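(* Let $G$ be a connected simple undirected graph on nodes $\{0,\dots,n\}$, and consider a Kuramoto network $(G,K,\omega)$ with generic coupling strengths $K=\{k_{ij}\}$ and natural frequencies $\omega$. Let $$c_k-\sum_{\{i,j\}\in E(G)} a_{ijk}\left(\frac{x_i}{x_j}-\frac{x_j}{x_i}\right)=0,\qquad k=1,\dots,n,\quad x_0=1,$$ be its unmixed synchronization system, and define $H(\mathbf{x},t)=(H_1,\dots,H_n)$ by $$H_k(\mathbf{x},t)=\frac{c_k}{t}-\sum_{\{i,j\}\in E(G)} a_{ijk}\left(\frac{x_i}{x_j}-\frac{x_j}{x_i}\right),\qquad k=1,\dots,n,$$ for $\mathbf{x}\in(\mathbb{C}\setminus\{0\})^n$, $t\in(0,1]$. Then the solution set of $H(\mathbf{x},t)=\mathbf{0}$ contains finitely many smooth curves parameterized by $t$ such that: (1) the set of limit points of these curves as $t\to1$ contains all isolated complex synchronization configurations of the network (isolated solutions in $(\mathbb{C}\setminus\{0\})^n$ of the unmixed synchronization system); and (2) for every facet $F$ of the adjacency polytope $\nabla_G$ and every complex solution $\mathbf{y}=(y_1,\dots,y_n)$ of the facet subsystem $c_k-\sum_{(i,j)\in\mathcal{E}_F} b_{k,(i,j)}\,x_i/x_j=0$ ($k=1,\dots,n$, $x_0=1$), there exists a curve defined by $H(\mathbf{x},t)=\mathbf{0}$ along which $x_i(t)=y_i t^{\alpha_i}+o(t)$ for some $\alpha_i\in\mathbb{Q}$, for all $t$ sufficiently close to $0$.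
   Context: The algebraic synchronization system of $(G,K,\omega)$ is $f_i:=\omega_i-\sum_{j\in\mathcal{N}_G(i)}\frac{k_{ij}}{2\sqrt{-1}}\left(\frac{x_i}{x_j}-\frac{x_j}{x_i}\right)=0$, $i=1,\dots,n$, with $x_0=1$ and $k_{ij}=k_{ji}$; its unmixed form is $M\mathbf{f}=\mathbf{0}$ for a nonsingular $n\times n$ matrix $M$, which has the displayed form with $c_k=\sum_i M_{ki}\omega_i$ and suitable coefficients $a_{ijk}$ (one term per undirected edge, with the orientation $(i,j)$ fixed for each edge). For a directed edge $(i,j)$, $b_{k,(i,j)}$ denotes the coefficient of the monomial $x_i/x_j$ in the $k$-th equation of the unmixed system (so $b_{k,(i,j)}=a_{ijk}$ and $b_{k,(j,i)}=-a_{ijk}$). Let $\mathbf{e}_1,\dots,\mathbf{e}_n$ be the standard basis of $\mathbb{R}^n$, $\mathbf{e}_0=\mathbf{0}$; the adjacency polytope is $\nabla_G=\operatorname{conv}\{\mathbf{e}_i-\mathbf{e}_j,\ \mathbf{e}_j-\mathbf{e}_i:\{i,j\}\in E(G)\}$; for a facet $F$ (face of dimension $n-1$), $\mathcal{E}_F=\{(i,j):\mathbf{e}_i-\mathbf{e}_j\in F\}$. "Generic" means outside a proper algebraic (measure-zero) subset of parameter space; in particular, arbitrarily small perturbations of any parameters are generic.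
   Formalization: The remainder in (2) is o(t^{α_i}), not o(t), which fails for n=1. Curves cover all of (0,1) off a proper real algebraic subset of complex parameters; off a proper complex algebraic subset (so for generic real networks) they may cover only subintervals ending at 1 or starting at 0. *)

theory Defs
  imports "HOL-Analysis.Analysis"
begin

(* The nodes 0, ..., n are the elements of 'n option: None is the reference node 0 and
   Some i, with i ranging over a finite type of n elements, are the other n nodes. *)

type_synonym 'n node = "'n option"

(* pairs (K, omega) of coupling strengths and natural frequencies *)
type_synonym 'n params = "(complex ^ 'n option ^ 'n option) \<times> (complex ^ 'n)"

definition simple_graph :: "('a \<times> 'a) set \<Rightarrow> bool" where
  "simple_graph E \<longleftrightarrow> sym E \<and> irrefl E"

definition connected_graph :: "('a \<times> 'a) set \<Rightarrow> bool" where
  "connected_graph E \<longleftrightarrow> (\<forall>i j. (i, j) \<in> E\<^sup>*)"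

definition orientation :: "('a \<times> 'a) set \<Rightarrow> ('a \<times> 'a) set \<Rightarrow> bool" where
  "orientation E D \<longleftrightarrow> D \<subseteq> E \<and> (\<forall>i j. (i, j) \<in> E \<longrightarrow> ((i, j) \<in> D \<longleftrightarrow> (j, i) \<notin> D))"

fun coord :: "complex ^ 'n \<Rightarrow> 'n::finite node \<Rightarrow> complex" where
  "coord x None = 1"
| "coord x (Some i) = x $ i"

definition torus :: "(complex ^ 'n::finite) set" where
  "torus = {x. \<forall>i. x $ i \<noteq> 0}"

definition sync ::
  "('n::finite node \<times> 'n node) set \<Rightarrow> complex ^ 'n node ^ 'n node \<Rightarrow> complex ^ 'n
    \<Rightarrow> complex ^ 'n \<Rightarrow> complex ^ 'n" where
  "sync E K \<omega> x =
    (\<chi> i. \<omega> $ i - (\<Sum>j | (Some i, j) \<in> E.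
        K $ Some i $ j / (2 * \<i>) * (coord x (Some i) / coord x j - coord x j / coord x (Some i))))"

definition unmixed ::
  "complex ^ 'n ^ 'n \<Rightarrow> ('n::finite node \<times> 'n node) set \<Rightarrow> complex ^ 'n node ^ 'n node
    \<Rightarrow> complex ^ 'n \<Rightarrow> complex ^ 'n \<Rightarrow> complex ^ 'n" where
  "unmixed M E K \<omega> x = M *v sync E K \<omega> x"

(* There is no equation for node 0, so its column in M counts as zero. *)
fun mcol :: "complex ^ 'n ^ 'n \<Rightarrow> 'n::finite \<Rightarrow> 'n node \<Rightarrow> complex" where
  "mcol M k None = 0"
| "mcol M k (Some i) = M $ k $ i"

(* An edge between i and j occurs in the equations of both of its end points, with opposite
   signs. The lemma unmixed_eq below confirms that these are the coefficients a_ijk of M f. *)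
definition acoef ::
  "complex ^ 'n ^ 'n \<Rightarrow> complex ^ 'n node ^ 'n node \<Rightarrow> 'n::finite node \<Rightarrow> 'n node \<Rightarrow> 'n \<Rightarrow> complex"
  where
  "acoef M K i j k = (mcol M k i - mcol M k j) * (K $ i $ j / (2 * \<i>))"

definition ccoef :: "complex ^ 'n ^ 'n \<Rightarrow> complex ^ 'n \<Rightarrow> 'n::finite \<Rightarrow> complex" where
  "ccoef M \<omega> k = (\<Sum>i\<in>UNIV. M $ k $ i * \<omega> $ i)"

(* the displayed form, with one term per undirected edge, oriented according to D *)
definition homotopy ::
  "complex ^ 'n ^ 'n \<Rightarrow> ('n::finite node \<times> 'n node) set \<Rightarrow> complex ^ 'n node ^ 'n node
    \<Rightarrow> complex ^ 'n \<Rightarrow> complex ^ 'n \<Rightarrow> real \<Rightarrow> complex ^ 'n" where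
  "homotopy M D K \<omega> x t =
    (\<chi> k. ccoef M \<omega> k / of_real t
       - (\<Sum>(i, j)\<in>D. acoef M K i j k * (coord x i / coord x j - coord x j / coord x i)))"

definition bcoef ::
  "complex ^ 'n ^ 'n \<Rightarrow> ('n::finite node \<times> 'n node) set \<Rightarrow> complex ^ 'n node ^ 'n node
    \<Rightarrow> 'n \<Rightarrow> 'n node \<times> 'n node \<Rightarrow> complex" where
  "bcoef M D K k = (\<lambda>(i, j).
     if (i, j) \<in> D then acoef M K i j k
     else if (j, i) \<in> D then - acoef M K j i k
     else 0)"

fun unit_vec :: "'n::finite node \<Rightarrow> real ^ 'n" where
  "unit_vec None = 0"
| "unit_vec (Some i) = axis i 1"

definition adjacency_polytope :: "('n::finite node \<times> 'n node) set \<Rightarrow> (real ^ 'n) set" where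
  "adjacency_polytope E = convex hull {unit_vec i - unit_vec j | i j. (i, j) \<in> E}"

definition facet_edges :: "(real ^ 'n::finite) set \<Rightarrow> ('n node \<times> 'n node) set" where
  "facet_edges F = {(i, j). unit_vec i - unit_vec j \<in> F}"

definition facet_system ::
  "complex ^ 'n ^ 'n \<Rightarrow> ('n::finite node \<times> 'n node) set \<Rightarrow> complex ^ 'n node ^ 'n node
    \<Rightarrow> complex ^ 'n \<Rightarrow> (real ^ 'n) set \<Rightarrow> complex ^ 'n \<Rightarrow> complex ^ 'n" where
  "facet_system M D K \<omega> F x =
    (\<chi> k. ccoef M \<omega> k
       - (\<Sum>(i, j)\<in>facet_edges F. bcoef M D K k (i, j) * (coord x i / coord x j)))"

(* C^infinity, witnessed by the sequence of all derivatives *)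
definition smooth_curve_on :: "real set \<Rightarrow> (real \<Rightarrow> 'a::real_normed_vector) \<Rightarrow> bool" where
  "smooth_curve_on J \<gamma> \<longleftrightarrow>
    (\<exists>d. d 0 = \<gamma> \<and> (\<forall>m::nat. \<forall>t\<in>J. (d m has_vector_derivative d (Suc m) t) (at t)))"

(* (a, b, \<gamma>) is a curve in the solution set, parameterized by t in the open interval from a to b *)
definition solution_curve ::
  "complex ^ 'n ^ 'n \<Rightarrow> ('n::finite node \<times> 'n node) set \<Rightarrow> complex ^ 'n node ^ 'n node
    \<Rightarrow> complex ^ 'n \<Rightarrow> real \<times> real \<times> (real \<Rightarrow> complex ^ 'n) \<Rightarrow> bool" where
  "solution_curve M D K \<omega> = (\<lambda>(a, b, \<gamma>).
     smooth_curve_on {a<..<b} \<gamma> \<and>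
     (\<forall>t\<in>{a<..<b}. \<gamma> t \<in> torus \<and> homotopy M D K \<omega> (\<gamma> t) t = 0))"

definition reaches_sync_configs ::
  "complex ^ 'n ^ 'n \<Rightarrow> ('n::finite node \<times> 'n node) set \<Rightarrow> complex ^ 'n node ^ 'n node
    \<Rightarrow> complex ^ 'n \<Rightarrow> (real \<times> real \<times> (real \<Rightarrow> complex ^ 'n)) set \<Rightarrow> bool" where
  "reaches_sync_configs M E K \<omega> \<Gamma> \<longleftrightarrow>
    (\<forall>z. z isolated_in {x \<in> torus. unmixed M E K \<omega> x = 0} \<longrightarrow>
      (\<exists>a \<gamma>. (a, 1, \<gamma>) \<in> \<Gamma> \<and> (\<gamma> \<longlongrightarrow> z) (at_left 1)))"

(* The error term is relative to the leading term t^\<alpha>_i: with an absolute error o(t) the expansion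
   already fails for two nodes, where the solutions are x = y/t + t/y + ... and its counterpart. *)
definition reaches_facet_solutions ::
  "complex ^ 'n ^ 'n \<Rightarrow> ('n::finite node \<times> 'n node) set \<Rightarrow> ('n node \<times> 'n node) set
    \<Rightarrow> complex ^ 'n node ^ 'n node \<Rightarrow> complex ^ 'n
    \<Rightarrow> (real \<times> real \<times> (real \<Rightarrow> complex ^ 'n)) set \<Rightarrow> bool" where
  "reaches_facet_solutions M E D K \<omega> \<Gamma> \<longleftrightarrow>
    (\<forall>F y. F facet_of adjacency_polytope E \<and> y \<in> torus \<and> facet_system M D K \<omega> F y = 0 \<longrightarrow>
      (\<exists>b \<gamma>. (0, b, \<gamma>) \<in> \<Gamma> \<and>
        (\<exists>\<alpha> :: 'n \<Rightarrow> rat. \<forall>i.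
          (\<lambda>t. \<gamma> t $ i - y $ i * of_real (t powr of_rat (\<alpha> i)))
            \<in> o[at_right 0](\<lambda>t. of_real (t powr of_rat (\<alpha> i))))))"

(* the conclusion about one network, with U the set of intervals on which curves may be defined *)
definition has_solution_curves ::
  "(real \<times> real) set \<Rightarrow> ('n::finite node \<times> 'n node) set \<Rightarrow> complex ^ 'n node ^ 'n node
    \<Rightarrow> complex ^ 'n \<Rightarrow> complex ^ 'n ^ 'n \<Rightarrow> ('n node \<times> 'n node) set \<Rightarrow> bool" where
  "has_solution_curves U E K \<omega> M D \<longleftrightarrow>
    (\<exists>\<Gamma>. finite \<Gamma> \<and>
      (\<forall>(a, b, \<gamma>)\<in>\<Gamma>. (a, b) \<in> U \<and> solution_curve M D K \<omega> (a, b, \<gamma>)) \<and>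
      reaches_sync_configs M E K \<omega> \<Gamma> \<and>
      reaches_facet_solutions M E D K \<omega> \<Gamma>)"

definition param_space :: "('n::finite node \<times> 'n node) set \<Rightarrow> 'n params set" where
  "param_space E =
    {(K, \<omega>). (\<forall>i j. K $ i $ j = K $ j $ i) \<and> (\<forall>i j. (i, j) \<notin> E \<longrightarrow> K $ i $ j = 0)}"

inductive complex_polynomial :: "('n::finite params \<Rightarrow> complex) \<Rightarrow> bool" where
  coupling: "complex_polynomial (\<lambda>p. fst p $ i $ j)"
| frequency: "complex_polynomial (\<lambda>p. snd p $ i)"
| const: "complex_polynomial (\<lambda>p. c)"
| add: "complex_polynomial f \<Longrightarrow> complex_polynomial g \<Longrightarrow> complex_polynomial (\<lambda>p. f p + g p)"
| mult: "complex_polynomial f \<Longrightarrow> complex_polynomial g \<Longrightarrow> complex_polynomial (\<lambda>p. f p * g p)"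

(* Outside a proper complex algebraic subset of the parameter space. A polynomial that is not
   identically zero there does not vanish identically at its real points either, so this
   includes the generic real networks. *)
definition generic_complex_alg ::
  "('n::finite node \<times> 'n node) set \<Rightarrow> ('n params \<Rightarrow> bool) \<Rightarrow> bool" where
  "generic_complex_alg E Q \<longleftrightarrow>
    (\<exists>P. complex_polynomial P \<and> (\<exists>p\<in>param_space E. P p \<noteq> 0) \<and>
      (\<forall>p\<in>param_space E. P p \<noteq> 0 \<longrightarrow> Q p))"

(* Outside a proper real algebraic subset of the (complex) parameter space, regarded as a real
   vector space: polynomials in the real and imaginary parts of all parameters. *)
definition generic_real_alg ::
  "('n::finite node \<times> 'n node) set \<Rightarrow> ('n params \<Rightarrow> bool) \<Rightarrow> bool" where
  "generic_real_alg E Q \<longleftrightarrow>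
    (\<exists>P. real_polynomial_function P \<and> (\<exists>p\<in>param_space E. P p \<noteq> 0) \<and>
      (\<forall>p\<in>param_space E. P p \<noteq> 0 \<longrightarrow> Q p))"

lemma sum_orientation:
  fixes g :: "'n::finite node \<Rightarrow> 'n node \<Rightarrow> complex"
  assumes "simple_graph E" "orientation E D"
  shows "(\<Sum>(i, j)\<in>E. g i j) = (\<Sum>(i, j)\<in>D. g i j + g j i)"
proof -
  have "(i, j) \<in> E \<longleftrightarrow> (i, j) \<in> D \<or> (j, i) \<in> D" for i j
    using assms unfolding simple_graph_def orientation_def by (meson subsetD symD)
  then have E: "E = D \<union> prod.swap ` D"
    by force
  have "(j, i) \<notin> D" if "(i, j) \<in> D" for i j
    using assms that unfolding orientation_def by blast
  then have "D \<inter> prod.swap ` D = {}"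
    by force
  then have "(\<Sum>(i, j)\<in>E. g i j) = (\<Sum>(i, j)\<in>D. g i j) + (\<Sum>(i, j)\<in>prod.swap ` D. g i j)"
    unfolding E by (intro sum.union_disjoint) auto
  also have "(\<Sum>(i, j)\<in>prod.swap ` D. g i j) = (\<Sum>(i, j)\<in>D. g j i)"
    by (subst sum.reindex) (auto simp: case_prod_unfold)
  finally show ?thesis
    by (simp add: case_prod_unfold sum.distrib)
qed

lemma unmixed_eq:
  assumes E: "simple_graph E" and D: "orientation E D" and p: "(K, \<omega>) \<in> param_space E"
  shows "unmixed M E K \<omega> x = homotopy M D K \<omega> x 1"
proof -
  define h where "h i j = K $ i $ j / (2 * \<i>) * (coord x i / coord x j - coord x j / coord x i)"
    for i j
  have hs: "h j i = - h i j" for i j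
  proof -
    have "K $ j $ i = K $ i $ j"
      using p unfolding param_space_def by blast
    then show ?thesis
      by (simp only: h_def minus_mult_right minus_diff_eq)
  qed
  have "(\<Sum>i\<in>UNIV. M $ k $ i * (\<Sum>j | (Some i, j) \<in> E. h (Some i) j))
      = (\<Sum>(i, j)\<in>D. acoef M K i j k * (coord x i / coord x j - coord x j / coord x i))" for k
  proof -
    have "(\<Sum>i\<in>UNIV. M $ k $ i * (\<Sum>j | (Some i, j) \<in> E. h (Some i) j))
        = (\<Sum>i\<in>UNIV. mcol M k i * (\<Sum>j | (i, j) \<in> E. h i j))"
      by (simp add: UNIV_option_conv sum.reindex)
    also have "\<dots> = (\<Sum>(i, j)\<in>Sigma UNIV (\<lambda>i. {j. (i, j) \<in> E}). mcol M k i * h i j)"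
      by (simp add: sum_distrib_left sum.Sigma)
    also have "Sigma UNIV (\<lambda>i. {j. (i, j) \<in> E}) = E"
      by auto
    also have "(\<Sum>(i, j)\<in>E. mcol M k i * h i j)
        = (\<Sum>(i, j)\<in>D. mcol M k i * h i j + mcol M k j * h j i)"
      by (rule sum_orientation[OF E D])
    also have "\<dots> = (\<Sum>(i, j)\<in>D. acoef M K i j k * (coord x i / coord x j - coord x j / coord x i))"
    proof (intro sum.cong refl, clarify)
      fix i j
      have "mcol M k i * h i j + mcol M k j * h j i = (mcol M k i - mcol M k j) * h i j"
        unfolding hs[of j i] by (simp only: left_diff_distrib mult_minus_right add_uminus_conv_diff)
      then show "mcol M k i * h i j + mcol M k j * h j i
          = acoef M K i j k * (coord x i / coord x j - coord x j / coord x i)"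
        by (simp only: acoef_def h_def mult.assoc)
    qed
    finally show ?thesis .
  qed
  moreover have "(\<Sum>i\<in>UNIV. M $ k $ i * (\<omega> $ i - S i))
      = (\<Sum>i\<in>UNIV. M $ k $ i * \<omega> $ i) - (\<Sum>i\<in>UNIV. M $ k $ i * S i)" for k S
    by (simp only: right_diff_distrib sum_subtractf)
  ultimately show ?thesis
    by (simp only: unmixed_def homotopy_def sync_def ccoef_def matrix_vector_mult_def vec_eq_iff
        vec_lambda_beta h_def[symmetric] of_real_1 div_by_1 simp_thms)
qed

end

theory Submission
  imports Defs "Subresultants.Subresultant_Gcd" "HOL-Computational_Algebra.Field_as_Ring"
    "HOL-Computational_Algebra.Fundamental_Theorem_Algebra"
begin

text \<open>For a nonsingular \<open>M\<close> the equations say that \<open>t \<Phi>(x) = \<omega>\<close>, where \<open>\<Phi>\<close> collects the coupling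
  terms. In logarithmic coordinates the Jacobian of \<open>\<Phi>\<close> is a weighted graph Laplacian with the row and
  column of the reference node removed. It is nonsingular at one point because the graph is connected,
  so, by counting monomials, the values of the parameters at singular solutions satisfy a nontrivial
  polynomial relation. The same count shows that the coordinates of a solution and their inverses are
  roots of polynomials over the parameters; where the leading coefficients do not vanish, the solutions
  stay in a compact part of the torus. Hence for generic parameters all solutions are nondegenerate,
  and the inverse function theorem provides the branches near \<open>t = 1\<close>.

  A facet of the adjacency polytope has an integral potential \<open>\<alpha>\<close> on the nodes. After the
  substitution \<open>x\<^sub>i = u\<^sub>i t powi \<alpha>\<^sub>i\<close> the system extends to \<open>t = 0\<close> and becomes the facet system there,
  which is of the same form for a connected subgraph, hence generically nondegenerate as well.

  If the excluded polynomial has no zero on the ray \<open>s \<mapsto> (K, s \<omega>)\<close> with \<open>s > 0\<close>, all branches continue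
  to \<open>0 < t\<close>. A polynomial in \<open>s\<close> has a real zero only if it has a zero in common with its complex
  conjugate, so the bad parameters lie in the zero set of a resultant, a real polynomial.\<close>

no_notation Matrix.vec_index (infixl "$" 100) and Matrix.scalar_prod (infix "\<bullet>" 70)
hide_const (open) Determinant.det Matrix.unit_vec Module.smult
hide_fact (open) Determinant.det_def Matrix.vec_eq_iff

section \<open>Elimination for polynomial functions\<close>

text \<open>Nondegeneracy alone does not suffice for continuation: a branch can also leave the
  torus, with a coordinate tending to 0 or infinity. Counting settles both questions because the
  flow components and the edge variables are exactly as many as the unknowns. Such functions need
  not be related, but on the zero set of one more nonzero function \<open>J\<close> they must be.
  For regularity \<open>J\<close> is the Laplacian determinant; for boundedness it ties an extra
  unknown to a coordinate or to its inverse. The substitution at a facet removes the singularity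
  because the term of an edge in \<open>t \<Phi>(x)\<close> acquires the exponent
  \<open>1 + \<alpha>\<^sub>i - \<alpha>\<^sub>j\<close>, which is 0, 1 or 2. So
  \<open>t = 0\<close> becomes an interior point for the inverse function theorem. A positive zero
  of \<open>s \<mapsto> P (K, s \<omega>)\<close> is in general a condition of real codimension one,
  too large for a proper complex algebraic set. Hence complex genericity yields curves near the two
  ends, and real genericity yields curves on all of (0, 1). The resultant is not identically zero
  because a unimodular factor on \<omega> rotates the roots in \<open>s\<close> and can separate
  them from their conjugates.\<close>

definition monom_fun :: "'v set \<Rightarrow> ('v \<Rightarrow> nat) \<Rightarrow> ('v \<Rightarrow> complex) \<Rightarrow> complex" where
  "monom_fun V a y = (\<Prod>v\<in>V. y v ^ a v)"

definition exponents :: "'v set \<Rightarrow> nat \<Rightarrow> ('v \<Rightarrow> nat) set" where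
  "exponents V N = PiE V (\<lambda>_. {..N})"

text \<open>The degree is bounded in each variable separately: the monomials are then simply
  counted, and the bounds add under multiplication. Polynomials appear as functions, without a type
  of multivariate polynomials.\<close>

definition boxpol :: "'v set \<Rightarrow> nat \<Rightarrow> (('v \<Rightarrow> complex) \<Rightarrow> complex) \<Rightarrow> bool" where
  "boxpol V N f \<longleftrightarrow> (\<exists>c. \<forall>y. f y = (\<Sum>a\<in>exponents V N. c a * monom_fun V a y))"

lemma finite_exponents: "finite V \<Longrightarrow> finite (exponents V N)"
  unfolding exponents_def by (intro finite_PiE) auto

lemma card_exponents: "finite V \<Longrightarrow> card (exponents V N) = (N + 1) ^ card V"
  by (simp add: exponents_def card_PiE)

lemma boxpol_monomial:
  assumes "finite V" "\<And>v. v \<in> V \<Longrightarrow> a v \<le> N"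
  shows "boxpol V N (monom_fun V a)"
proof -
  let ?r = "restrict a V"
  have r: "?r \<in> exponents V N"
    using assms by (auto simp: exponents_def)
  have "monom_fun V a y = (\<Sum>b\<in>exponents V N. (if b = ?r then 1 else 0) * monom_fun V b y)" for y
  proof -
    have "(\<Sum>b\<in>exponents V N. (if b = ?r then 1 else 0) * monom_fun V b y) = monom_fun V ?r y"
      using r finite_exponents[OF assms(1)] by (simp add: if_distrib[of "\<lambda>x. x * _"] cong: if_cong)
    then show ?thesis
      by (simp add: monom_fun_def)
  qed
  then show ?thesis
    unfolding boxpol_def by (intro exI[of _ "\<lambda>b. if b = ?r then 1 else 0"]) blast
qed

lemma boxpol_zero: "boxpol V N (\<lambda>y. 0)"
  unfolding boxpol_def by (intro exI[of _ "\<lambda>_. 0"]) simp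

lemma boxpol_add:
  assumes "boxpol V N f" "boxpol V N g"
  shows "boxpol V N (\<lambda>y. f y + g y)"
proof -
  obtain c d where "\<forall>y. f y = (\<Sum>a\<in>exponents V N. c a * monom_fun V a y)"
    "\<forall>y. g y = (\<Sum>a\<in>exponents V N. d a * monom_fun V a y)"
    using assms unfolding boxpol_def by blast
  then show ?thesis
    unfolding boxpol_def
    by (intro exI[of _ "\<lambda>a. c a + d a"]) (simp add: distrib_right sum.distrib)
qed

lemma boxpol_cmult:
  assumes "boxpol V N f"
  shows "boxpol V N (\<lambda>y. k * f y)"
proof -
  obtain c where "\<forall>y. f y = (\<Sum>a\<in>exponents V N. c a * monom_fun V a y)"
    using assms unfolding boxpol_def by blast
  then show ?thesis
    unfolding boxpol_def
    by (intro exI[of _ "\<lambda>a. k * c a"]) (simp add: sum_distrib_left mult.assoc)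
qed

lemma boxpol_sum:
  assumes "\<And>i. i \<in> I \<Longrightarrow> boxpol V N (f i)"
  shows "boxpol V N (\<lambda>y. \<Sum>i\<in>I. f i y)"
proof (cases "finite I")
  case True
  from this assms show ?thesis
    by (induction I rule: finite_induct) (auto intro: boxpol_add boxpol_zero)
qed (simp add: boxpol_zero)

lemma boxpol_mult:
  assumes V: "finite V" and f: "boxpol V N f" and g: "boxpol V M g"
  shows "boxpol V (N + M) (\<lambda>y. f y * g y)"
proof -
  obtain c d where c: "\<And>y. f y = (\<Sum>a\<in>exponents V N. c a * monom_fun V a y)"
    and d: "\<And>y. g y = (\<Sum>a\<in>exponents V M. d a * monom_fun V a y)"
    using f g unfolding boxpol_def by blast
  have "f y * g y = (\<Sum>a\<in>exponents V N. \<Sum>b\<in>exponents V M. (c a * d b) * monom_fun V (\<lambda>v. a v + b v) y)" for y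
    unfolding c d sum_product
    by (intro sum.cong refl) (simp add: monom_fun_def power_add prod.distrib)
  moreover have "boxpol V (N + M) (\<lambda>y. \<Sum>a\<in>exponents V N. \<Sum>b\<in>exponents V M. (c a * d b) * monom_fun V (\<lambda>v. a v + b v) y)"
    by (intro boxpol_sum boxpol_cmult boxpol_monomial[OF V] add_mono) (auto simp: exponents_def)
  ultimately show ?thesis
    by presburger
qed

lemma boxpol_mono:
  assumes "finite V" "boxpol V N f" "N \<le> M"
  shows "boxpol V M f"
proof -
  obtain c where c: "f = (\<lambda>y. \<Sum>a\<in>exponents V N. c a * monom_fun V a y)"
    using assms(2) unfolding boxpol_def by blast
  show ?thesis
    unfolding c using assms(3)
    by (intro boxpol_sum boxpol_cmult boxpol_monomial[OF assms(1)]) (force simp: exponents_def)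
qed

lemma boxpol_const: "finite V \<Longrightarrow> boxpol V N (\<lambda>y. k)"
  using boxpol_cmult[OF boxpol_monomial[of V "\<lambda>_. 0" N], of k] by (simp add: monom_fun_def)

lemma boxpol_var: "finite V \<Longrightarrow> v \<in> V \<Longrightarrow> boxpol V 1 (\<lambda>y. y v)"
proof -
  assume V: "finite V" "v \<in> V"
  have "monom_fun V (\<lambda>w. if w = v then 1 else 0) = (\<lambda>y. y v)"
    using V by (simp add: monom_fun_def if_distrib[of "\<lambda>k. _ ^ k"] prod.delta fun_eq_iff cong: if_cong)
  then show ?thesis
    using boxpol_monomial[of V "\<lambda>w. if w = v then 1 else 0" 1] V by simp
qed

lemma boxpol_power:
  assumes "finite V" "boxpol V N f"
  shows "boxpol V (k * N) (\<lambda>y. f y ^ k)"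
  by (induction k) (auto intro: boxpol_const boxpol_mult assms)

lemma boxpol_prod:
  assumes "finite V" "finite I" "\<And>i. i \<in> I \<Longrightarrow> boxpol V N (f i)"
  shows "boxpol V (card I * N) (\<lambda>y. \<Prod>i\<in>I. f i y)"
  using assms(2,3)
  by (induction I rule: finite_induct) (auto intro: boxpol_const boxpol_mult assms(1))

text \<open>Collecting by powers of one variable is what permits induction on the number of
  variables, and later the passage to the leading coefficient in the extra unknown.\<close>

lemma sum_exponents_insert:
  assumes V: "finite V" and v: "v \<notin> V"
  shows "(\<Sum>a\<in>exponents (insert v V) N. c a * monom_fun (insert v V) a (y(v := \<zeta>)))
    = (\<Sum>l\<le>N. (\<Sum>b\<in>exponents V N. c (b(v := l)) * monom_fun V b y) * \<zeta> ^ l)"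
proof -
  have "(\<Sum>a\<in>exponents (insert v V) N. c a * monom_fun (insert v V) a (y(v := \<zeta>)))
      = (\<Sum>(l, b)\<in>{..N} \<times> exponents V N. c (b(v := l)) * monom_fun (insert v V) (b(v := l)) (y(v := \<zeta>)))"
    unfolding exponents_def PiE_insert_eq
    by (subst sum.reindex[OF inj_combinator[OF v]]) (simp add: case_prod_unfold o_def)
  also have "\<dots> = (\<Sum>(l, b)\<in>{..N} \<times> exponents V N. c (b(v := l)) * monom_fun V b y * \<zeta> ^ l)"
  proof (intro sum.cong refl, clarify)
    fix l b
    have "monom_fun (insert v V) (b(v := l)) (y(v := \<zeta>)) = \<zeta> ^ l * (\<Prod>w\<in>V. (y(v := \<zeta>)) w ^ (b(v := l)) w)"
      using V v by (simp add: monom_fun_def)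
    also have "(\<Prod>w\<in>V. (y(v := \<zeta>)) w ^ (b(v := l)) w) = monom_fun V b y"
      unfolding monom_fun_def using v by (intro prod.cong) auto
    finally show "c (b(v := l)) * monom_fun (insert v V) (b(v := l)) (y(v := \<zeta>))
        = c (b(v := l)) * monom_fun V b y * \<zeta> ^ l"
      by (simp only: mult.commute mult.left_commute)
  qed
  also have "\<dots> = (\<Sum>l\<le>N. \<Sum>b\<in>exponents V N. c (b(v := l)) * monom_fun V b y * \<zeta> ^ l)"
    by (simp add: sum.cartesian_product)
  finally show ?thesis
    by (simp add: sum_distrib_right)
qed

text \<open>With the other variables fixed, the sum is a polynomial in the value of \<open>v\<close>
  with infinitely many zeros. So each of its coefficients vanishes, identically in the other
  variables, and the induction applies to it.\<close>

lemma coeff_zero_if_sum_zero: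
  assumes "finite V" "\<And>y. (\<Sum>a\<in>exponents V N. c a * monom_fun V a y) = 0" "a \<in> exponents V N"
  shows "c a = (0::complex)"
  using assms
proof (induction V arbitrary: c a rule: finite_induct)
  case empty
  then show ?case by (simp add: exponents_def monom_fun_def)
next
  case (insert v V)
  have "(\<Sum>b\<in>exponents V N. c (b(v := l)) * monom_fun V b y) = 0" if "l \<le> N" for l y
  proof -
    have "(\<Sum>l\<le>N. (\<Sum>b\<in>exponents V N. c (b(v := l)) * monom_fun V b y) * \<zeta> ^ l) = 0" for \<zeta>
      using insert.prems(1)[of "y(v := \<zeta>)"] sum_exponents_insert[OF insert.hyps(1,2), where c = c and N = N and y = y and \<zeta> = \<zeta>] by metis
    then show ?thesis
      using that polyfun_eq_0[of "\<lambda>l. \<Sum>b\<in>exponents V N. c (b(v := l)) * monom_fun V b y" N] by simp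
  qed
  then have "c (b(v := l)) = 0" if "l \<le> N" "b \<in> exponents V N" for l b
    using insert.IH[of "\<lambda>b. c (b(v := l))" b] that by blast
  moreover obtain l b where "a = b(v := l)" "l \<le> N" "b \<in> exponents V N"
    using insert.prems(2) unfolding exponents_def PiE_insert_eq by auto
  ultimately show ?case
    by blast
qed

lemma boxpol_on_line:
  assumes "finite V" "boxpol V N f"
  shows "\<exists>r. \<forall>s. f (\<lambda>v. p v + s * d v) = poly r s"
proof -
  obtain c where c: "\<And>y. f y = (\<Sum>a\<in>exponents V N. c a * monom_fun V a y)"
    using assms(2) unfolding boxpol_def by blast
  have "f (\<lambda>v. p v + s * d v)
      = poly (\<Sum>a\<in>exponents V N. smult (c a) (\<Prod>v\<in>V. [:p v, d v:] ^ a v)) s" for s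
    by (simp add: c monom_fun_def poly_sum poly_prod)
  then show ?thesis
    by blast
qed

text \<open>On the complex line through \<open>p\<close> and \<open>q\<close> both functions
  restrict to nonzero polynomials in one variable, whose product has a non-root.\<close>

lemma boxpol_mult_nonzero:
  assumes V: "finite V" and f: "boxpol V N f" and g: "boxpol V M g" and p: "f p \<noteq> 0" and q: "g q \<noteq> 0"
  shows "\<exists>y. f y \<noteq> 0 \<and> g y \<noteq> 0"
proof -
  obtain r r' where r: "\<And>s. f (\<lambda>v. p v + s * (q v - p v)) = poly r s"
    and r': "\<And>s. g (\<lambda>v. p v + s * (q v - p v)) = poly r' s"
    using boxpol_on_line[OF V f, of p "\<lambda>v. q v - p v"] boxpol_on_line[OF V g, of p "\<lambda>v. q v - p v"]
    by blast
  have "r \<noteq> 0" "r' \<noteq> 0"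
    using r[of 0] p r'[of 1] q by auto
  then have "r * r' \<noteq> 0"
    by simp
  then obtain s where "poly (r * r') s \<noteq> 0"
    using poly_all_0_iff_0 by blast
  then show ?thesis
    using r[of s] r'[of s] by (intro exI[of _ "\<lambda>v. p v + s * (q v - p v)"]) auto
qed

section \<open>Dimension counting\<close>

text \<open>Gaussian elimination: a pivot \<open>p\<close> with \<open>c p w \<noteq> 0\<close>
  solves the equation \<open>w\<close> for the unknown \<open>l p\<close>, which removes one
  equation and one unknown.\<close>

lemma underdetermined_linear_system:
  fixes c :: "'a \<Rightarrow> 'w \<Rightarrow> 'f::field"
  assumes "finite W" "finite A" "card W < card A"
  shows "\<exists>l. (\<exists>a\<in>A. l a \<noteq> 0) \<and> (\<forall>w\<in>W. (\<Sum>a\<in>A. l a * c a w) = 0)"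
  using assms
proof (induction W arbitrary: A c rule: finite_induct)
  case empty
  then have "A \<noteq> {}" by auto
  then show ?case by (intro exI[of _ "\<lambda>_. 1"]) auto
next
  case (insert w W)
  show ?case
  proof (cases "\<forall>a\<in>A. c a w = 0")
    case True
    then show ?thesis
      using insert.IH[of A c] insert.prems insert.hyps by auto
  next
    case False
    then obtain p where p: "p \<in> A" "c p w \<noteq> 0" by blast
    define c' where "c' a x = c a x - c a w / c p w * c p x" for a x
    have "card W < card (A - {p})"
      using insert.prems insert.hyps p by simp
    then obtain l where l: "\<exists>a\<in>A - {p}. l a \<noteq> 0" "\<forall>x\<in>W. (\<Sum>a\<in>A - {p}. l a * c' a x) = 0"
      using insert.IH[of "A - {p}" c'] insert.prems by blast
    define m where "m a = (if a = p then - (\<Sum>a\<in>A - {p}. l a * c a w) / c p w else l a)" for a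
    have m: "(\<Sum>a\<in>A. m a * c a x) = (\<Sum>a\<in>A - {p}. l a * c' a x)" for x
    proof -
      have "(\<Sum>a\<in>A. m a * c a x) = m p * c p x + (\<Sum>a\<in>A - {p}. m a * c a x)"
        using p insert.prems by (simp add: sum.remove)
      also have "(\<Sum>a\<in>A - {p}. m a * c a x) = (\<Sum>a\<in>A - {p}. l a * c a x)"
        by (intro sum.cong) (auto simp: m_def)
      finally show ?thesis
        by (simp add: m_def c'_def right_diff_distrib sum_subtractf sum_divide_distrib sum_distrib_right
            sum_negf mult.assoc)
    qed
    have "(\<Sum>a\<in>A. m a * c a x) = 0" if "x \<in> insert w W" for x
    proof (cases "x = w")
      case True
      then show ?thesis
        using p by (simp add: m c'_def)
    qed (use that l m in auto)
    moreover have "\<exists>a\<in>A. m a \<noteq> 0"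
      using l by (auto simp: m_def)
    ultimately show ?thesis
      by blast
  qed
qed

text \<open>With \<open>y + z = L + 1\<close> and \<open>z = \<delta>\<close> this bounds the number
  of monomials lost when the degree bound drops from \<open>L\<close> to
  \<open>L - \<delta>\<close>; the loss is of order \<open>d - 1\<close> in
  \<open>L\<close>.\<close>

lemma power_add_le: "(y + z :: nat) ^ d \<le> y ^ d + d * z * (y + z) ^ (d - 1)"
proof (induction d)
  case (Suc d)
  show ?case
  proof (cases d)
    case (Suc k)
    have "(y + z) ^ Suc d \<le> (y + z) * (y ^ d + d * z * (y + z) ^ (d - 1))"
      using Suc.IH by simp
    also have "\<dots> = y ^ Suc d + z * y ^ d + d * z * (y + z) ^ d"
      using Suc by (simp add: algebra_simps)
    also have "z * y ^ d \<le> z * (y + z) ^ d"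
      by (simp add: power_mono)
    finally show ?thesis
      by (simp add: algebra_simps)
  qed auto
qed auto

section \<open>Polynomials with powers of a fixed denominator\<close>

text \<open>Agreement is demanded only where \<open>q\<close> does not vanish, so the values that
  division by zero produces elsewhere do not matter.\<close>

definition laurent :: "'v set \<Rightarrow> (('v \<Rightarrow> complex) \<Rightarrow> complex) \<Rightarrow> (('v \<Rightarrow> complex) \<Rightarrow> complex) \<Rightarrow> bool" where
  "laurent V q f \<longleftrightarrow> (\<exists>N M h. boxpol V M h \<and> (\<forall>y. q y \<noteq> 0 \<longrightarrow> f y = h y / q y ^ N))"

locale denominator =
  fixes V :: "'v set" and q :: "('v \<Rightarrow> complex) \<Rightarrow> complex" and Nq :: nat
  assumes finite_vars: "finite V" and boxpol_denominator: "boxpol V Nq q"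
begin

lemma laurent_boxpol: "boxpol V M f \<Longrightarrow> laurent V q f"
  unfolding laurent_def by (intro exI[of _ 0] exI[of _ M] exI[of _ f]) simp

lemma laurent_const: "laurent V q (\<lambda>y. k)"
  by (rule laurent_boxpol[OF boxpol_const[OF finite_vars]])

lemma laurent_var: "v \<in> V \<Longrightarrow> laurent V q (\<lambda>y. y v)"
  by (rule laurent_boxpol[OF boxpol_var[OF finite_vars]])

lemma laurent_divide_denominator: "boxpol V M h \<Longrightarrow> laurent V q (\<lambda>y. h y / q y)"
  unfolding laurent_def by (intro exI[of _ 1] exI[of _ M] exI[of _ h]) simp

lemma laurent_common_power:
  assumes "boxpol V M h" "\<forall>y. q y \<noteq> 0 \<longrightarrow> f y = h y / q y ^ N" "N \<le> N'"
  shows "\<exists>M' h'. boxpol V M' h' \<and> (\<forall>y. q y \<noteq> 0 \<longrightarrow> f y = h' y / q y ^ N')"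
proof (intro exI conjI)
  show "boxpol V (M + (N' - N) * Nq) (\<lambda>y. h y * q y ^ (N' - N))"
    by (intro boxpol_mult boxpol_power assms finite_vars boxpol_denominator)
  show "\<forall>y. q y \<noteq> 0 \<longrightarrow> f y = (h y * q y ^ (N' - N)) / q y ^ N'"
    using assms(2,3) by (simp add: power_diff)
qed

lemma laurent_add:
  assumes "laurent V q f" "laurent V q g"
  shows "laurent V q (\<lambda>y. f y + g y)"
proof -
  obtain N M h N' M' h' where f: "boxpol V M h" "\<forall>y. q y \<noteq> 0 \<longrightarrow> f y = h y / q y ^ N"
    and g: "boxpol V M' h'" "\<forall>y. q y \<noteq> 0 \<longrightarrow> g y = h' y / q y ^ N'"
    using assms unfolding laurent_def by blast
  define k where "k = max N N'"
  obtain M1 h1 M2 h2 where *: "boxpol V M1 h1" "\<forall>y. q y \<noteq> 0 \<longrightarrow> f y = h1 y / q y ^ k"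
    "boxpol V M2 h2" "\<forall>y. q y \<noteq> 0 \<longrightarrow> g y = h2 y / q y ^ k"
    using laurent_common_power[OF f, of k] laurent_common_power[OF g, of k] by (auto simp: k_def)
  have "boxpol V (max M1 M2) (\<lambda>y. h1 y + h2 y)"
    by (intro boxpol_add) (use * in \<open>auto intro: boxpol_mono[OF finite_vars]\<close>)
  then show ?thesis
    unfolding laurent_def using *
    by (intro exI[of _ k] exI[of _ "max M1 M2"] exI[of _ "\<lambda>y. h1 y + h2 y"]) (auto simp: add_divide_distrib)
qed

lemma laurent_mult:
  assumes "laurent V q f" "laurent V q g"
  shows "laurent V q (\<lambda>y. f y * g y)"
proof -
  obtain N M h N' M' h' where *: "boxpol V M h" "\<forall>y. q y \<noteq> 0 \<longrightarrow> f y = h y / q y ^ N"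
    "boxpol V M' h'" "\<forall>y. q y \<noteq> 0 \<longrightarrow> g y = h' y / q y ^ N'"
    using assms unfolding laurent_def by blast
  then show ?thesis
    unfolding laurent_def
    by (intro exI[of _ "N + N'"] exI[of _ "M + M'"] exI[of _ "\<lambda>y. h y * h' y"])
      (auto simp: power_add intro: boxpol_mult[OF finite_vars])
qed

lemma laurent_uminus: "laurent V q f \<Longrightarrow> laurent V q (\<lambda>y. - f y)"
  using laurent_mult[OF laurent_const[of "-1"], of f] by simp

lemma laurent_diff: "laurent V q f \<Longrightarrow> laurent V q g \<Longrightarrow> laurent V q (\<lambda>y. f y - g y)"
  using laurent_add[OF _ laurent_uminus, of f g] by simp

lemma laurent_sum: "(\<And>i. i \<in> I \<Longrightarrow> laurent V q (f i)) \<Longrightarrow> laurent V q (\<lambda>y. \<Sum>i\<in>I. f i y)"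
  by (induction I rule: infinite_finite_induct) (auto intro: laurent_add laurent_const)

lemma laurent_prod: "(\<And>i. i \<in> I \<Longrightarrow> laurent V q (f i)) \<Longrightarrow> laurent V q (\<lambda>y. \<Prod>i\<in>I. f i y)"
  by (induction I rule: infinite_finite_induct) (auto intro: laurent_mult laurent_const)

text \<open>Elimination by counting: there are \<open>(N + 1)\<^sup>d\<close> monomials in the functions \<open>g\<close>, while modulo
  the multiples of \<open>J\<close> the polynomials of the same degree form a space whose dimension grows only
  like \<open>N ^ (d - 1)\<close>.\<close>

lemma algebraic_relation_modulo:
  assumes ne: "V \<noteq> {}" and g: "\<And>v. v \<in> V \<Longrightarrow> laurent V q (g v)"
    and J: "laurent V q J" and J0: "q y0 \<noteq> 0" "J y0 \<noteq> 0"
  shows "\<exists>N P. boxpol V N P \<and> (\<exists>y. P y \<noteq> 0) \<and> (\<forall>y. q y \<noteq> 0 \<and> J y = 0 \<longrightarrow> P (\<lambda>v. g v y) = 0)"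
proof -
  note V = finite_vars
  obtain NJ \<delta> hJ where hJ: "boxpol V \<delta> hJ" "\<And>y. q y \<noteq> 0 \<Longrightarrow> J y = hJ y / q y ^ NJ"
    using J unfolding laurent_def by blast
  have "\<exists>N M h. v \<in> V \<longrightarrow> boxpol V M h \<and> (\<forall>y. q y \<noteq> 0 \<longrightarrow> g v y = h y / q y ^ N)" for v
    using g[of v] unfolding laurent_def by blast
  then obtain Ng Mg hg where hg: "\<And>v. v \<in> V \<Longrightarrow> boxpol V (Mg v) (hg v)"
    "\<And>v. v \<in> V \<Longrightarrow> \<forall>y. q y \<noteq> 0 \<longrightarrow> g v y = hg v y / q y ^ Ng v"
    by metis
  \<comment> \<open>A common exponent of the denominator for all functions
    \<open>g v\<close>.\<close>
  define k where "k = Max (Ng ` V)"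
  have "\<exists>M h. v \<in> V \<longrightarrow> boxpol V M h \<and> (\<forall>y. q y \<noteq> 0 \<longrightarrow> g v y = h y / q y ^ k)" for v
    using laurent_common_power[OF hg(1) hg(2), of v k] V by (auto simp: k_def)
  then obtain M h where h: "\<And>v. v \<in> V \<Longrightarrow> boxpol V (M v) (h v)"
    "\<And>v y. v \<in> V \<Longrightarrow> q y \<noteq> 0 \<Longrightarrow> g v y = h v y / q y ^ k"
    by metis
  define Q where "Q y = q y ^ k" for y
  \<comment> \<open>A common degree bound for the numerators \<open>h v\<close> and for the
    denominator \<open>Q\<close>; \<open>Suc\<close> makes it positive.\<close>
  define c where "c = Suc (Max (M ` V) + k * Nq)"
  have h': "boxpol V c (h v)" if "v \<in> V" for v
  proof (rule boxpol_mono[OF V h(1)[OF that]])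
    have "M v \<le> Max (M ` V)"
      using that V by simp
    then show "M v \<le> c"
      by (simp add: c_def)
  qed
  have Q: "boxpol V c Q"
    unfolding Q_def
    by (rule boxpol_mono[OF V boxpol_power[OF V boxpol_denominator, of k]]) (simp add: c_def)
  define d where "d = card V"
  have d: "d > 0"
    using ne V by (simp add: d_def card_gt_0_iff)
  \<comment> \<open>Chosen for the count below: the first summand is what has to be smaller than
    \<open>N + 1\<close>, and the second ensures \<open>\<delta> \<le> L\<close>.\<close>
  define N where "N = d * \<delta> * (d * c) ^ (d - 1) + \<delta>"
  \<comment> \<open>The degree bound of the cleared monomials \<open>mon a\<close>, which are
    products of \<open>d\<close> factors of degree at most \<open>N * c\<close>.\<close>
  define L where "L = d * N * c"
  have cpos: "c > 0"
    by (simp add: c_def)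
  have NL: "N \<le> L"
    using d cpos by (simp add: L_def)
  \<comment> \<open>The monomial in the functions \<open>g v\<close>, multiplied by
    \<open>Q ^ N\<close> for each variable. The total factor \<open>Q ^ (d * N)\<close> is the same
    for all exponents, so a linear relation survives division by it.\<close>
  define mon where "mon a y = (\<Prod>v\<in>V. h v y ^ a v * Q y ^ (N - a v))" for a y
  have mon: "boxpol V L (mon a)" if "a \<in> exponents V N" for a
  proof -
    have "boxpol V (N * c) (\<lambda>y. h v y ^ a v * Q y ^ (N - a v))" if "v \<in> V" for v
    proof -
      have "a v \<le> N"
        using \<open>a \<in> exponents V N\<close> that by (auto simp: exponents_def)
      then have "a v * c + (N - a v) * c = N * c"
        by (simp flip: distrib_right)
      then show ?thesis
        using boxpol_mult[OF V boxpol_power[OF V h'[OF that], of "a v"] boxpol_power[OF V Q, of "N - a v"]]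
        by simp
    qed
    then show ?thesis
      using boxpol_prod[OF V V, of "N * c"] unfolding mon_def L_def d_def by (simp add: mult.assoc)
  qed
  have mul: "boxpol V L (\<lambda>y. hJ y * monom_fun V b y)" if "b \<in> exponents V (L - \<delta>)" for b
  proof -
    have "boxpol V (\<delta> + (L - \<delta>)) (\<lambda>y. hJ y * monom_fun V b y)"
      using that by (intro boxpol_mult boxpol_monomial hJ V) (auto simp: exponents_def)
    moreover have "\<delta> \<le> L"
      using NL by (simp add: N_def)
    ultimately show ?thesis
      by simp
  qed
  \<comment> \<open>The disjoint sum indexes two families in the same space of polynomials: the
    cleared monomials and the multiples of the numerator \<open>hJ\<close>. Being more numerous than
    the monomials of that space, they are linearly dependent.\<close>
  define A where "A = exponents V N <+> exponents V (L - \<delta>)"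
  define F where "F = case_sum mon (\<lambda>b y. hJ y * monom_fun V b y)"
  have "\<forall>i. \<exists>c. i \<in> A \<longrightarrow> (\<forall>y. F i y = (\<Sum>w\<in>exponents V L. c w * monom_fun V w y))"
    using mon mul unfolding boxpol_def A_def F_def by fastforce
  then obtain co where co: "\<And>i y. i \<in> A \<Longrightarrow> F i y = (\<Sum>w\<in>exponents V L. co i w * monom_fun V w y)"
    by metis
  have "card (exponents V L) < card A"
  proof -
    have "L + 1 = (L - \<delta> + 1) + \<delta>"
      using NL by (simp add: N_def)
    then have "(L + 1) ^ d \<le> (L - \<delta> + 1) ^ d + d * \<delta> * (L + 1) ^ (d - 1)"
      using power_add_le[of "L - \<delta> + 1" \<delta> d] by simp
    also have "L + 1 \<le> d * c * (N + 1)"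
      using d cpos by (simp add: L_def algebra_simps Suc_leI)
    then have "d * \<delta> * (L + 1) ^ (d - 1) \<le> d * \<delta> * (d * c * (N + 1)) ^ (d - 1)"
      by (intro mult_left_mono power_mono) auto
    also have "\<dots> = (d * \<delta> * (d * c) ^ (d - 1)) * (N + 1) ^ (d - 1)"
      by (simp only: power_mult_distrib mult.assoc)
    also have "\<dots> < (N + 1) * (N + 1) ^ (d - 1)"
      by (intro mult_strict_right_mono) (auto simp: N_def)
    also have "\<dots> = (N + 1) ^ d"
      using d by (simp add: power_eq_if)
    finally show ?thesis
      using V by (simp add: A_def card_exponents card_Plus finite_exponents flip: d_def)
  qed
  then obtain l where l: "\<exists>i\<in>A. l i \<noteq> 0" "\<forall>w\<in>exponents V L. (\<Sum>i\<in>A. l i * co i w) = 0"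
    using underdetermined_linear_system[of "exponents V L" A co] V
    by (auto simp: A_def finite_exponents)
  have rel: "(\<Sum>i\<in>A. l i * F i y) = 0" for y
  proof -
    have "(\<Sum>i\<in>A. l i * F i y) = (\<Sum>i\<in>A. \<Sum>w\<in>exponents V L. l i * co i w * monom_fun V w y)"
      by (intro sum.cong refl) (simp add: co sum_distrib_left mult.assoc)
    also have "\<dots> = (\<Sum>w\<in>exponents V L. (\<Sum>i\<in>A. l i * co i w) * monom_fun V w y)"
      by (subst sum.swap) (simp add: sum_distrib_right)
    finally show ?thesis
      using l(2) by simp
  qed
  define P where "P y = (\<Sum>a\<in>exponents V N. l (Inl a) * monom_fun V a y)" for y
  define R where "R y = (\<Sum>b\<in>exponents V (L - \<delta>). l (Inr b) * monom_fun V b y)" for y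
  have rel': "(\<Sum>a\<in>exponents V N. l (Inl a) * mon a y) + hJ y * R y = 0" for y
  proof -
    have "(\<Sum>i\<in>A. l i * F i y) = (\<Sum>a\<in>exponents V N. l (Inl a) * mon a y) + hJ y * R y"
      unfolding A_def R_def using finite_exponents[OF V]
      by (subst sum.Plus) (auto simp: F_def sum_distrib_left mult_ac)
    then show ?thesis
      using rel by simp
  qed
  have "boxpol V N P"
    unfolding boxpol_def P_def by (intro exI[of _ "\<lambda>a. l (Inl a)"] allI refl)
  \<comment> \<open>If the relation involved only multiples of \<open>hJ\<close>, it would read
    \<open>hJ y * R y = 0\<close>. As \<open>hJ\<close> is not identically zero, \<open>R\<close>
    would be, and then all coefficients would vanish.\<close>
  moreover have "\<exists>y. P y \<noteq> 0"
  proof (rule ccontr)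
    assume "\<not> ?thesis"
    then have l0: "l (Inl a) = 0" if "a \<in> exponents V N" for a
      using coeff_zero_if_sum_zero[OF V, of "\<lambda>a. l (Inl a)" N a] that by (simp add: P_def)
    have R: "boxpol V (L - \<delta>) R"
      unfolding boxpol_def R_def by (intro exI[of _ "\<lambda>b. l (Inr b)"] allI refl)
    have "R y = 0" for y
    proof (rule ccontr)
      assume "R y \<noteq> 0"
      moreover have "hJ y0 \<noteq> 0"
        using J0 hJ by auto
      ultimately obtain z where "hJ z \<noteq> 0" "R z \<noteq> 0"
        using boxpol_mult_nonzero[OF V hJ(1) R] by blast
      then show False
        using rel'[of z] l0 by simp
    qed
    then have "l (Inr b) = 0" if "b \<in> exponents V (L - \<delta>)" for b
      using coeff_zero_if_sum_zero[OF V, of "\<lambda>a. l (Inr a)" "L - \<delta>" b] that by (simp add: R_def)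
    then show False
      using l(1) l0 by (auto simp: A_def)
  qed
  moreover have "P (\<lambda>v. g v y) = 0" if "q y \<noteq> 0" "J y = 0" for y
  proof -
    have Qy: "Q y \<noteq> 0"
      using that by (simp add: Q_def)
    have "mon a y = Q y ^ (d * N) * monom_fun V a (\<lambda>v. g v y)" if "a \<in> exponents V N" for a
    proof -
      have "h v y ^ a v * Q y ^ (N - a v) = Q y ^ N * g v y ^ a v" if v: "v \<in> V" for v
      proof -
        have "a v \<le> N"
          using \<open>a \<in> exponents V N\<close> v by (auto simp: exponents_def)
        then have "Q y ^ N = Q y ^ a v * Q y ^ (N - a v)"
          by (simp flip: power_add)
        moreover have "h v y = g v y * Q y"
          using h(2)[OF v \<open>q y \<noteq> 0\<close>] Qy by (simp add: Q_def)
        ultimately show ?thesis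
          by (simp add: power_mult_distrib)
      qed
      then have "mon a y = (\<Prod>v\<in>V. Q y ^ N * g v y ^ a v)"
        by (simp add: mon_def)
      then show ?thesis
        by (simp add: monom_fun_def prod.distrib d_def mult.commute flip: power_mult)
    qed
    then have "(\<Sum>a\<in>exponents V N. l (Inl a) * mon a y) = Q y ^ (d * N) * P (\<lambda>v. g v y)"
      by (simp add: P_def sum_distrib_left mult_ac)
    \<comment> \<open>Where \<open>J\<close> vanishes the second family drops out of the relation,
      and only the nonzero factor \<open>Q y ^ (d * N)\<close> has to be cancelled.\<close>
    moreover have "hJ y = 0"
      using hJ(2)[OF \<open>q y \<noteq> 0\<close>] that by simp
    ultimately show ?thesis
      using rel'[of y] Qy by simp
  qed
  ultimately show ?thesis
    by blast
qed

end

text \<open>The degree \<open>n\<close> is the largest power of \<open>z\<close> whose coefficient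
  is not identically zero, so \<open>p n\<close> can serve as an excluded polynomial in the
  remaining variables. The case \<open>n = 0\<close> is included.\<close>

lemma leading_coefficient:
  assumes V: "finite V" "z \<notin> V" and P: "boxpol (insert z V) N P" and nz: "P y0 \<noteq> 0"
  shows "\<exists>n p. (\<forall>l. boxpol V N (p l)) \<and> (\<exists>y. p n y \<noteq> 0) \<and>
    (\<forall>y \<zeta>. P (y(z := \<zeta>)) = (\<Sum>l\<le>n. p l y * \<zeta> ^ l))"
proof -
  obtain c where c: "\<And>y. P y = (\<Sum>a\<in>exponents (insert z V) N. c a * monom_fun (insert z V) a y)"
    using P unfolding boxpol_def by blast
  define p where "p l y = (\<Sum>b\<in>exponents V N. c (b(z := l)) * monom_fun V b y)" for l y
  have p: "P (y(z := \<zeta>)) = (\<Sum>l\<le>N. p l y * \<zeta> ^ l)" for y \<zeta>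
    unfolding c p_def by (rule sum_exponents_insert[OF V])
  define S where "S = {l. l \<le> N \<and> (\<exists>y. p l y \<noteq> 0)}"
  have "S \<noteq> {}"
  proof
    assume "S = {}"
    then have "\<forall>l\<le>N. p l y0 = 0"
      by (auto simp: S_def)
    then show False
      using p[of y0 "y0 z"] nz by simp
  qed
  moreover have "finite S"
    by (rule finite_subset[of _ "{..N}"]) (auto simp: S_def)
  ultimately have n: "Max S \<in> S" "\<And>l. l \<in> S \<Longrightarrow> l \<le> Max S"
    by auto
  show ?thesis
  proof (intro exI conjI allI)
    show "boxpol V N (p l)" for l
      unfolding boxpol_def p_def by (intro exI[of _ "\<lambda>b. c (b(z := l))"] allI refl)
    show "p (Max S) (SOME y. p (Max S) y \<noteq> 0) \<noteq> 0"
      using n(1) someI_ex[of "\<lambda>y. p (Max S) y \<noteq> 0"] by (auto simp: S_def)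
    have "(\<Sum>l\<le>N. p l y * \<zeta> ^ l) = (\<Sum>l\<le>Max S. p l y * \<zeta> ^ l)" for y \<zeta>
    proof (rule sum.mono_neutral_right)
      show "{..Max S} \<subseteq> {..N}"
        using n(1) by (auto simp: S_def)
      show "\<forall>l\<in>{..N} - {..Max S}. p l y * \<zeta> ^ l = 0"
      proof
        fix l assume "l \<in> {..N} - {..Max S}"
        then have "l \<le> N" "l \<notin> S"
          using n(2)[of l] by auto
        then show "p l y * \<zeta> ^ l = 0"
          by (simp add: S_def)
      qed
    qed simp
    then show "P (y(z := \<zeta>)) = (\<Sum>l\<le>Max S. p l y * \<zeta> ^ l)" for y \<zeta>
      using p by simp
  qed
qed

section \<open>Flows and Laplacians of a network\<close>

text \<open>The two directions of an edge have independent coefficients, because a facet system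
  keeps at most one of them.\<close>

definition flow :: "('n node \<Rightarrow> 'n node \<Rightarrow> complex) \<Rightarrow> complex ^ 'n::finite \<Rightarrow> complex ^ 'n" where
  "flow c u = (\<chi> i. \<Sum>j\<in>UNIV. c (Some i) j * (coord u (Some i) / coord u j)
     - c j (Some i) * (coord u j / coord u (Some i)))"

text \<open>The derivative of the flow along an edge with respect to the difference of the
  logarithms of its end points. It is symmetric in \<open>i\<close> and \<open>j\<close> even if
  \<open>c\<close> is not.\<close>

definition weight :: "('n node \<Rightarrow> 'n node \<Rightarrow> complex) \<Rightarrow> complex ^ 'n::finite \<Rightarrow> 'n node \<Rightarrow> 'n node \<Rightarrow> complex" where
  "weight c u i j = c i j * (coord u i / coord u j) + c j i * (coord u j / coord u i)"

text \<open>Multiplied by the logarithmic variations \<open>h\<^sub>i / u\<^sub>i\<close>, this matrix gives the derivative of the flow.\<close>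

definition laplacian :: "('n node \<Rightarrow> 'n node \<Rightarrow> complex) \<Rightarrow> complex ^ 'n::finite \<Rightarrow> complex ^ 'n ^ 'n" where
  "laplacian c u = (\<chi> i j. (if i = j then \<Sum>k\<in>UNIV. weight c u (Some i) k else 0)
     - weight c u (Some i) (Some j))"

text \<open>The value 0 at the reference node is its logarithmic variation, since its coordinate is
  constantly 1.\<close>

fun grounded :: "complex ^ 'n \<Rightarrow> 'n::finite node \<Rightarrow> complex" where
  "grounded v None = 0"
| "grounded v (Some i) = v $ i"

lemma sum_node: "(\<Sum>j\<in>UNIV. f j) = f None + (\<Sum>j\<in>UNIV. f (Some j))" for f :: "'n::finite node \<Rightarrow> complex"
  by (simp add: UNIV_option_conv sum.reindex)

text \<open>Without its row and column the reference node still enters the diagonal. Extending the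
  vector by zero turns the product into a sum of differences over all nodes.\<close>

lemma laplacian_mult:
  "(laplacian c u *v v) $ i = (\<Sum>j\<in>UNIV. weight c u (Some i) j * (grounded v (Some i) - grounded v j))"
proof -
  have "(laplacian c u *v v) $ i = (\<Sum>k\<in>UNIV. weight c u (Some i) k) * v $ i
      - (\<Sum>j\<in>UNIV. weight c u (Some i) (Some j) * v $ j)"
    by (simp add: laplacian_def matrix_vector_mult_def left_diff_distrib sum_subtractf
        if_distrib[of "\<lambda>x. x * _"] cong: if_cong)
  also have "(\<Sum>j\<in>UNIV. weight c u (Some i) (Some j) * v $ j) = (\<Sum>j\<in>UNIV. weight c u (Some i) j * grounded v j)"
    by (simp add: sum_node)
  finally show ?thesis
    by (simp add: right_diff_distrib sum_subtractf sum_distrib_right)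
qed

lemma det_nonzero_iff_kernel:
  fixes A :: "'a::field ^ 'n ^ 'n"
  shows "det A \<noteq> 0 \<longleftrightarrow> (\<forall>x. A *v x = 0 \<longrightarrow> x = 0)"
  by (metis invertible_det_nz invertible_left_inverse matrix_left_invertible_ker)

text \<open>At the point with all coordinates 1 the weights are nonnegative reals. A kernel vector
  makes the energy, the weighted sum of the squared differences along the edges, vanish; so it is
  constant on the connected graph and equals its value 0 at the reference node.\<close>

lemma laplacian_nonsingular:
  assumes conn: "connected_graph (A \<union> A\<inverse>)"
  shows "det (laplacian (\<lambda>i j. of_bool ((i, j) \<in> A)) (1 :: complex ^ 'n::finite)) \<noteq> 0"
  unfolding det_nonzero_iff_kernel
proof (intro allI impI)
  fix v :: "complex ^ 'n"
  let ?c = "\<lambda>i j. of_bool ((i, j) \<in> A)"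
  define w where "w i j = (of_bool ((i, j) \<in> A) + of_bool ((j, i) \<in> A) :: real)" for i j
  let ?v = "grounded v"
  have one: "coord 1 i = 1" for i :: "'n node"
    by (cases i) auto
  have weight: "weight ?c 1 i j = of_real (w i j)" for i j :: "'n node"
    by (simp add: weight_def w_def one)
  have w: "w i j = w j i" "w i j \<ge> 0" for i j
    by (auto simp: w_def)
  assume "laplacian ?c 1 *v v = 0"
  then have "(\<Sum>j\<in>UNIV. of_real (w (Some i) j) * (?v (Some i) - ?v j)) = 0" for i
    using laplacian_mult[of ?c 1 v i] by (simp add: weight)
  \<comment> \<open>There is no equation for the reference node, but its factor
    \<open>cnj (?v None)\<close> is zero.\<close>
  then have "cnj (?v i) * (\<Sum>j\<in>UNIV. of_real (w i j) * (?v i - ?v j)) = 0" for i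
    by (cases i) auto
  then have "(\<Sum>i\<in>UNIV. \<Sum>j\<in>UNIV. of_real (w i j) * (cnj (?v i) * (?v i - ?v j))) = 0"
    by (simp add: sum_distrib_left mult_ac)
  \<comment> \<open>Exchanging the two summation indices and adding symmetrizes the form into
    squared moduli.\<close>
  moreover from this have "(\<Sum>i\<in>UNIV. \<Sum>j\<in>UNIV. of_real (w i j) * (cnj (?v j) * (?v j - ?v i))) = 0"
    by (subst sum.swap) (simp add: w(1))
  ultimately have "(\<Sum>i\<in>UNIV. \<Sum>j\<in>UNIV. of_real (w i j) * (cnj (?v i) * (?v i - ?v j))
      + of_real (w i j) * (cnj (?v j) * (?v j - ?v i))) = 0"
    by (simp add: sum.distrib)
  moreover have "of_real (w i j) * (cnj (?v i) * (?v i - ?v j)) + of_real (w i j) * (cnj (?v j) * (?v j - ?v i))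
      = of_real (w i j * (cmod (?v i - ?v j))\<^sup>2)" for i j
    unfolding of_real_mult complex_norm_square by (simp add: algebra_simps)
  ultimately have "(\<Sum>i\<in>UNIV. \<Sum>j\<in>UNIV. w i j * (cmod (?v i - ?v j))\<^sup>2) = 0"
    by (simp only: of_real_sum[symmetric] of_real_eq_0_iff)
  then have "\<forall>i. (\<Sum>j\<in>UNIV. w i j * (cmod (?v i - ?v j))\<^sup>2) = 0"
    by (subst (asm) sum_nonneg_eq_0_iff) (auto intro!: sum_nonneg mult_nonneg_nonneg w)
  then have zero: "w i j * (cmod (?v i - ?v j))\<^sup>2 = 0" for i j
    using sum_nonneg_eq_0_iff[of UNIV "\<lambda>j. w i j * (cmod (?v i - ?v j))\<^sup>2"] w(2) by auto
  have edge: "?v i = ?v j" if "(i, j) \<in> A \<union> A\<inverse>" for i j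
  proof -
    have "w i j > 0"
      using that by (auto simp: w_def)
    then show ?thesis
      using zero[of i j] by simp
  qed
  have "?v i = ?v j" if "(i, j) \<in> (A \<union> A\<inverse>)\<^sup>*" for i j
    using that by (induction rule: rtrancl_induct) (use edge in auto)
  then have "?v (Some i) = ?v None" for i
    using conn unfolding connected_graph_def by blast
  then show "v = 0"
    by (simp add: vec_eq_iff)
qed

text \<open>Among the arguments, \<open>Node i\<close> is the coordinate \<open>x\<^sub>i\<close> of a point; among the values to be related,
  it is the frequency \<open>\<omega>\<^sub>i\<close>.\<close>

datatype 'n unknown = Node 'n | Edge "'n node \<times> 'n node" | Extra

definition point :: "('n unknown \<Rightarrow> complex) \<Rightarrow> complex ^ 'n" where
  "point y = (\<chi> i. y (Node i))"

text \<open>Both directions of an edge read the variable of the oriented edge, which builds in the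
  symmetry of \<open>K\<close>. Cutting down to a subgraph \<open>A\<close> leaves the set of
  variables unchanged.\<close>

definition coupling_of :: "('n node \<times> 'n node) set \<Rightarrow> ('n node \<times> 'n node) set \<Rightarrow> ('n unknown \<Rightarrow> complex)
    \<Rightarrow> 'n node \<Rightarrow> 'n node \<Rightarrow> complex" where
  "coupling_of D A y i j =
     (if (i, j) \<in> A then y (Edge (if (i, j) \<in> D then (i, j) else (j, i))) else 0)"

definition unknowns :: "('n node \<times> 'n node) set \<Rightarrow> 'n unknown set" where
  "unknowns D = range Node \<union> Edge ` D"

locale network =
  fixes E D :: "('n::finite node \<times> 'n node) set"
  assumes graph: "simple_graph E" and orient: "orientation E D"
begin

abbreviation q :: "('n unknown \<Rightarrow> complex) \<Rightarrow> complex" where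
  "q y \<equiv> \<Prod>i\<in>UNIV. y (Node i)"

lemma finite_unknowns: "finite (unknowns D)"
  by (simp add: unknowns_def)

lemma denominator_q:
  assumes "finite V" "range Node \<subseteq> V"
  shows "denominator V q (card (UNIV :: 'n set) * 1)"
proof
  show "boxpol V (card (UNIV :: 'n set) * 1) q"
    by (rule boxpol_prod[OF assms(1) finite_class.finite_UNIV boxpol_var[OF assms(1)]]) (use assms(2) in auto)
qed (rule assms(1))

lemma q_nonzero_iff: "q y \<noteq> 0 \<longleftrightarrow> point y \<in> torus"
  by (auto simp: torus_def point_def)

context
  fixes V :: "'n unknown set" and Nq
  assumes denominator_V: "denominator V q Nq" and unknowns_subset: "unknowns D \<subseteq> V"
begin

interpretation denominator V q Nq
  by (rule denominator_V)

lemma laurent_coord: "laurent V q (\<lambda>y. coord (point y) i)"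
  using unknowns_subset
  by (cases i) (auto simp: point_def unknowns_def intro!: laurent_const laurent_var)

text \<open>The inverse of a coordinate is the product of the other coordinates divided by
  \<open>q\<close>.\<close>

lemma laurent_inverse_coord: "laurent V q (\<lambda>y. 1 / coord (point y) i)"
proof (cases i)
  case (Some k)
  have "boxpol V (card (UNIV - {k}) * 1) (\<lambda>y. \<Prod>j\<in>UNIV - {k}. y (Node j))"
    by (intro boxpol_prod boxpol_var finite_vars) (use unknowns_subset in \<open>auto simp: unknowns_def\<close>)
  note L = laurent_divide_denominator[OF this]
  have eq: "(\<Prod>j\<in>UNIV - {k}. y (Node j)) / q y = 1 / coord (point y) i" if "q y \<noteq> 0" for y
  proof -
    have "q y = y (Node k) * (\<Prod>j\<in>UNIV - {k}. y (Node j))"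
      by (simp add: prod.remove)
    then show ?thesis
      using that Some by (simp add: point_def)
  qed
  show ?thesis
    using L unfolding laurent_def by (simp add: eq)
qed (simp add: laurent_const)

lemma laurent_ratio: "laurent V q (\<lambda>y. coord (point y) i / coord (point y) j)"
  using laurent_mult[OF laurent_coord[of i] laurent_inverse_coord[of j]] by simp

lemma laurent_coupling: "A \<subseteq> E \<Longrightarrow> laurent V q (\<lambda>y. coupling_of D A y i j)"
proof (cases "(i, j) \<in> A")
  case True
  assume "A \<subseteq> E"
  then have "(i, j) \<notin> D \<longrightarrow> (j, i) \<in> D"
    using True orient unfolding orientation_def by (meson subsetD)
  then have "Edge (if (i, j) \<in> D then (i, j) else (j, i)) \<in> V"
    using unknowns_subset by (auto simp: unknowns_def)
  then show ?thesis
    using True laurent_var by (simp add: coupling_of_def)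
qed (simp add: coupling_of_def laurent_const)

lemma laurent_flow: "A \<subseteq> E \<Longrightarrow> laurent V q (\<lambda>y. flow (coupling_of D A y) (point y) $ i)"
  unfolding flow_def vec_lambda_beta
  by (intro laurent_sum laurent_diff laurent_mult laurent_ratio laurent_coupling)

lemma laurent_det:
  assumes "A \<subseteq> E"
  shows "laurent V q (\<lambda>y. det (laplacian (coupling_of D A y) (point y)))"
proof -
  have *: "laurent V q (\<lambda>y. weight (coupling_of D A y) (point y) i j)" for i j
    unfolding weight_def by (intro laurent_add laurent_mult laurent_ratio laurent_coupling assms)
  have "laurent V q (\<lambda>y. laplacian (coupling_of D A y) (point y) $ i $ j)" for i j
    unfolding laplacian_def vec_lambda_beta
    by (cases "i = j") (auto intro!: laurent_diff laurent_sum laurent_const laurent_uminus *)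
  then show ?thesis
    unfolding det_def by (intro laurent_sum laurent_mult laurent_prod laurent_const)
qed

text \<open>The flow components take the places of the coordinates, and the other unknowns are kept.
  For a solution the flow components are the frequencies, so the relation speaks only of the
  parameters and, if present, of \<open>Extra\<close>.\<close>

lemma flow_relation:
  assumes A: "A \<subseteq> E" and J: "laurent V q J" and J0: "q y0 \<noteq> 0" "J y0 \<noteq> 0"
  shows "\<exists>N P. boxpol V N P \<and> (\<exists>y. P y \<noteq> 0) \<and>
    (\<forall>y. point y \<in> torus \<and> J y = 0 \<longrightarrow>
      P (\<lambda>v. case v of Node i \<Rightarrow> flow (coupling_of D A y) (point y) $ i | _ \<Rightarrow> y v) = 0)"
proof -
  have "V \<noteq> {}"
    using unknowns_subset by (auto simp: unknowns_def)
  moreover have "laurent V q (\<lambda>y. case v of Node i \<Rightarrow> flow (coupling_of D A y) (point y) $ i | _ \<Rightarrow> y v)"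
    if "v \<in> V" for v
    using that A by (cases v) (auto intro: laurent_flow laurent_var)
  ultimately show ?thesis
    using algebraic_relation_modulo[of "\<lambda>v y. case v of Node i \<Rightarrow> flow (coupling_of D A y) (point y) $ i | _ \<Rightarrow> y v" J y0]
      J J0 unfolding q_nonzero_iff by blast
qed

end

end

section \<open>Generic regularity and boundedness\<close>

lemma complex_polynomial_sum:
  "(\<And>i. i \<in> I \<Longrightarrow> complex_polynomial (f i)) \<Longrightarrow> complex_polynomial (\<lambda>p. \<Sum>i\<in>I. f i p)"
  by (induction I rule: infinite_finite_induct)
    (auto intro: complex_polynomial.add complex_polynomial.const)

lemma complex_polynomial_prod:
  "(\<And>i. i \<in> I \<Longrightarrow> complex_polynomial (f i)) \<Longrightarrow> complex_polynomial (\<lambda>p. \<Prod>i\<in>I. f i p)"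
  by (induction I rule: infinite_finite_induct)
    (auto intro: complex_polynomial.mult complex_polynomial.const)

lemma complex_polynomial_power: "complex_polynomial f \<Longrightarrow> complex_polynomial (\<lambda>p. f p ^ k)"
  by (induction k) (auto intro: complex_polynomial.mult complex_polynomial.const)

lemma continuous_on_complex_polynomial:
  assumes "complex_polynomial P"
  shows "continuous_on S P"
  using assms by induction (auto intro!: continuous_intros)

definition line :: "'n::finite params \<Rightarrow> 'n params \<Rightarrow> complex \<Rightarrow> 'n params" where
  "line p d s = ((\<chi> i j. fst p $ i $ j + s * fst d $ i $ j), (\<chi> i. snd p $ i + s * snd d $ i))"

lemma complex_polynomial_line:
  assumes "complex_polynomial P"
  shows "\<exists>r. \<forall>s. P (line p d s) = poly r s"
  using assms
proof induction
  case (coupling i j)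
  show ?case
    by (intro exI[of _ "[:fst p $ i $ j, fst d $ i $ j:]"]) (simp add: line_def)
next
  case (frequency i)
  show ?case
    by (intro exI[of _ "[:snd p $ i, snd d $ i:]"]) (simp add: line_def)
next
  case (const c)
  show ?case
    by (intro exI[of _ "[:c:]"]) simp
next
  case (add f g)
  then obtain r r' where "\<forall>s. f (line p d s) = poly r s" "\<forall>s. g (line p d s) = poly r' s"
    by blast
  then show ?case
    by (intro exI[of _ "r + r'"]) simp
next
  case (mult f g)
  then obtain r r' where "\<forall>s. f (line p d s) = poly r s" "\<forall>s. g (line p d s) = poly r' s"
    by blast
  then show ?case
    by (intro exI[of _ "r * r'"]) simp
qed

text \<open>\<open>param_space E\<close> is a linear subspace, so the complex line through the two
  witnesses stays inside and the question reduces to polynomials in one variable.\<close>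

lemma complex_polynomial_mult_nonzero:
  assumes P: "complex_polynomial P" and Q: "complex_polynomial Q"
    and p: "p \<in> param_space E" "P p \<noteq> 0" and p': "p' \<in> param_space E" "Q p' \<noteq> 0"
  shows "\<exists>r\<in>param_space E. P r * Q r \<noteq> 0"
proof -
  define d where "d = ((\<chi> i j. fst p' $ i $ j - fst p $ i $ j), (\<chi> i. snd p' $ i - snd p $ i))"
  obtain r r' where r: "\<And>s. P (line p d s) = poly r s" and r': "\<And>s. Q (line p d s) = poly r' s"
    using complex_polynomial_line[OF P, of p d] complex_polynomial_line[OF Q, of p d] by blast
  have "line p d 0 = p" "line p d 1 = p'"
    by (simp_all add: line_def d_def vec_eq_iff prod_eq_iff)
  then have "r \<noteq> 0" "r' \<noteq> 0"
    using r[of 0] r'[of 1] p p' by auto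
  then have "r * r' \<noteq> 0"
    by simp
  then obtain s where "poly (r * r') s \<noteq> 0"
    using poly_all_0_iff_0 by blast
  moreover have "line p d s \<in> param_space E"
    using p(1) p'(1) by (auto simp: param_space_def line_def d_def case_prod_unfold)
  ultimately show ?thesis
    using r[of s] r'[of s] by (intro bexI[of _ "line p d s"]) auto
qed

text \<open>The boundedness statements below are not about single parameters but about compact sets of
  parameters on which the excluded polynomial has no zero.\<close>

definition generic_compact :: "('n::finite node \<times> 'n node) set \<Rightarrow> ('n params set \<Rightarrow> bool) \<Rightarrow> bool" where
  "generic_compact E \<Psi> \<longleftrightarrow>
    (\<exists>P. complex_polynomial P \<and> (\<exists>p\<in>param_space E. P p \<noteq> 0) \<and>
      (\<forall>S. compact S \<and> S \<subseteq> param_space E \<and> (\<forall>p\<in>S. P p \<noteq> 0) \<longrightarrow> \<Psi> S))"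

lemma generic_compact_conj:
  assumes "generic_compact E \<Psi>" "generic_compact E \<Theta>"
  shows "generic_compact E (\<lambda>S. \<Psi> S \<and> \<Theta> S)"
proof -
  obtain P p Q p' where *: "complex_polynomial P" "p \<in> param_space E" "P p \<noteq> 0"
    "\<And>S. compact S \<and> S \<subseteq> param_space E \<and> (\<forall>p\<in>S. P p \<noteq> 0) \<Longrightarrow> \<Psi> S"
    "complex_polynomial Q" "p' \<in> param_space E" "Q p' \<noteq> 0"
    "\<And>S. compact S \<and> S \<subseteq> param_space E \<and> (\<forall>p\<in>S. Q p \<noteq> 0) \<Longrightarrow> \<Theta> S"
    using assms unfolding generic_compact_def by metis
  then show ?thesis
    unfolding generic_compact_def
    by (intro exI[of _ "\<lambda>p. P p * Q p"] conjI complex_polynomial.mult complex_polynomial_mult_nonzero) auto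
qed

lemma generic_compact_ball:
  assumes "finite I" "\<And>i. i \<in> I \<Longrightarrow> generic_compact E (\<Psi> i)"
  shows "generic_compact E (\<lambda>S. \<forall>i\<in>I. \<Psi> i S)"
  using assms
proof (induction I rule: finite_induct)
  case empty
  have "(0, 0) \<in> param_space E"
    by (simp add: param_space_def)
  then show ?case
    unfolding generic_compact_def by (intro exI[of _ "\<lambda>_. 1"]) (auto intro: complex_polynomial.const)
next
  case (insert i I)
  then show ?case
    using generic_compact_conj[of E "\<Psi> i" "\<lambda>S. \<forall>i\<in>I. \<Psi> i S"] by simp
qed

lemma generic_compact_mono:
  assumes "generic_compact E \<Psi>" "\<And>S. S \<subseteq> param_space E \<Longrightarrow> \<Psi> S \<Longrightarrow> \<Theta> S"
  shows "generic_compact E \<Theta>"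
  using assms unfolding generic_compact_def by meson

text \<open>The edge value is the coefficient \<open>k / (2 * \<i>)\<close> of the flow. The second
  component of the argument is the frequency vector when parameters are encoded, and the point
  itself in \<open>encode (K, u)\<close>; the value at \<open>Extra\<close> is a default to be
  overwritten.\<close>

definition encode :: "'n::finite params \<Rightarrow> 'n unknown \<Rightarrow> complex" where
  "encode p v = (case v of Node i \<Rightarrow> snd p $ i | Edge e \<Rightarrow> fst p $ fst e $ snd e / (2 * \<i>) | Extra \<Rightarrow> 0)"

definition coupling :: "('n node \<times> 'n node) set \<Rightarrow> complex ^ 'n node ^ 'n node \<Rightarrow> 'n::finite node \<Rightarrow> 'n node \<Rightarrow> complex"
  where "coupling A K i j = (if (i, j) \<in> A then K $ i $ j / (2 * \<i>) else 0)"

lemma complex_polynomial_boxpol: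
  assumes "boxpol V N f"
  shows "complex_polynomial (\<lambda>p. f (encode p))"
proof -
  obtain c where c: "\<And>y. f y = (\<Sum>a\<in>exponents V N. c a * monom_fun V a y)"
    using assms unfolding boxpol_def by blast
  have "complex_polynomial (\<lambda>p. encode p v)" for v
  proof (cases v)
    case (Edge e)
    then show ?thesis
      using complex_polynomial.mult[OF complex_polynomial.coupling[of "fst e" "snd e"] complex_polynomial.const[of "1 / (2 * \<i>)"]]
      by (simp only: encode_def Edge unknown.case times_divide_eq_right mult_1_right)
  qed (auto simp: encode_def intro: complex_polynomial.frequency complex_polynomial.const)
  then show ?thesis
    unfolding c monom_fun_def
    by (intro complex_polynomial_sum complex_polynomial.mult[OF complex_polynomial.const]
        complex_polynomial_prod complex_polynomial_power)
qed

section \<open>Bounds for roots, uniform over compact sets of parameters\<close>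

text \<open>Cauchy's bound: if \<open>\<zeta>\<close> has modulus above 1, the lower terms are at
  most \<open>n * C\<close> times the power \<open>n - 1\<close> of the modulus, and this power
  cancels.\<close>

lemma root_bound:
  fixes a :: "nat \<Rightarrow> complex"
  assumes root: "(\<Sum>l\<le>n. a l * \<zeta> ^ l) = 0" and lead: "cmod (a n) \<ge> m" "m > 0"
    and bound: "\<And>l. l \<le> n \<Longrightarrow> cmod (a l) \<le> C"
  shows "cmod \<zeta> \<le> 1 + real n * C / m"
proof (cases "cmod \<zeta> \<le> 1")
  case True
  have "C \<ge> 0"
    using bound[of 0] norm_ge_zero[of "a 0"] by linarith
  then show ?thesis
    using True \<open>m > 0\<close> by (simp add: add_increasing2)
next
  case False
  have n: "n > 0"
    using root lead by (cases n) auto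
  have "a n * \<zeta> ^ n = - (\<Sum>l<n. a l * \<zeta> ^ l)"
  proof -
    have "(\<Sum>l\<le>n. a l * \<zeta> ^ l) = (\<Sum>l<n. a l * \<zeta> ^ l) + a n * \<zeta> ^ n"
      by (simp flip: lessThan_Suc_atMost)
    then show ?thesis
      using root by (metis add.commute eq_neg_iff_add_eq_0)
  qed
  then have "cmod (a n) * cmod \<zeta> ^ n = cmod (\<Sum>l<n. a l * \<zeta> ^ l)"
    by (metis norm_minus_cancel norm_mult norm_power)
  also have "\<dots> \<le> (\<Sum>l<n. cmod (a l) * cmod \<zeta> ^ l)"
    by (rule order_trans[OF norm_sum]) (simp add: norm_mult norm_power)
  also have "\<dots> \<le> (\<Sum>l<n. C * cmod \<zeta> ^ (n - 1))"
  proof (intro sum_mono mult_mono power_increasing)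
    show "0 \<le> C"
      using bound[of 0] norm_ge_zero[of "a 0"] by linarith
  qed (use False bound in auto)
  finally have "cmod (a n) * cmod \<zeta> * cmod \<zeta> ^ (n - 1) \<le> real n * C * cmod \<zeta> ^ (n - 1)"
    using n by (cases n) (auto simp: mult_ac)
  then have "cmod (a n) * cmod \<zeta> \<le> real n * C"
    by (rule mult_right_le_imp_le) (use False in \<open>intro zero_less_power; linarith\<close>)
  moreover have "m * cmod \<zeta> \<le> cmod (a n) * cmod \<zeta>"
    using lead by (intro mult_right_mono) auto
  ultimately have "m * cmod \<zeta> \<le> real n * C"
    by linarith
  then show ?thesis
    using \<open>m > 0\<close> by (simp add: field_simps)
qed

text \<open>On a compact set the leading coefficient has a positive minimum modulus and the other
  coefficients are bounded.\<close>

lemma root_bound_compact: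
  fixes S :: "'n::finite params set"
  assumes S: "compact S" and p: "\<And>l. complex_polynomial (p l)" and nz: "\<And>x. x \<in> S \<Longrightarrow> p n x \<noteq> 0"
  shows "\<exists>B. \<forall>x\<in>S. \<forall>\<zeta>. (\<Sum>l\<le>n. p l x * \<zeta> ^ l) = 0 \<longrightarrow> cmod \<zeta> \<le> B"
proof (cases "S = {}")
  case False
  have cont: "continuous_on S (\<lambda>x. cmod (p l x))" for l
    by (intro continuous_on_norm continuous_on_complex_polynomial p)
  obtain x0 where x0: "x0 \<in> S" "\<forall>x\<in>S. cmod (p n x0) \<le> cmod (p n x)"
    using continuous_attains_inf[OF S False cont[of n]] by blast
  have "\<exists>C. \<forall>x\<in>S. cmod (p l x) \<le> C" for l
    using continuous_attains_sup[OF S False cont[of l]] by blast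
  then obtain C where C: "\<And>l x. x \<in> S \<Longrightarrow> cmod (p l x) \<le> C l"
    by metis
  have "C l \<ge> 0" for l
    using C[OF x0(1), of l] norm_ge_zero[of "p l x0"] by linarith
  then have "C l \<le> (\<Sum>l\<le>n. C l)" if "l \<le> n" for l
    using that by (intro member_le_sum) auto
  then have "cmod (p l x) \<le> (\<Sum>l\<le>n. C l)" if "l \<le> n" "x \<in> S" for l x
    using that C order_trans by blast
  then have "\<forall>x\<in>S. \<forall>\<zeta>. (\<Sum>l\<le>n. p l x * \<zeta> ^ l) = 0 \<longrightarrow>
      cmod \<zeta> \<le> 1 + real n * (\<Sum>l\<le>n. C l) / cmod (p n x0)"
    using x0 nz[OF x0(1)] by (intro ballI allI impI root_bound) auto
  then show ?thesis
    by blast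
qed auto

definition bounded_flow_solutions :: "('n node \<times> 'n node) set \<Rightarrow> 'n::finite params set \<Rightarrow> bool" where
  "bounded_flow_solutions A S \<longleftrightarrow> (\<exists>B. \<forall>(K, \<omega>)\<in>S. \<forall>u\<in>torus. flow (coupling A K) u = \<omega> \<longrightarrow>
    (\<forall>i. cmod (u $ i) \<le> B \<and> cmod (1 / u $ i) \<le> B))"

definition regular_flow_solutions :: "('n node \<times> 'n node) set \<Rightarrow> 'n::finite params set \<Rightarrow> bool" where
  "regular_flow_solutions A S \<longleftrightarrow> (\<forall>(K, \<omega>)\<in>S. \<forall>u\<in>torus. flow (coupling A K) u = \<omega> \<longrightarrow>
    det (laplacian (coupling A K) u) \<noteq> 0)"

context network
begin

text \<open>Every assignment to \<open>unknowns D\<close> is the encoding of some network in the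
  parameter space, so a nonzero polynomial in these unknowns cannot vanish on the whole
  space.\<close>

lemma param_space_witness:
  assumes P: "boxpol (unknowns D) N P" and nz: "P y \<noteq> 0"
  shows "\<exists>p\<in>param_space E. P (encode p) \<noteq> 0"
proof -
  \<comment> \<open>The factor \<open>2 * \<i>\<close> undoes the division in \<open>encode\<close>;
    the second branch makes \<open>K\<close> symmetric.\<close>
  define K :: "complex ^ 'n node ^ 'n node" where "K = (\<chi> i j. if (i, j) \<in> D then 2 * \<i> * y (Edge (i, j))
      else if (j, i) \<in> D then 2 * \<i> * y (Edge (j, i)) else 0)"
  obtain c where c: "\<And>y. P y = (\<Sum>a\<in>exponents (unknowns D) N. c a * monom_fun (unknowns D) a y)"
    using P unfolding boxpol_def by blast
  have "encode (K, point y) v = y v" if "v \<in> unknowns D" for v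
    using that by (auto simp: unknowns_def encode_def point_def K_def)
  then have "P (encode (K, point y)) = P y"
    by (simp add: c monom_fun_def)
  moreover have "(K, point y) \<in> param_space E"
    using orient graph unfolding param_space_def orientation_def simple_graph_def K_def
    by (auto dest: symD)
  ultimately show ?thesis
    using nz by force
qed

lemma coupling_of_encode:
  assumes "(K, \<omega>) \<in> param_space E"
  shows "coupling_of D A ((encode (K, u))(Extra := \<zeta>)) = coupling A K"
    "coupling_of D A (encode (K, u)) = coupling A K"
  using assms by (auto simp: coupling_of_def coupling_def encode_def param_space_def fun_eq_iff)

text \<open>An algebraic form of Sard's theorem: with \<open>J\<close> the determinant, the relation
  holds at all critical values, so the parameters of a degenerate solution lie in the zero set of
  one nonzero polynomial. The assignment that is constantly 1 shows that \<open>J\<close> is not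
  identically zero.\<close>

lemma generic_regular:
  assumes A: "A \<subseteq> E" and conn: "connected_graph (A \<union> A\<inverse>)"
  shows "generic_compact E (regular_flow_solutions A)"
proof -
  note den = denominator_q[OF finite_unknowns]
  have sub: "range Node \<subseteq> unknowns D"
    by (simp add: unknowns_def)
  let ?J = "\<lambda>y. det (laplacian (coupling_of D A y) (point y))"
  have "point (\<lambda>_. 1) = (1 :: complex ^ 'n)"
    by (simp add: point_def vec_eq_iff)
  moreover have "coupling_of D A (\<lambda>_. 1) = (\<lambda>i j. of_bool ((i, j) \<in> A))"
    by (simp add: coupling_of_def fun_eq_iff)
  ultimately have "?J (\<lambda>_. 1) \<noteq> 0"
    using laplacian_nonsingular[OF conn] by simp
  moreover have q1: "q (\<lambda>_. 1) \<noteq> 0"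
    by simp
  ultimately obtain N P y where P: "boxpol (unknowns D) N P" "P y \<noteq> 0"
    "\<And>y. point y \<in> torus \<and> ?J y = 0 \<Longrightarrow>
      P (\<lambda>v. case v of Node i \<Rightarrow> flow (coupling_of D A y) (point y) $ i | _ \<Rightarrow> y v) = 0"
    using flow_relation[OF den[OF sub] order_refl A laurent_det[OF den[OF sub] order_refl A], of "\<lambda>_. 1"] q1
    by blast
  have "regular_flow_solutions A S" if S: "S \<subseteq> param_space E" "\<forall>p\<in>S. P (encode p) \<noteq> 0" for S
    unfolding regular_flow_solutions_def
  proof clarify
    fix K and u :: "complex ^ 'n"
    assume *: "(K, flow (coupling A K) u) \<in> S" "u \<in> torus" "det (laplacian (coupling A K) u) = 0"
    let ?y = "encode (K, u)"
    have K: "coupling_of D A ?y = coupling A K" "point ?y = u"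
      using coupling_of_encode(2)[of K] * S by (auto simp: point_def encode_def vec_eq_iff)
    \<comment> \<open>The tuple of related values is the encoding of exactly those parameters of
      which \<open>u\<close> is a solution.\<close>
    have "(\<lambda>v. case v of Node i \<Rightarrow> flow (coupling_of D A ?y) (point ?y) $ i | _ \<Rightarrow> ?y v)
        = encode (K, flow (coupling A K) u)"
      unfolding K by (auto simp: encode_def fun_eq_iff split: unknown.split)
    then have "P (encode (K, flow (coupling A K) u)) = 0"
      using P(3)[of ?y] * K by simp
    then show False
      using S * by blast
  qed
  then show ?thesis
    unfolding generic_compact_def
    using complex_polynomial_boxpol[OF P(1)] param_space_witness[OF P(1,2)] by blast
qed

text \<open>The extra unknown \<open>\<zeta>\<close> stands for a coordinate of a solution or for its inverse. It satisfies
  a polynomial equation over the parameters, and it is bounded where the leading coefficient of this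
  equation does not vanish.\<close>

lemma generic_extra_bound:
  assumes A: "A \<subseteq> E" and J: "\<And>V Nq. denominator V q Nq \<Longrightarrow> insert Extra (unknowns D) \<subseteq> V \<Longrightarrow> laurent V q J"
    and J0: "q y0 \<noteq> 0" "J y0 \<noteq> 0"
    and zero: "\<And>K u. u \<in> torus \<Longrightarrow> J ((encode (K, u))(Extra := f u)) = 0"
  shows "generic_compact E (\<lambda>S. \<exists>B. \<forall>(K, \<omega>)\<in>S. \<forall>u\<in>torus. flow (coupling A K) u = \<omega> \<longrightarrow> cmod (f u) \<le> B)"
proof -
  let ?V = "insert Extra (unknowns D)"
  have fin: "finite ?V" and sub: "range Node \<subseteq> ?V"
    using finite_unknowns by (auto simp: unknowns_def)
  have Ex: "Extra \<notin> unknowns D"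
    by (auto simp: unknowns_def)
  obtain N P y where P: "boxpol ?V N P" "P y \<noteq> 0"
    "\<And>y. point y \<in> torus \<and> J y = 0 \<Longrightarrow>
      P (\<lambda>v. case v of Node i \<Rightarrow> flow (coupling_of D A y) (point y) $ i | _ \<Rightarrow> y v) = 0"
    using flow_relation[OF denominator_q[OF fin sub] subset_insertI A J[OF denominator_q[OF fin sub] order_refl] J0]
    by blast
  \<comment> \<open>The coefficients depend on \<open>unknowns D\<close> alone, hence on the
    parameters and no longer on the solution.\<close>
  obtain n p where "(\<forall>l. boxpol (unknowns D) N (p l)) \<and> (\<exists>y. p n y \<noteq> 0) \<and>
      (\<forall>y \<zeta>. P (y(Extra := \<zeta>)) = (\<Sum>l\<le>n. p l y * \<zeta> ^ l))"
    using leading_coefficient[OF finite_unknowns Ex P(1,2)] by (elim exE)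
  then obtain y1 where p: "\<And>l. boxpol (unknowns D) N (p l)" "p n y1 \<noteq> 0"
    "\<And>y \<zeta>. P (y(Extra := \<zeta>)) = (\<Sum>l\<le>n. p l y * \<zeta> ^ l)"
    by blast
  have "\<exists>B. \<forall>(K, \<omega>)\<in>S. \<forall>u\<in>torus. flow (coupling A K) u = \<omega> \<longrightarrow> cmod (f u) \<le> B"
    if S: "compact S" "S \<subseteq> param_space E" "\<forall>x\<in>S. p n (encode x) \<noteq> 0" for S
  proof -
    have "\<exists>B. \<forall>x\<in>S. \<forall>\<zeta>. (\<Sum>l\<le>n. p l (encode x) * \<zeta> ^ l) = 0 \<longrightarrow> cmod \<zeta> \<le> B"
      by (rule root_bound_compact[OF S(1) complex_polynomial_boxpol[OF p(1)]]) (use S(3) in blast)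
    then obtain B where B: "\<And>x \<zeta>. x \<in> S \<Longrightarrow> (\<Sum>l\<le>n. p l (encode x) * \<zeta> ^ l) = 0 \<Longrightarrow> cmod \<zeta> \<le> B"
      by blast
    show ?thesis
    proof (intro exI[of _ B], clarify)
      fix K and u :: "complex ^ 'n"
      assume *: "(K, flow (coupling A K) u) \<in> S" "u \<in> torus"
      let ?y = "(encode (K, u))(Extra := f u)"
      have K: "coupling_of D A ?y = coupling A K" "point ?y = u"
        using coupling_of_encode(1)[of K] * S by (auto simp: point_def encode_def vec_eq_iff)
      have "(\<lambda>v. case v of Node i \<Rightarrow> flow (coupling_of D A ?y) (point ?y) $ i | _ \<Rightarrow> ?y v)
          = (encode (K, flow (coupling A K) u))(Extra := f u)"
        unfolding K by (auto simp: encode_def fun_eq_iff split: unknown.split)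
      then have "P ((encode (K, flow (coupling A K) u))(Extra := f u)) = 0"
        using P(3)[of ?y] * K zero by simp
      then show "cmod (f u) \<le> B"
        using B * by (simp add: p(3))
    qed
  qed
  then show ?thesis
    unfolding generic_compact_def
    using complex_polynomial_boxpol[OF p(1)] param_space_witness[OF p(1,2)]
    by (intro exI[of _ "\<lambda>x. p n (encode x)"]) blast
qed

lemma generic_bounded:
  assumes A: "A \<subseteq> E"
  shows "generic_compact E (bounded_flow_solutions A)"
proof -
  \<comment> \<open>This \<open>J\<close> identifies the extra unknown with the coordinate. At the
    sample point, 2 for \<open>Extra\<close> and 1 otherwise, it has the value 1.\<close>
  have 1: "generic_compact E (\<lambda>S. \<exists>B. \<forall>(K, \<omega>)\<in>S. \<forall>u\<in>torus. flow (coupling A K) u = \<omega> \<longrightarrow> cmod (u $ i) \<le> B)" for i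
  proof (rule generic_extra_bound[OF A, of "\<lambda>y. y Extra - y (Node i)" "\<lambda>v. if v = Extra then 2 else 1"])
    show "laurent V q (\<lambda>y. y Extra - y (Node i))" if "denominator V q Nq" "insert Extra (unknowns D) \<subseteq> V" for V Nq
      using that by (intro denominator.laurent_diff[OF that(1)] denominator.laurent_var[OF that(1)])
        (auto simp: unknowns_def)
  qed (auto simp: encode_def)
  \<comment> \<open>Here the extra unknown is identified with the inverse of the coordinate, so that
    a bound keeps the coordinate away from 0.\<close>
  have 2: "generic_compact E (\<lambda>S. \<exists>B. \<forall>(K, \<omega>)\<in>S. \<forall>u\<in>torus. flow (coupling A K) u = \<omega> \<longrightarrow> cmod (1 / u $ i) \<le> B)" for i
  proof (rule generic_extra_bound[OF A, of "\<lambda>y. y Extra * y (Node i) - 1" "\<lambda>v. if v = Extra then 2 else 1"])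
    show "laurent V q (\<lambda>y. y Extra * y (Node i) - 1)" if "denominator V q Nq" "insert Extra (unknowns D) \<subseteq> V" for V Nq
      using that by (intro denominator.laurent_diff[OF that(1)] denominator.laurent_mult[OF that(1)]
          denominator.laurent_const[OF that(1)] denominator.laurent_var[OF that(1)]) (auto simp: unknowns_def)
  qed (auto simp: encode_def torus_def)
  show ?thesis
  proof (rule generic_compact_mono[OF generic_compact_ball[OF finite_class.finite_UNIV generic_compact_conj[OF 1 2]]])
    fix S :: "'n params set"
    assume "\<forall>i\<in>UNIV. (\<exists>B. \<forall>(K, \<omega>)\<in>S. \<forall>u\<in>torus. flow (coupling A K) u = \<omega> \<longrightarrow> cmod (u $ i) \<le> B) \<and>
      (\<exists>B. \<forall>(K, \<omega>)\<in>S. \<forall>u\<in>torus. flow (coupling A K) u = \<omega> \<longrightarrow> cmod (1 / u $ i) \<le> B)"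
    then have "\<forall>i. \<exists>B. \<forall>(K, \<omega>)\<in>S. \<forall>u\<in>torus. flow (coupling A K) u = \<omega> \<longrightarrow> cmod (u $ i) \<le> B"
      "\<forall>i. \<exists>B. \<forall>(K, \<omega>)\<in>S. \<forall>u\<in>torus. flow (coupling A K) u = \<omega> \<longrightarrow> cmod (1 / u $ i) \<le> B"
      by auto
    from this[THEN choice] obtain B C where BC:
      "\<forall>i. \<forall>(K, \<omega>)\<in>S. \<forall>u\<in>torus. flow (coupling A K) u = \<omega> \<longrightarrow> cmod (u $ i) \<le> B i"
      "\<forall>i. \<forall>(K, \<omega>)\<in>S. \<forall>u\<in>torus. flow (coupling A K) u = \<omega> \<longrightarrow> cmod (1 / u $ i) \<le> C i"
      by (elim exE)
    define M where "M = Max (range B \<union> range C)"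
    have M: "B i \<le> M" "C i \<le> M" for i
      by (simp_all add: M_def)
    have "\<forall>(K, \<omega>)\<in>S. \<forall>u\<in>torus. flow (coupling A K) u = \<omega> \<longrightarrow>
        (\<forall>i. cmod (u $ i) \<le> M \<and> cmod (1 / u $ i) \<le> M)"
    proof (clarify, intro conjI)
      fix K u i
      assume "(K, flow (coupling A K) u) \<in> S" "u \<in> torus"
      then have "cmod (u $ i) \<le> B i" "cmod (1 / u $ i) \<le> C i"
        using BC by (force dest: bspec)+
      then show "cmod (u $ i) \<le> M" "cmod (1 / u $ i) \<le> M"
        using M[of i] by linarith+
    qed
    then show "bounded_flow_solutions A S"
      unfolding bounded_flow_solutions_def ..
  qed
qed

end

section \<open>Solution branches\<close>

text \<open>One family for three purposes: exponents 1 give \<open>t \<Phi>(x)\<close>, exponents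
  \<open>1 + \<alpha> i - \<alpha> j\<close> give the system in facet coordinates, and exponents 0
  give a system independent of \<open>t\<close>, used for finiteness.\<close>

definition deform :: "('n node \<Rightarrow> 'n node \<Rightarrow> complex) \<Rightarrow> ('n node \<Rightarrow> 'n node \<Rightarrow> nat) \<Rightarrow> real
    \<Rightarrow> 'n node \<Rightarrow> 'n node \<Rightarrow> complex" where
  "deform C e t i j = C i j * of_real (t ^ e i j)"

text \<open>The derivative of \<open>deform\<close> in \<open>t\<close>. For exponent 0 the
  truncated subtraction is harmless, since the factor \<open>e i j\<close> is zero.\<close>

definition deform' :: "('n node \<Rightarrow> 'n node \<Rightarrow> complex) \<Rightarrow> ('n node \<Rightarrow> 'n node \<Rightarrow> nat) \<Rightarrow> real
    \<Rightarrow> 'n node \<Rightarrow> 'n node \<Rightarrow> complex" where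
  "deform' C e t i j = C i j * of_real (of_nat (e i j) * t ^ (e i j - 1))"

lemma has_derivative_vecI:
  fixes f :: "'a::real_normed_vector \<Rightarrow> 'b::euclidean_space ^ 'n::finite"
  assumes "\<And>i. ((\<lambda>x. f x $ i) has_derivative (\<lambda>h. f' h $ i)) (at x within S)"
  shows "(f has_derivative f') (at x within S)"
  unfolding has_derivative_componentwise_within[of f]
  by (auto simp: Basis_vec_def inner_axis intro!: has_derivative_inner_left assms)

lemma coord_nonzero: "u \<in> torus \<Longrightarrow> coord u i \<noteq> 0"
  by (cases i) (auto simp: torus_def)

lemma open_torus: "open (torus :: (complex ^ 'n::finite) set)"
proof -
  have "torus = (\<Inter>i. {x :: complex ^ 'n. x $ i \<noteq> 0})"
    by (auto simp: torus_def)
  moreover have "open (\<Inter>i. {x :: complex ^ 'n. x $ i \<noteq> 0})"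
    by (intro open_INT ballI open_Collect_neq continuous_intros) auto
  ultimately show ?thesis by simp
qed

lemma has_derivative_coord:
  "((\<lambda>x. coord (fst x) i) has_derivative (\<lambda>h. grounded (fst h) i)) (at x within S)"
proof (cases i)
  case (Some k)
  show ?thesis
    unfolding Some coord.simps grounded.simps
    by (intro bounded_linear_imp_has_derivative bounded_linear_compose[OF bounded_linear_vec_nth bounded_linear_fst])
qed simp

lemma grounded_ratio: "grounded (\<chi> i. h $ i / u $ i) j = grounded h j / coord u j"
  by (cases j) auto

text \<open>The variation of a ratio of coordinates is the ratio times the difference of the
  logarithmic variations; this is where the Laplacian comes from.\<close>

lemma has_derivative_flow_term:
  fixes u :: "complex ^ 'n::finite"
  assumes u: "u \<in> torus"
  shows "((\<lambda>x. deform C e (snd x) i j * (coord (fst x) i / coord (fst x) j)) has_derivative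
    (\<lambda>h. deform C e t i j * (coord u i / coord u j)
        * (grounded (\<chi> k. fst h $ k / u $ k) i - grounded (\<chi> k. fst h $ k / u $ k) j)
      + of_real (snd h) * (deform' C e t i j * (coord u i / coord u j)))) (at (u, t))"
  unfolding deform_def
  apply (rule has_derivative_eq_rhs)
   apply (rule derivative_intros has_derivative_coord has_derivative_divide' | simp add: coord_nonzero u)+
  apply (rule ext)
  apply (simp add: deform'_def grounded_ratio coord_nonzero[OF u] field_simps)
  done

lemma has_derivative_flow:
  fixes u :: "complex ^ 'n::finite"
  assumes u: "u \<in> torus"
  shows "((\<lambda>x. flow (deform C e (snd x)) (fst x)) has_derivative
    (\<lambda>h. laplacian (deform C e t) u *v (\<chi> k. fst h $ k / u $ k) + snd h *\<^sub>R flow (deform' C e t) u)) (at (u, t))"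
proof (rule has_derivative_vecI)
  fix i
  let ?v = "\<lambda>h :: (complex ^ 'n) \<times> real. (\<chi> k. fst h $ k / u $ k) :: complex ^ 'n"
  have "((\<lambda>x. flow (deform C e (snd x)) (fst x) $ i) has_derivative
    (\<lambda>h. \<Sum>j\<in>UNIV. (deform C e t (Some i) j * (coord u (Some i) / coord u j)
        * (grounded (?v h) (Some i) - grounded (?v h) j)
      + of_real (snd h) * (deform' C e t (Some i) j * (coord u (Some i) / coord u j)))
      - (deform C e t j (Some i) * (coord u j / coord u (Some i))
        * (grounded (?v h) j - grounded (?v h) (Some i))
      + of_real (snd h) * (deform' C e t j (Some i) * (coord u j / coord u (Some i)))))) (at (u, t))"
    unfolding flow_def vec_lambda_beta
    by (intro has_derivative_sum has_derivative_diff has_derivative_flow_term u)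
  moreover have "(\<Sum>j\<in>UNIV. (deform C e t (Some i) j * (coord u (Some i) / coord u j)
        * (grounded (?v h) (Some i) - grounded (?v h) j)
      + of_real (snd h) * (deform' C e t (Some i) j * (coord u (Some i) / coord u j)))
      - (deform C e t j (Some i) * (coord u j / coord u (Some i))
        * (grounded (?v h) j - grounded (?v h) (Some i))
      + of_real (snd h) * (deform' C e t j (Some i) * (coord u j / coord u (Some i)))))
    = (laplacian (deform C e t) u *v ?v h + snd h *\<^sub>R flow (deform' C e t) u) $ i" for h
    unfolding vector_add_component vector_scaleR_component laplacian_mult
    unfolding flow_def vec_lambda_beta scaleR_conv_of_real sum_distrib_left sum.distrib[symmetric] weight_def
    by (intro sum.cong refl) (simp add: algebra_simps)
  ultimately show "((\<lambda>x. flow (deform C e (snd x)) (fst x) $ i) has_derivative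
    (\<lambda>h. (laplacian (deform C e t) u *v (\<chi> k. fst h $ k / u $ k) + snd h *\<^sub>R flow (deform' C e t) u) $ i)) (at (u, t))"
    by simp
qed

lemma continuous_on_coord: "continuous_on S f \<Longrightarrow> continuous_on S (\<lambda>x. coord (f x) i)"
  by (cases i) (auto intro!: continuous_intros)

lemma continuous_on_flow:
  assumes "continuous_on S f" "f ` S \<subseteq> torus" "\<And>i j. continuous_on S (\<lambda>x. c x i j)"
  shows "continuous_on S (\<lambda>x. flow (c x) (f x))"
  unfolding flow_def
  by (intro continuous_on_vec_lambda continuous_intros continuous_on_coord assms)
    (use assms(2) in \<open>auto simp: image_subset_iff coord_nonzero simp del: coord.simps\<close>)

lemma continuous_on_weight:
  assumes "continuous_on S f" "f ` S \<subseteq> torus" "\<And>i j. continuous_on S (\<lambda>x. c x i j)"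
  shows "continuous_on S (\<lambda>x. weight (c x) (f x) i j)"
  unfolding weight_def
  by (intro continuous_intros continuous_on_coord assms)
    (use assms(2) in \<open>auto simp: image_subset_iff coord_nonzero simp del: coord.simps\<close>)

lemma continuous_on_laplacian_entry:
  assumes "continuous_on S f" "f ` S \<subseteq> torus" "\<And>i j. continuous_on S (\<lambda>x. c x i j)"
  shows "continuous_on S (\<lambda>x. laplacian (c x) (f x) $ i $ j)"
  unfolding laplacian_def vec_lambda_beta
  by (cases "i = j") (auto intro!: continuous_intros continuous_on_weight assms)

lemma continuous_on_det_laplacian:
  assumes "continuous_on S f" "f ` S \<subseteq> torus" "\<And>i j. continuous_on S (\<lambda>x. c x i j)"
  shows "continuous_on S (\<lambda>x. det (laplacian (c x) (f x)))"
  unfolding det_def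
  by (intro continuous_intros continuous_on_laplacian_entry assms)

lemma continuous_on_deform: "continuous_on S f \<Longrightarrow> continuous_on S (\<lambda>x. deform C e (f x) i j)"
  unfolding deform_def by (intro continuous_intros)

lemma continuous_on_deform': "continuous_on S f \<Longrightarrow> continuous_on S (\<lambda>x. deform' C e (f x) i j)"
  unfolding deform'_def by (intro continuous_intros)

text \<open>The implicit function theorem, from the inverse function theorem for the map that also
  records \<open>t\<close>. The open set \<open>W\<close> provides local uniqueness: every solution
  in it lies on the branch. This is used to identify branches with each other.\<close>

lemma local_branch:
  fixes u0 :: "complex ^ 'n::finite"
  assumes u0: "u0 \<in> torus" and sol: "flow (deform C e t0) u0 = \<omega>"
    and det: "det (laplacian (deform C e t0) u0) \<noteq> 0"
  shows "\<exists>\<epsilon>>0. \<exists>\<delta> W. open W \<and> (u0, t0) \<in> W \<and>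
    (\<forall>t. \<bar>t - t0\<bar> < \<epsilon> \<longrightarrow> \<delta> t \<in> torus \<and> flow (deform C e t) (\<delta> t) = \<omega> \<and> (\<exists>v. (\<delta> has_vector_derivative v) (at t))) \<and>
    (\<forall>(u, t)\<in>W. u \<in> torus \<and> flow (deform C e t) u = \<omega> \<longrightarrow> \<bar>t - t0\<bar> < \<epsilon> \<and> u = \<delta> t)"
proof -
  define F where "F = (\<lambda>x. (flow (deform C e (snd x)) (fst x), snd x))"
  define L where "L = (\<lambda>x h. (laplacian (deform C e (snd x)) (fst x) *v (\<chi> k. fst h $ k / fst x $ k)
    + snd h *\<^sub>R flow (deform' C e (snd x)) (fst x), snd h))"
  define U where "U = (torus :: (complex ^ 'n) set) \<times> (UNIV :: real set)"
  have U: "open U"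
    unfolding U_def by (intro open_Times open_torus open_UNIV)
  have der: "(F has_derivative L x) (at x)" if "x \<in> U" for x
  proof -
    obtain u t where x: "x = (u, t)" by (cases x)
    then have "u \<in> torus" using that by (auto simp: U_def)
    then show ?thesis
      unfolding F_def L_def x fst_conv snd_conv by (intro has_derivative_Pair has_derivative_flow derivative_intros)
  qed
  then have bl: "bounded_linear (L x)" if "x \<in> U" for x
    using that has_derivative_bounded_linear by blast
  define f' where "f' x = Blinfun (L x)" for x
  have f': "blinfun_apply (f' x) = L x" if "x \<in> U" for x
    using bl[OF that] by (simp add: f'_def bounded_linear_Blinfun_apply)
  have contL: "continuous_on U (\<lambda>x. L x h)" for h
  proof -
    have fst: "fst ` U \<subseteq> torus"
      by (auto simp: U_def)
    have nz: "\<forall>x\<in>U. fst x $ k \<noteq> 0" for k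
      by (auto simp: U_def torus_def)
    have "continuous_on U (\<lambda>x. flow (deform' C e (snd x)) (fst x))"
      by (intro continuous_on_flow continuous_on_deform' continuous_intros fst)
    moreover have "continuous_on U (\<lambda>x. laplacian (deform C e (snd x)) (fst x) *v (\<chi> k. fst h $ k / fst x $ k))"
      unfolding matrix_vector_mult_def vec_lambda_beta
      by (intro continuous_on_vec_lambda continuous_intros continuous_on_laplacian_entry continuous_on_deform fst nz)
    ultimately show ?thesis
      unfolding L_def by (intro continuous_intros)
  qed
  \<comment> \<open>The inverse function theorem asks for continuity in the operator norm, which in
    finite dimension follows from continuity at each argument \<open>h\<close>.\<close>
  have contf': "continuous_on U f'"
    by (intro continuous_on_blinfun_componentwise) (use contL f' in \<open>simp cong: continuous_on_cong\<close>)
  have x0: "(u0, t0) \<in> U"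
    using u0 by (simp add: U_def)
  \<comment> \<open>The derivative is block triangular: its second component forces
    \<open>snd h = 0\<close>, and then the Laplacian acts on the first alone.\<close>
  have inj: "inj (L (u0, t0))"
  proof (rule linear_injective_0[THEN iffD2])
    show "linear (L (u0, t0))"
      using bl[OF x0] bounded_linear.linear by blast
    show "\<forall>h. L (u0, t0) h = 0 \<longrightarrow> h = 0"
    proof (intro allI impI)
      fix h assume "L (u0, t0) h = 0"
      then have "snd h = 0" and "laplacian (deform C e t0) u0 *v (\<chi> k. fst h $ k / u0 $ k) = 0"
        by (auto simp: L_def zero_prod_def)
      then have "(\<chi> k. fst h $ k / u0 $ k) = 0"
        using det unfolding det_nonzero_iff_kernel by blast
      then have "fst h = 0"
        using u0 by (simp add: vec_eq_iff torus_def)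
      then show "h = 0"
        using \<open>snd h = 0\<close> by (simp add: prod_eq_iff)
    qed
  qed
  obtain g0 where g0: "linear g0" "g0 \<circ> L (u0, t0) = id"
    using linear_injective_left_inverse[OF _ inj] bl[OF x0] bounded_linear.linear by blast
  have inv: "Blinfun g0 o\<^sub>L f' (u0, t0) = id_blinfun"
    using g0(1) fun_cong[OF g0(2)] by (intro blinfun_eqI)
      (simp add: f'[OF x0] bounded_linear_Blinfun_apply linear_linear)
  have derf: "(F has_derivative blinfun_apply (f' x)) (at x)" if "x \<in> U" for x
    using der f' that by simp
  have "\<exists>U' V g. open U' \<and> U' \<subseteq> U \<and> (u0, t0) \<in> U' \<and> open V \<and> F (u0, t0) \<in> V \<and>
      homeomorphism U' V F g \<and> (\<forall>y\<in>V. \<exists>D. (g has_derivative D) (at y))"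
  proof (rule inverse_function_theorem[OF U derf contf' x0 inv])
    fix U' V g g'
    assume *: "open U'" "U' \<subseteq> U" "(u0, t0) \<in> U'" "open V" "F (u0, t0) \<in> V" "homeomorphism U' V F g"
      and der: "\<And>y. y \<in> V \<Longrightarrow> (g has_derivative g' y) (at y)"
    have "\<forall>y\<in>V. \<exists>D. (g has_derivative D) (at y)"
      by (intro ballI exI) (rule der)
    with * show ?thesis
      by (intro exI conjI)
  qed
  then obtain U' V g where IFT: "open U'" "U' \<subseteq> U" "(u0, t0) \<in> U'" "open V" "F (u0, t0) \<in> V"
    "homeomorphism U' V F g" and "\<forall>y\<in>V. \<exists>D. (g has_derivative D) (at y)"
    by (elim exE conjE)
  from this(7) obtain g' where "\<forall>y\<in>V. (g has_derivative g' y) (at y)"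
    by (rule bchoice[THEN exE])
  then have g': "\<And>y. y \<in> V \<Longrightarrow> (g has_derivative g' y) (at y)"
    by blast
  have "F (u0, t0) = (\<omega>, t0)"
    using sol by (simp add: F_def)
  then have "(\<omega>, t0) \<in> V"
    using IFT(5) by simp
  moreover have "open ((\<lambda>t. (\<omega>, t)) -` V)"
    by (intro open_vimage IFT(4) continuous_intros)
  ultimately obtain \<epsilon> where \<epsilon>: "\<epsilon> > 0" "\<And>t. \<bar>t - t0\<bar> < \<epsilon> \<Longrightarrow> (\<omega>, t) \<in> V"
    unfolding open_dist by (auto simp: dist_real_def)
  define \<delta> where "\<delta> t = fst (g (\<omega>, t))" for t
  define W where "W = U' \<inter> (UNIV \<times> ball t0 \<epsilon>)"
  have br: "\<delta> t \<in> torus \<and> flow (deform C e t) (\<delta> t) = \<omega> \<and> (\<exists>v. (\<delta> has_vector_derivative v) (at t))"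
    if t: "\<bar>t - t0\<bar> < \<epsilon>" for t
  proof -
    have "F (g (\<omega>, t)) = (\<omega>, t)" and g: "g (\<omega>, t) \<in> U"
      using IFT(2,6) \<epsilon>(2)[OF t] unfolding homeomorphism_def by auto
    then have "flow (deform C e t) (\<delta> t) = \<omega>"
      by (auto simp: F_def \<delta>_def)
    moreover have "\<delta> t \<in> torus"
      using g by (auto simp: U_def \<delta>_def)
    moreover have "(\<delta> has_vector_derivative fst (g' (\<omega>, t) (0, 1))) (at t)"
    proof -
      have "((\<lambda>t. (\<omega>, t)) has_derivative (\<lambda>h. (0, h))) (at t)"
        by (intro derivative_intros)
      from has_derivative_fst[OF has_derivative_compose[OF this g'[OF \<epsilon>(2)[OF t]]]]
      have "(\<delta> has_derivative (\<lambda>h. fst (g' (\<omega>, t) (0, h)))) (at t)"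
        by (simp add: \<delta>_def[abs_def])
      moreover have "(\<lambda>h. fst (g' (\<omega>, t) (0, h))) = (\<lambda>h. h *\<^sub>R fst (g' (\<omega>, t) (0, 1)))"
      proof
        fix h
        show "fst (g' (\<omega>, t) (0, h)) = h *\<^sub>R fst (g' (\<omega>, t) (0, 1))"
          using linear_scale[OF bounded_linear.linear[OF has_derivative_bounded_linear[OF g'[OF \<epsilon>(2)[OF t]]]], of h "(0, 1)"]
          by simp
      qed
      ultimately show ?thesis
        by (simp only: has_vector_derivative_def)
    qed
    ultimately show ?thesis
      by blast
  qed
  moreover have "open W" "(u0, t0) \<in> W"
    using IFT \<epsilon> by (auto simp: W_def intro!: open_Int open_Times)
  moreover have "\<bar>t - t0\<bar> < \<epsilon> \<and> u = \<delta> t" if "(u, t) \<in> W" "flow (deform C e t) u = \<omega>" for u t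
  proof -
    have "g (F (u, t)) = (u, t)"
      using that(1) IFT(6) unfolding homeomorphism_def W_def by auto
    then show ?thesis
      using that by (auto simp: F_def \<delta>_def W_def dist_real_def)
  qed
  ultimately show ?thesis
    using \<epsilon>(1) by (intro exI[of _ \<epsilon>] conjI exI[of _ \<delta>] exI[of _ W]) auto
qed

section \<open>Smoothness of branches\<close>

text \<open>Rational expressions in the generators whose denominators have no zero in
  \<open>J\<close>. If the derivatives of the generators are such expressions, so are all
  derivatives, and smoothness follows from a single differentiation.\<close>

inductive_set rational_closure :: "real set \<Rightarrow> (real \<Rightarrow> complex) set \<Rightarrow> (real \<Rightarrow> complex) set"
  for J G where
  gen: "f \<in> G \<Longrightarrow> f \<in> rational_closure J G"
| const: "(\<lambda>t. c) \<in> rational_closure J G"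
| add: "f \<in> rational_closure J G \<Longrightarrow> g \<in> rational_closure J G \<Longrightarrow> (\<lambda>t. f t + g t) \<in> rational_closure J G"
| mult: "f \<in> rational_closure J G \<Longrightarrow> g \<in> rational_closure J G \<Longrightarrow> (\<lambda>t. f t * g t) \<in> rational_closure J G"
| inverse: "f \<in> rational_closure J G \<Longrightarrow> (\<And>t. t \<in> J \<Longrightarrow> f t \<noteq> 0) \<Longrightarrow> (\<lambda>t. inverse (f t)) \<in> rational_closure J G"

context
  fixes J :: "real set" and G :: "(real \<Rightarrow> complex) set"
begin

lemma rational_closure_uminus: "f \<in> rational_closure J G \<Longrightarrow> (\<lambda>t. - f t) \<in> rational_closure J G"
  using rational_closure.mult[OF rational_closure.const[of "-1"], of f] by simp

lemma rational_closure_diff: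
  assumes "f \<in> rational_closure J G" "g \<in> rational_closure J G"
  shows "(\<lambda>t. f t - g t) \<in> rational_closure J G"
  using rational_closure.add[OF assms(1) rational_closure_uminus[OF assms(2)]] by simp

lemma rational_closure_divide:
  "f \<in> rational_closure J G \<Longrightarrow> g \<in> rational_closure J G \<Longrightarrow> (\<And>t. t \<in> J \<Longrightarrow> g t \<noteq> 0)
    \<Longrightarrow> (\<lambda>t. f t / g t) \<in> rational_closure J G"
  unfolding divide_inverse by (intro rational_closure.mult rational_closure.inverse)

lemma rational_closure_sum:
  "(\<And>i. i \<in> I \<Longrightarrow> f i \<in> rational_closure J G) \<Longrightarrow> (\<lambda>t. \<Sum>i\<in>I. f i t) \<in> rational_closure J G"
  by (induction I rule: infinite_finite_induct) (auto intro: rational_closure.const rational_closure.add)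

lemma rational_closure_prod:
  "(\<And>i. i \<in> I \<Longrightarrow> f i \<in> rational_closure J G) \<Longrightarrow> (\<lambda>t. \<Prod>i\<in>I. f i t) \<in> rational_closure J G"
  by (induction I rule: infinite_finite_induct) (auto intro: rational_closure.const rational_closure.mult)

lemma rational_closure_power: "f \<in> rational_closure J G \<Longrightarrow> (\<lambda>t. f t ^ k) \<in> rational_closure J G"
  by (induction k) (auto intro: rational_closure.const rational_closure.mult)

lemma rational_closure_det:
  assumes "\<And>i j. (\<lambda>t. A t $ i $ j) \<in> rational_closure J G"
  shows "(\<lambda>t. det (A t)) \<in> rational_closure J G"
  unfolding det_def
  by (intro rational_closure_sum rational_closure.mult rational_closure.const rational_closure_prod assms)

context
  assumes deriv: "\<And>f. f \<in> G \<Longrightarrow> \<exists>g\<in>rational_closure J G. \<forall>t\<in>J. (f has_vector_derivative g t) (at t)"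
begin

lemma rational_closure_derivative:
  assumes "f \<in> rational_closure J G"
  shows "\<exists>g\<in>rational_closure J G. \<forall>t\<in>J. (f has_vector_derivative g t) (at t)"
  using assms
proof induction
  case (gen f)
  then show ?case by (rule deriv)
next
  case (const c)
  show ?case
    by (intro bexI[of _ "\<lambda>t. 0"] rational_closure.const) (auto intro: derivative_eq_intros)
next
  case (add f g)
  then obtain f' g' where "f' \<in> rational_closure J G" "g' \<in> rational_closure J G"
    "\<forall>t\<in>J. (f has_vector_derivative f' t) (at t)" "\<forall>t\<in>J. (g has_vector_derivative g' t) (at t)"
    by blast
  then show ?case
    by (intro bexI[of _ "\<lambda>t. f' t + g' t"] rational_closure.add) (auto intro: derivative_intros)
next
  case (mult f g)
  then obtain f' g' where "f' \<in> rational_closure J G" "g' \<in> rational_closure J G"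
    "\<forall>t\<in>J. (f has_vector_derivative f' t) (at t)" "\<forall>t\<in>J. (g has_vector_derivative g' t) (at t)"
    by blast
  with mult.hyps show ?case
    by (intro bexI[of _ "\<lambda>t. f t * g' t + f' t * g t"] rational_closure.add rational_closure.mult)
      (auto intro: has_vector_derivative_mult)
next
  case (inverse f)
  then obtain f' where f': "f' \<in> rational_closure J G" "\<forall>t\<in>J. (f has_vector_derivative f' t) (at t)"
    by blast
  have "((\<lambda>t. inverse (f t)) has_vector_derivative - (inverse (f t) * f' t * inverse (f t))) (at t)"
    if t: "t \<in> J" for t
  proof -
    have "(f has_derivative (\<lambda>h. h *\<^sub>R f' t)) (at t)"
      using f'(2) t by (simp add: has_vector_derivative_def)
    from Deriv.has_derivative_inverse[OF _ this] inverse.hyps(2)[OF t]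
    show ?thesis
      by (simp add: has_vector_derivative_def scaleR_conv_of_real mult_ac)
  qed
  with inverse.hyps f'(1) show ?case
    by (intro bexI[of _ "\<lambda>t. - (inverse (f t) * f' t * inverse (f t))"])
      (auto intro!: rational_closure_uminus rational_closure.mult rational_closure.inverse)
qed

lemma smooth_curve_on_rational_closure:
  fixes \<gamma> :: "real \<Rightarrow> complex ^ 'n::finite"
  assumes "\<And>i. (\<lambda>t. \<gamma> t $ i) \<in> rational_closure J G"
  shows "smooth_curve_on J \<gamma>"
proof -
  have "\<forall>f\<in>rational_closure J G. \<exists>g. g \<in> rational_closure J G \<and> (\<forall>t\<in>J. (f has_vector_derivative g t) (at t))"
    using rational_closure_derivative by blast
  then obtain \<Delta> where "\<forall>f\<in>rational_closure J G. \<Delta> f \<in> rational_closure J G \<and>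
      (\<forall>t\<in>J. (f has_vector_derivative \<Delta> f t) (at t))"
    by (rule bchoice[THEN exE])
  then have \<Delta>: "\<And>f. f \<in> rational_closure J G \<Longrightarrow> \<Delta> f \<in> rational_closure J G"
    "\<And>f t. f \<in> rational_closure J G \<Longrightarrow> t \<in> J \<Longrightarrow> (f has_vector_derivative \<Delta> f t) (at t)"
    by auto
  \<comment> \<open>A chosen derivative operator \<open>\<Delta>\<close> maps the closure to itself,
    so its iterates give derivatives of all orders.\<close>
  define d where "d m t = (\<chi> i. (\<Delta> ^^ m) (\<lambda>t. \<gamma> t $ i) t)" for m t
  have "(\<Delta> ^^ m) (\<lambda>t. \<gamma> t $ i) \<in> rational_closure J G" for m i
    by (induction m) (auto intro: assms \<Delta>)
  then have "((\<lambda>s. d m s $ i) has_derivative (\<lambda>h. (h *\<^sub>R d (Suc m) t) $ i)) (at t)" if "t \<in> J" for m t i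
    using \<Delta>(2)[OF _ that, of "(\<Delta> ^^ m) (\<lambda>t. \<gamma> t $ i)"] by (simp add: d_def has_vector_derivative_def)
  then have "(d m has_vector_derivative d (Suc m) t) (at t)" if "t \<in> J" for m t
    unfolding has_vector_derivative_def using that by (intro has_derivative_vecI) auto
  moreover have "d 0 = \<gamma>"
    by (simp add: d_def vec_eq_iff fun_eq_iff)
  ultimately show ?thesis
    unfolding smooth_curve_on_def by blast
qed

end

end

text \<open>Near each time a continuous curve of solutions stays in the uniqueness neighbourhood
  \<open>W\<close>, so it coincides there with the differentiable branch.\<close>

lemma branch_differentiable:
  fixes \<gamma> :: "real \<Rightarrow> complex ^ 'n::finite"
  assumes J: "open J" "t \<in> J" and cont: "continuous_on J \<gamma>"
    and sol: "\<And>t. t \<in> J \<Longrightarrow> \<gamma> t \<in> torus \<and> flow (deform C e t) (\<gamma> t) = \<omega>"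
    and det: "\<And>t. t \<in> J \<Longrightarrow> det (laplacian (deform C e t) (\<gamma> t)) \<noteq> 0"
  shows "\<exists>v. (\<gamma> has_vector_derivative v) (at t)"
proof -
  obtain \<epsilon> \<delta> W where W: "open W" "(\<gamma> t, t) \<in> W" and "\<epsilon> > 0"
    and \<delta>: "\<And>s. \<bar>s - t\<bar> < \<epsilon> \<Longrightarrow> \<exists>v. (\<delta> has_vector_derivative v) (at s)"
    and uniq: "\<And>u s. (u, s) \<in> W \<Longrightarrow> u \<in> torus \<and> flow (deform C e s) u = \<omega> \<Longrightarrow> u = \<delta> s"
    using local_branch[OF conjunct1[OF sol] conjunct2[OF sol] det, OF J(2) J(2) J(2)] by blast
  have "continuous_on J (\<lambda>s. (\<gamma> s, s))"
    by (intro continuous_intros cont)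
  then have "open (J \<inter> (\<lambda>s. (\<gamma> s, s)) -` W)"
    using J(1) W(1) continuous_open_preimage by blast
  moreover have "t \<in> J \<inter> (\<lambda>s. (\<gamma> s, s)) -` W"
    using J(2) W(2) by simp
  moreover have "\<delta> s = \<gamma> s" if "s \<in> J \<inter> (\<lambda>s. (\<gamma> s, s)) -` W" for s
    using uniq[of "\<gamma> s" s] sol[of s] that by auto
  moreover obtain v where "(\<delta> has_vector_derivative v) (at t)"
    using \<delta>[of t] \<open>\<epsilon> > 0\<close> by auto
  ultimately show ?thesis
    using has_vector_derivative_transform_within_open by blast
qed

text \<open>Cramer's rule expresses the derivative of a branch as a rational function of the branch.\<close>

lemma branch_rational:
  fixes \<gamma> :: "real \<Rightarrow> complex ^ 'n::finite"
  assumes J: "open J" and cont: "continuous_on J \<gamma>"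
    and sol: "\<And>t. t \<in> J \<Longrightarrow> \<gamma> t \<in> torus \<and> flow (deform C e t) (\<gamma> t) = \<omega>"
    and det: "\<And>t. t \<in> J \<Longrightarrow> det (laplacian (deform C e t) (\<gamma> t)) \<noteq> 0"
    and f: "f \<in> insert of_real (range (\<lambda>i t. \<gamma> t $ i))"
  shows "\<exists>g\<in>rational_closure J (insert of_real (range (\<lambda>i t. \<gamma> t $ i))).
    \<forall>t\<in>J. (f has_vector_derivative g t) (at t)"
proof -
  let ?G = "insert of_real (range (\<lambda>i t. \<gamma> t $ i))"
  let ?R = "rational_closure J ?G"
  have id: "of_real \<in> ?R"
    by (intro rational_closure.gen) simp
  have comp: "(\<lambda>t. \<gamma> t $ i) \<in> ?R" for i
    by (intro rational_closure.gen) simp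
  have coord: "(\<lambda>t. coord (\<gamma> t) i) \<in> ?R" for i
    by (cases i) (auto intro: comp rational_closure.const)
  have nz: "coord (\<gamma> t) i \<noteq> 0" if "t \<in> J" for t i
    using sol[OF that] coord_nonzero by blast
  have ratio: "(\<lambda>t. coord (\<gamma> t) i / coord (\<gamma> t) j) \<in> ?R" for i j
    by (intro rational_closure_divide coord nz)
  have pow: "(\<lambda>t. of_real (t ^ k)) \<in> ?R" for k
    using rational_closure_power[OF id, of k] by simp
  have def1: "(\<lambda>t. deform C e t i j) \<in> ?R" for i j
    unfolding deform_def by (intro rational_closure.mult rational_closure.const pow)
  have def2: "(\<lambda>t. deform' C e t i j) \<in> ?R" for i j
    unfolding deform'_def of_real_mult by (intro rational_closure.mult rational_closure.const pow)
  have wt: "(\<lambda>t. weight (deform C e t) (\<gamma> t) i j) \<in> ?R" for i j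
    unfolding weight_def by (intro rational_closure.add rational_closure.mult def1 ratio)
  have lap: "(\<lambda>t. laplacian (deform C e t) (\<gamma> t) $ i $ j) \<in> ?R" for i j
    unfolding laplacian_def vec_lambda_beta
    by (cases "i = j") (auto intro!: rational_closure_diff rational_closure_sum rational_closure_uminus rational_closure.const wt)
  have rhs: "(\<lambda>t. - flow (deform' C e t) (\<gamma> t) $ i) \<in> ?R" for i
    unfolding flow_def vec_lambda_beta
    by (intro rational_closure_uminus rational_closure_sum rational_closure_diff rational_closure.mult def2 ratio)
  \<comment> \<open>The Laplacian with its column \<open>k\<close> replaced by the negative
    derivative of the flow in \<open>t\<close>, as in Cramer's rule.\<close>
  define M where "M t k = (\<chi> i j. if j = k then (- flow (deform' C e t) (\<gamma> t)) $ i
      else laplacian (deform C e t) (\<gamma> t) $ i $ j)" for t and k :: 'n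
  have M: "(\<lambda>t. M t k $ i $ j) \<in> ?R" for i j k
    unfolding M_def vec_lambda_beta using lap rhs by (cases "j = k") auto
  \<comment> \<open>Cramer's rule yields the logarithmic derivative; the factor
    \<open>\<gamma> t $ k\<close> turns it into the derivative itself.\<close>
  define D where "D k t = \<gamma> t $ k * (det (M t k) / det (laplacian (deform C e t) (\<gamma> t)))"
    for k t
  have D: "D k \<in> ?R" for k
    unfolding D_def[abs_def]
    by (intro rational_closure.mult rational_closure_divide rational_closure_det M lap comp det)
  have der: "((\<lambda>t. \<gamma> t $ k) has_vector_derivative D k t) (at t)" if t: "t \<in> J" for k t
  proof -
    obtain v where v: "(\<gamma> has_vector_derivative v) (at t)"
      using branch_differentiable[OF J t cont sol det] by blast
    let ?w = "(\<chi> k. v $ k / \<gamma> t $ k) :: complex ^ 'n"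
    let ?L = "laplacian (deform C e t) (\<gamma> t)"
    have "((\<lambda>t. (\<gamma> t, t)) has_derivative (\<lambda>h. (h *\<^sub>R v, h))) (at t)"
      using v unfolding has_vector_derivative_def by (intro derivative_intros)
    from has_derivative_compose[OF this has_derivative_flow] sol[OF t]
    have "((\<lambda>t. flow (deform C e t) (\<gamma> t)) has_derivative
        (\<lambda>h. ?L *v (\<chi> k. (h *\<^sub>R v) $ k / \<gamma> t $ k) + h *\<^sub>R flow (deform' C e t) (\<gamma> t))) (at t)"
      by simp
    \<comment> \<open>Along a branch the flow is constantly \<open>\<omega>\<close>; comparing the
      two derivatives gives the linear system for the logarithmic velocity.\<close>
    moreover have "((\<lambda>t. flow (deform C e t) (\<gamma> t)) has_derivative (\<lambda>h. 0)) (at t)"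
      by (rule has_derivative_transform_within_open[OF has_derivative_const[of \<omega>] J t]) (use sol in auto)
    ultimately have "(\<lambda>h. ?L *v (\<chi> k. (h *\<^sub>R v) $ k / \<gamma> t $ k) + h *\<^sub>R flow (deform' C e t) (\<gamma> t)) = (\<lambda>h. 0)"
      by (rule has_derivative_unique)
    from fun_cong[OF this, of 1] have "?L *v ?w = - flow (deform' C e t) (\<gamma> t)"
      by (simp add: eq_neg_iff_add_eq_0)
    then have "?w = (\<chi> k. det (M t k) / det ?L)"
      unfolding M_def using cramer[OF det[OF t]] by blast
    then have "v $ k / \<gamma> t $ k = det (M t k) / det ?L"
      by (simp add: vec_eq_iff)
    moreover have "\<gamma> t $ k \<noteq> 0"
      using sol[OF t] by (simp add: torus_def)
    ultimately have "v $ k = D k t"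
      by (simp add: D_def field_simps)
    then show ?thesis
      using bounded_linear.has_vector_derivative[OF bounded_linear_vec_nth v, of k] by simp
  qed
  consider "f = of_real" | k where "f = (\<lambda>t. \<gamma> t $ k)"
    using f by blast
  then show ?thesis
  proof cases
    case 1
    have "(complex_of_real has_vector_derivative 1) (at t)" for t
      using bounded_linear_imp_has_derivative[OF bounded_linear_of_real]
      by (simp add: has_vector_derivative_def scaleR_conv_of_real)
    then show ?thesis
      unfolding 1 by (intro bexI[of _ "\<lambda>t. 1"] rational_closure.const) auto
  next
    case 2
    then show ?thesis
      using der D by blast
  qed
qed

lemma branch_smooth:
  fixes \<gamma> :: "real \<Rightarrow> complex ^ 'n::finite"
  assumes J: "open J" and cont: "continuous_on J \<gamma>"
    and sol: "\<And>t. t \<in> J \<Longrightarrow> \<gamma> t \<in> torus \<and> flow (deform C e t) (\<gamma> t) = \<omega>"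
    and det: "\<And>t. t \<in> J \<Longrightarrow> det (laplacian (deform C e t) (\<gamma> t)) \<noteq> 0"
    and x: "\<And>i. (\<lambda>t. x t $ i) \<in> rational_closure J (insert of_real (range (\<lambda>i t. \<gamma> t $ i)))"
  shows "smooth_curve_on J x"
  by (rule smooth_curve_on_rational_closure[OF branch_rational[OF J cont sol det] x])

section \<open>Continuation of branches\<close>

text \<open>All that continuation needs to know about a solution set: near each of its points it is
  the graph of one continuous function of \<open>t\<close>.\<close>

locale branches =
  fixes S :: "('a::real_normed_vector \<times> real) set"
  assumes local: "\<And>x t. (x, t) \<in> S \<Longrightarrow> \<exists>\<epsilon>>0. \<exists>\<delta> W. open W \<and> (x, t) \<in> W \<and>
      continuous_on (ball t \<epsilon>) \<delta> \<and> (\<forall>s\<in>ball t \<epsilon>. (\<delta> s, s) \<in> S) \<and>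
      (\<forall>(y, s)\<in>S \<inter> W. s \<in> ball t \<epsilon> \<and> y = \<delta> s)"
begin

text \<open>The set where two branches agree is closed by continuity and open by local uniqueness,
  hence all of the connected set \<open>T\<close>.\<close>

lemma branch_unique:
  assumes T: "connected T" and c1: "continuous_on T \<gamma>" and c2: "continuous_on T \<eta>"
    and S: "\<And>t. t \<in> T \<Longrightarrow> (\<gamma> t, t) \<in> S" "\<And>t. t \<in> T \<Longrightarrow> (\<eta> t, t) \<in> S"
    and eq: "t0 \<in> T" "\<gamma> t0 = \<eta> t0" and t: "t \<in> T"
  shows "\<gamma> t = \<eta> t"
proof -
  define A where "A = {t \<in> T. \<gamma> t - \<eta> t = 0}"
  have "closedin (top_of_set T) A"
    unfolding A_def by (intro continuous_closedin_preimage_constant continuous_intros c1 c2)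
  moreover have "openin (top_of_set T) A"
  proof (subst openin_subopen, intro ballI)
    fix s assume s: "s \<in> A"
    then have sT: "s \<in> T" "\<gamma> s = \<eta> s"
      by (auto simp: A_def)
    obtain \<delta> W where W: "open W" "(\<gamma> s, s) \<in> W" and u: "\<forall>(y, r)\<in>S \<inter> W. y = \<delta> r"
      using local[OF S(1)[OF sT(1)]] by (force simp: case_prod_unfold)
    define B where "B = (T \<inter> (\<lambda>r. (\<gamma> r, r)) -` W) \<inter> (T \<inter> (\<lambda>r. (\<eta> r, r)) -` W)"
    have "openin (top_of_set T) B"
      unfolding B_def using W(1)
      by (intro openin_Int continuous_openin_preimage_gen continuous_intros c1 c2)
    moreover have "s \<in> B"
      using sT W(2) by (simp add: B_def)
    moreover have "B \<subseteq> A"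
    proof
      fix r assume r: "r \<in> B"
      then have "(\<gamma> r, r) \<in> S \<inter> W" "(\<eta> r, r) \<in> S \<inter> W" "r \<in> T"
        using S by (auto simp: B_def)
      then have "\<gamma> r = \<delta> r" "\<eta> r = \<delta> r"
        using u by blast+
      then show "r \<in> A"
        using \<open>r \<in> T\<close> by (simp add: A_def)
    qed
    ultimately show "\<exists>B. openin (top_of_set T) B \<and> s \<in> B \<and> B \<subseteq> A"
      by blast
  qed
  ultimately have "A = {} \<or> A = T"
    using T connected_clopen by blast
  then show ?thesis
    using eq t by (auto simp: A_def)
qed

text \<open>A Lebesgue number argument: finitely many local branches cover the compact piece, and
  the smallest of their halved radii serves for all of its points.\<close>

lemma uniform_radius:
  assumes "compact (S \<inter> UNIV \<times> {a..b})"
  shows "\<exists>\<epsilon>>0. \<forall>(x, t)\<in>S. t \<in> {a..b} \<longrightarrow>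
    (\<exists>\<delta>. continuous_on (ball t \<epsilon>) \<delta> \<and> \<delta> t = x \<and> (\<forall>s\<in>ball t \<epsilon>. (\<delta> s, s) \<in> S))"
proof (cases "S \<inter> UNIV \<times> {a..b} = {}")
  case False
  let ?C = "S \<inter> UNIV \<times> {a..b}"
  have "\<forall>p\<in>?C. \<exists>q. fst q > (0::real) \<and> open (snd (snd q)) \<and> p \<in> snd (snd q) \<and>
      continuous_on (ball (snd p) (fst q)) (fst (snd q)) \<and>
      (\<forall>s\<in>ball (snd p) (fst q). (fst (snd q) s, s) \<in> S) \<and>
      (\<forall>(y, s)\<in>S \<inter> snd (snd q). s \<in> ball (snd p) (fst q) \<and> y = fst (snd q) s)"
  proof
    fix p assume "p \<in> ?C"
    then obtain \<epsilon> \<delta> W where "\<epsilon> > 0 \<and> open W \<and> p \<in> W \<and>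
      continuous_on (ball (snd p) \<epsilon>) \<delta> \<and> (\<forall>s\<in>ball (snd p) \<epsilon>. (\<delta> s, s) \<in> S) \<and>
      (\<forall>(y, s)\<in>S \<inter> W. s \<in> ball (snd p) \<epsilon> \<and> y = \<delta> s)"
      using local[of "fst p" "snd p"] by auto
    then show "\<exists>q. fst q > (0::real) \<and> open (snd (snd q)) \<and> p \<in> snd (snd q) \<and>
      continuous_on (ball (snd p) (fst q)) (fst (snd q)) \<and>
      (\<forall>s\<in>ball (snd p) (fst q). (fst (snd q) s, s) \<in> S) \<and>
      (\<forall>(y, s)\<in>S \<inter> snd (snd q). s \<in> ball (snd p) (fst q) \<and> y = fst (snd q) s)"
      by (intro exI[of _ "(\<epsilon>, \<delta>, W)"]) simp
  qed
  then obtain Q where Q: "\<forall>p\<in>?C. fst (Q p) > (0::real) \<and> open (snd (snd (Q p))) \<and> p \<in> snd (snd (Q p)) \<and>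
      continuous_on (ball (snd p) (fst (Q p))) (fst (snd (Q p))) \<and>
      (\<forall>s\<in>ball (snd p) (fst (Q p)). (fst (snd (Q p)) s, s) \<in> S) \<and>
      (\<forall>(y, s)\<in>S \<inter> snd (snd (Q p)). s \<in> ball (snd p) (fst (Q p)) \<and> y = fst (snd (Q p)) s)"
    by (rule bchoice[THEN exE])
  \<comment> \<open>Halving the radius leaves room for a ball around every time in the halved
    ball.\<close>
  define W' where "W' p = snd (snd (Q p)) \<inter> UNIV \<times> ball (snd p) (fst (Q p) / 2)" for p
  have "?C \<subseteq> (\<Union>p\<in>?C. W' p)"
  proof
    fix p assume "p \<in> ?C"
    then have "p \<in> W' p"
      using Q by (auto simp: W'_def mem_Times_iff)
    then show "p \<in> (\<Union>p\<in>?C. W' p)"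
      using \<open>p \<in> ?C\<close> by blast
  qed
  moreover have "\<And>p. p \<in> ?C \<Longrightarrow> open (W' p)"
    using Q unfolding W'_def by (intro open_Int open_Times) auto
  ultimately obtain F where F: "F \<subseteq> ?C" "finite F" "?C \<subseteq> (\<Union>p\<in>F. W' p)"
    using compactE_image[OF assms, of ?C W'] by metis
  have "F \<noteq> {}"
    using False F(3) by auto
  define \<epsilon> where "\<epsilon> = Min ((\<lambda>p. fst (Q p) / 2) ` F)"
  have \<epsilon>: "\<epsilon> > 0"
    unfolding \<epsilon>_def using F \<open>F \<noteq> {}\<close> Q by (subst Min_gr_iff) auto
  have "\<exists>\<delta>. continuous_on (ball t \<epsilon>) \<delta> \<and> \<delta> t = x \<and> (\<forall>s\<in>ball t \<epsilon>. (\<delta> s, s) \<in> S)"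
    if xt: "(x, t) \<in> S" "t \<in> {a..b}" for x t
  proof -
    obtain p where p: "p \<in> F" "(x, t) \<in> W' p"
      using F(3) xt by blast
    then have "p \<in> ?C"
      using F by blast
    have "\<epsilon> \<le> fst (Q p) / 2"
      unfolding \<epsilon>_def using F(2) p(1) by (intro Min_le) auto
    note q = bspec[OF Q \<open>p \<in> ?C\<close>]
    have "ball t \<epsilon> \<subseteq> ball (snd p) (fst (Q p))"
    proof
      fix s assume "s \<in> ball t \<epsilon>"
      then have "dist t s < fst (Q p) / 2" "dist (snd p) t < fst (Q p) / 2"
        using p(2) \<open>\<epsilon> \<le> fst (Q p) / 2\<close> by (auto simp: W'_def)
      then show "s \<in> ball (snd p) (fst (Q p))"
        using dist_triangle[of "snd p" s t] by auto
    qed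
    moreover have "x = fst (snd (Q p)) t"
      using q xt(1) p(2) by (auto simp: W'_def)
    ultimately show ?thesis
      using q by (intro exI[of _ "fst (snd (Q p))"]) (auto intro: continuous_on_subset)
  qed
  then show ?thesis
    using \<epsilon> by blast
qed (intro exI[of _ 1], auto)

text \<open>The times that can be reached from \<open>t0\<close> form an open and closed subset of
  the positive half-line, because compactness gives a radius of extension that does not shrink on
  the way to a boundary time. Uniqueness lets the partial branches be glued.\<close>

lemma continuation:
  assumes comp: "\<And>a b. 0 < a \<Longrightarrow> compact (S \<inter> UNIV \<times> {a..b})"
    and S0: "(x0, t0) \<in> S" "t0 > 0"
  shows "\<exists>\<gamma>. continuous_on {0<..} \<gamma> \<and> \<gamma> t0 = x0 \<and> (\<forall>t>0. (\<gamma> t, t) \<in> S)"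
proof -
  define P where "P J \<gamma> \<longleftrightarrow> open J \<and> connected J \<and> t0 \<in> J \<and> continuous_on J \<gamma> \<and> \<gamma> t0 = x0 \<and>
    (\<forall>s\<in>J. (\<gamma> s, s) \<in> S)" for J \<gamma>
  have conn_Int: "connected (J \<inter> J')" if "connected J" "connected J'" for J J' :: "real set"
    using that is_interval_Int unfolding is_interval_connected_1[symmetric] by blast
  have agree: "\<gamma> t = \<eta> t" if "P J \<gamma>" "P J' \<eta>" "t \<in> J" "t \<in> J'" for J J' \<gamma> \<eta> t
  proof (rule branch_unique[of "J \<inter> J'" \<gamma> \<eta> t0])
    show "connected (J \<inter> J')"
      using that by (intro conn_Int) (auto simp: P_def)
    show "continuous_on (J \<inter> J') \<gamma>" "continuous_on (J \<inter> J') \<eta>"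
      using that by (auto simp: P_def intro: continuous_on_subset)
  qed (use that in \<open>auto simp: P_def\<close>)
  have extend: "\<exists>\<eta>. P (J \<union> ball t \<epsilon>) \<eta>"
    if J: "P J \<gamma>" and t: "t \<in> J" and \<epsilon>: "\<epsilon> > 0" and \<delta>: "continuous_on (ball t \<epsilon>) \<delta>" "\<delta> t = \<gamma> t"
      "\<forall>s\<in>ball t \<epsilon>. (\<delta> s, s) \<in> S" for J \<gamma> t \<epsilon> \<delta>
  proof -
    define \<eta> where "\<eta> s = (if s \<in> J then \<gamma> s else \<delta> s)" for s
    have JB: "\<gamma> s = \<delta> s" if "s \<in> J" "s \<in> ball t \<epsilon>" for s
    proof (rule branch_unique[of "J \<inter> ball t \<epsilon>" \<gamma> \<delta> t])
      show "connected (J \<inter> ball t \<epsilon>)"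
        using J by (intro conn_Int) (auto simp: P_def)
      show "continuous_on (J \<inter> ball t \<epsilon>) \<gamma>" "continuous_on (J \<inter> ball t \<epsilon>) \<delta>"
        using J \<delta> by (auto simp: P_def intro: continuous_on_subset)
    qed (use that J \<delta> t \<epsilon> in \<open>auto simp: P_def\<close>)
    have "continuous_on J \<eta>"
      using J continuous_on_cong[of J J \<eta> \<gamma>] by (simp add: P_def \<eta>_def)
    moreover have "continuous_on (ball t \<epsilon>) \<eta>"
      using \<delta>(1) continuous_on_cong[of "ball t \<epsilon>" "ball t \<epsilon>" \<eta> \<delta>] JB by (auto simp: \<eta>_def)
    ultimately have "continuous_on (J \<union> ball t \<epsilon>) \<eta>"
      using J by (intro continuous_on_open_Un) (auto simp: P_def)
    moreover have "connected (J \<union> ball t \<epsilon>)"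
      using J t \<epsilon> by (intro connected_Un) (auto simp: P_def)
    ultimately have "P (J \<union> ball t \<epsilon>) \<eta>"
      using J \<delta> by (auto simp: P_def \<eta>_def)
    then show ?thesis
      by blast
  qed
  define T where "T = {t. t > 0 \<and> (\<exists>J \<gamma>. P J \<gamma> \<and> t \<in> J)}"
  have t0: "t0 \<in> T"
  proof -
    obtain \<epsilon> \<delta> where "\<epsilon> > 0" "continuous_on (ball t0 \<epsilon>) \<delta> \<and> \<delta> t0 = x0 \<and> (\<forall>s\<in>ball t0 \<epsilon>. (\<delta> s, s) \<in> S)"
      using uniform_radius[OF comp[OF S0(2)], of t0] S0 by auto
    then have "P (ball t0 \<epsilon>) \<delta>"
      by (auto simp: P_def)
    then show ?thesis
      using S0 \<open>\<epsilon> > 0\<close> by (auto simp: T_def intro!: exI[of _ "ball t0 \<epsilon>"])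
  qed
  \<comment> \<open>A radius that is uniform on \<open>{t / 2..2 * t}\<close> lets any reached time
    close to \<open>t\<close> carry the branch over a whole ball around \<open>t\<close>. This
    yields openness and closedness of \<open>T\<close> at once.\<close>
  have near: "\<exists>\<epsilon>>0. ball t \<epsilon> \<subseteq> {0<..} \<and> (\<forall>s\<in>ball t \<epsilon>. s \<in> T \<longrightarrow> ball t \<epsilon> \<subseteq> T)" if t: "t > 0" for t
  proof -
    obtain \<epsilon> where \<epsilon>: "\<epsilon> > 0" "\<forall>(x, s)\<in>S. s \<in> {t / 2..2 * t} \<longrightarrow>
        (\<exists>\<delta>. continuous_on (ball s \<epsilon>) \<delta> \<and> \<delta> s = x \<and> (\<forall>r\<in>ball s \<epsilon>. (\<delta> r, r) \<in> S))"
      using uniform_radius[OF comp, of "t / 2" "2 * t"] t by auto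
    define \<epsilon>' where "\<epsilon>' = min (\<epsilon> / 2) (t / 2)"
    have pos: "ball t \<epsilon>' \<subseteq> {0<..}"
    proof
      fix s assume "s \<in> ball t \<epsilon>'"
      then have "\<bar>t - s\<bar> < t / 2"
        by (simp add: \<epsilon>'_def dist_real_def)
      then show "s \<in> {0<..}"
        using t by (auto simp: abs_if split: if_splits)
    qed
    moreover have "ball t \<epsilon>' \<subseteq> T" if s: "s \<in> ball t \<epsilon>'" "s \<in> T" for s
    proof -
      obtain J \<gamma> where J: "P J \<gamma>" "s \<in> J"
        using s by (auto simp: T_def)
      have "s \<in> {t / 2..2 * t}"
        using s(1) t by (auto simp: \<epsilon>'_def dist_real_def abs_if split: if_splits)
      moreover have "(\<gamma> s, s) \<in> S"
        using J by (simp add: P_def)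
      ultimately obtain \<delta> where "continuous_on (ball s \<epsilon>) \<delta>" "\<delta> s = \<gamma> s" "\<forall>r\<in>ball s \<epsilon>. (\<delta> r, r) \<in> S"
        using \<epsilon>(2) by blast
      then obtain \<eta> where "P (J \<union> ball s \<epsilon>) \<eta>"
        using extend[OF J \<epsilon>(1)] by blast
      moreover have "ball t \<epsilon>' \<subseteq> ball s \<epsilon>"
      proof
        fix r assume "r \<in> ball t \<epsilon>'"
        then have "dist t r < \<epsilon> / 2" "dist t s < \<epsilon> / 2"
          using s(1) by (simp_all add: \<epsilon>'_def)
        then show "r \<in> ball s \<epsilon>"
          using dist_triangle3[of s r t] by simp
      qed
      ultimately show ?thesis
        using pos by (force simp: T_def)
    qed
    ultimately show ?thesis
      using \<epsilon>(1) t by (intro exI[of _ \<epsilon>']) (auto simp: \<epsilon>'_def)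
  qed
  have "T = {0<..}"
  proof -
    have "open T"
      unfolding open_contains_ball
    proof
      fix t assume t: "t \<in> T"
      then obtain \<epsilon> where "\<epsilon> > 0" "\<forall>s\<in>ball t \<epsilon>. s \<in> T \<longrightarrow> ball t \<epsilon> \<subseteq> T"
        using near[of t] by (auto simp: T_def)
      then show "\<exists>e>0. ball t e \<subseteq> T"
        using t by (intro exI[of _ \<epsilon>]) auto
    qed
    moreover have "open ({0<..} - T)"
      unfolding open_contains_ball
    proof
      fix t assume t: "t \<in> {0<..} - T"
      then obtain \<epsilon> where "\<epsilon> > 0" "ball t \<epsilon> \<subseteq> {0<..}" "\<forall>s\<in>ball t \<epsilon>. s \<in> T \<longrightarrow> ball t \<epsilon> \<subseteq> T"
        using near[of t] by auto
      then show "\<exists>e>0. ball t e \<subseteq> {0<..} - T"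
        using t by (intro exI[of _ \<epsilon>]) (auto dest: centre_in_ball[THEN iffD2])
    qed
    moreover have "T \<subseteq> {0<..}"
      by (auto simp: T_def)
    ultimately show ?thesis
      using connectedD[of "{0<..} :: real set" T "{0<..} - T"] t0 by fastforce
  qed
  then have "\<forall>t\<in>{0<..}. \<exists>q. P (fst q) (snd q) \<and> t \<in> fst q"
    by (auto simp: T_def)
  then obtain q where q: "\<forall>t\<in>{0<..}. P (fst (q t)) (snd (q t)) \<and> t \<in> fst (q t)"
    by (rule bchoice[THEN exE])
  \<comment> \<open>Each time uses a branch chosen for it; these branches all start at
    \<open>x0\<close> and agree where they overlap.\<close>
  define \<gamma> where "\<gamma> t = snd (q t) t" for t
  have \<gamma>: "\<gamma> t = \<eta> t" if "P J \<eta>" "t \<in> J" "t > 0" for J \<eta> t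
    using agree[of "fst (q t)" "snd (q t)" J \<eta> t] q that by (simp add: \<gamma>_def)
  have "isCont \<gamma> t" if "t > 0" for t
  proof -
    obtain J \<eta> where J: "P J \<eta>" "t \<in> J"
      using q \<open>t > 0\<close> by auto
    have "continuous_on (J \<inter> {0<..}) \<gamma>"
    proof -
      have "continuous_on (J \<inter> {0<..}) \<eta>"
        using J by (auto simp: P_def intro: continuous_on_subset)
      then show ?thesis
        using \<gamma>[OF J(1)] by (subst continuous_on_cong[of _ "J \<inter> {0<..}" _ \<eta>]) auto
    qed
    moreover have "open (J \<inter> {0<..})"
      using J by (intro open_Int) (auto simp: P_def)
    ultimately show ?thesis
      using J \<open>t > 0\<close> continuous_on_eq_continuous_at by blast
  qed
  then have "continuous_on {0<..} \<gamma>"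
    by (auto intro: continuous_at_imp_continuous_on)
  moreover have "\<gamma> t0 = x0"
    using q S0(2) unfolding \<gamma>_def P_def by auto
  moreover have "(\<gamma> t, t) \<in> S" if "t > 0" for t
    using q that by (auto simp: \<gamma>_def P_def)
  ultimately show ?thesis
    by blast
qed

end

section \<open>Homotopy and facet system in terms of flows\<close>

text \<open>Summation by parts: a directed edge enters the flow of its tail with a plus sign and
  that of its head with a minus sign, which produces the difference of two columns of
  \<open>M\<close>.\<close>

lemma sum_mcol_flow:
  fixes x :: "complex ^ 'n::finite"
  shows "(\<Sum>(i, j)\<in>A. (mcol M k i - mcol M k j) * c i j * (coord x i / coord x j))
    = (M *v flow (\<lambda>i j. if (i, j) \<in> A then c i j else 0) x) $ k"
proof -
  define g where "g i j = (if (i, j) \<in> A then c i j else 0) * (coord x i / coord x j)" for i j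
  have "(M *v flow (\<lambda>i j. if (i, j) \<in> A then c i j else 0) x) $ k
      = (\<Sum>i\<in>UNIV. mcol M k i * (\<Sum>j\<in>UNIV. g i j - g j i))"
    unfolding matrix_vector_mult_def flow_def vec_lambda_beta g_def sum_node by simp
  also have "\<dots> = (\<Sum>i\<in>UNIV. \<Sum>j\<in>UNIV. mcol M k i * g i j) - (\<Sum>i\<in>UNIV. \<Sum>j\<in>UNIV. mcol M k i * g j i)"
    by (simp add: sum_distrib_left right_diff_distrib sum_subtractf)
  also have "(\<Sum>i\<in>UNIV. \<Sum>j\<in>UNIV. mcol M k i * g j i) = (\<Sum>i\<in>UNIV. \<Sum>j\<in>UNIV. mcol M k j * g i j)"
    by (rule sum.swap)
  also have "(\<Sum>i\<in>UNIV. \<Sum>j\<in>UNIV. mcol M k i * g i j) - (\<Sum>i\<in>UNIV. \<Sum>j\<in>UNIV. mcol M k j * g i j)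
      = (\<Sum>(i, j)\<in>UNIV. (mcol M k i - mcol M k j) * g i j)"
    unfolding sum.cartesian_product UNIV_Times_UNIV
    by (simp add: case_prod_unfold left_diff_distrib sum_subtractf)
  also have "\<dots> = (\<Sum>(i, j)\<in>A. (mcol M k i - mcol M k j) * g i j)"
    by (rule sum.mono_neutral_right) (auto simp: g_def)
  finally show ?thesis
    by (auto simp: g_def mult.assoc intro!: sum.cong)
qed

lemma ccoef_eq: "ccoef M \<omega> k = (M *v \<omega>) $ k"
  by (simp add: ccoef_def matrix_vector_mult_def)

text \<open>Each undirected term splits into two directed ones; the sign of the second is absorbed
  by exchanging the columns of \<open>M\<close>. With \<open>M\<close> factored out, an invertible
  \<open>M\<close> no longer affects the solutions.\<close>

lemma homotopy_eq:
  assumes "simple_graph E" "orientation E D" "(K, \<omega>) \<in> param_space E"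
  shows "homotopy M D K \<omega> x t = M *v ((1 / t) *\<^sub>R \<omega> - flow (coupling E K) x)"
proof -
  have sym: "K $ i $ j = K $ j $ i" for i j
    using assms(3) unfolding param_space_def by blast
  have distr: "(a - b) * c * (p - q) = (a - b) * c * p + (b - a) * c * q" for a b c p q :: complex
    by (simp add: algebra_simps)
  have "(\<Sum>(i, j)\<in>D. acoef M K i j k * (coord x i / coord x j - coord x j / coord x i))
      = (\<Sum>(i, j)\<in>E. (mcol M k i - mcol M k j) * (K $ i $ j / (2 * \<i>)) * (coord x i / coord x j))" for k
    unfolding sum_orientation[OF assms(1,2)] acoef_def
  proof (intro sum.cong refl, clarify)
    fix i j
    show "(mcol M k i - mcol M k j) * (K $ i $ j / (2 * \<i>)) * (coord x i / coord x j - coord x j / coord x i) =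
      (mcol M k i - mcol M k j) * (K $ i $ j / (2 * \<i>)) * (coord x i / coord x j) +
      (mcol M k j - mcol M k i) * (K $ j $ i / (2 * \<i>)) * (coord x j / coord x i)"
      unfolding sym[of j i] by (rule distr)
  qed
  then have "(\<Sum>(i, j)\<in>D. acoef M K i j k * (coord x i / coord x j - coord x j / coord x i))
      = (M *v flow (coupling E K) x) $ k" for k
    unfolding sum_mcol_flow coupling_def[abs_def] by simp
  moreover have "(M *v ((1 / t) *\<^sub>R \<omega>)) $ k = (M *v \<omega>) $ k / of_real t" for k
    by (simp add: matrix_vector_mult_def scaleR_conv_of_real[where 'a = complex] sum_divide_distrib)
  ultimately show ?thesis
    by (simp add: homotopy_def vec_eq_iff ccoef_eq matrix_vector_mult_diff_distrib)
qed

text \<open>\<open>facet_edges F\<close> is defined by membership in \<open>F\<close>, not by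
  adjacency; the intersection with \<open>E\<close> is legitimate because the coefficients of other
  pairs vanish.\<close>

lemma facet_system_eq:
  assumes "orientation E D" "(K, \<omega>) \<in> param_space E"
  shows "facet_system M D K \<omega> F x = M *v (\<omega> - flow (coupling (facet_edges F \<inter> E) K) x)"
proof -
  have sym: "K $ i $ j = K $ j $ i" for i j
    using assms(2) unfolding param_space_def by blast
  have DE: "D \<subseteq> E" and or: "\<And>i j. (i, j) \<in> E \<Longrightarrow> (i, j) \<notin> D \<Longrightarrow> (j, i) \<in> D"
    using assms(1) unfolding orientation_def by blast+
  have b: "bcoef M D K k (i, j) = (mcol M k i - mcol M k j) * (K $ i $ j / (2 * \<i>))" if "(i, j) \<in> E" for i j k
  proof (cases "(i, j) \<in> D")
    case False
    have "- ((mcol M k j - mcol M k i) * (K $ j $ i / (2 * \<i>))) = (mcol M k i - mcol M k j) * (K $ i $ j / (2 * \<i>))"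
      unfolding sym[of j i] by (simp only: mult_minus_left[symmetric] minus_diff_eq)
    then show ?thesis
      using or[OF that False] False by (simp add: bcoef_def acoef_def)
  qed (simp add: bcoef_def acoef_def)
  have b0: "bcoef M D K k (i, j) = 0" if "(i, j) \<notin> E" for i j k
  proof -
    have "K $ j $ i = 0" "K $ i $ j = 0"
      using that assms(2) sym[of j i] unfolding param_space_def by auto
    then show ?thesis
      by (simp add: bcoef_def acoef_def)
  qed
  have "(\<Sum>(i, j)\<in>facet_edges F. bcoef M D K k (i, j) * (coord x i / coord x j))
      = (\<Sum>(i, j)\<in>facet_edges F \<inter> E. bcoef M D K k (i, j) * (coord x i / coord x j))" for k
    by (rule sum.mono_neutral_right) (use b0 in fastforce)+
  also have "\<And>k. \<dots> k = (\<Sum>(i, j)\<in>facet_edges F \<inter> E.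
      (mcol M k i - mcol M k j) * (K $ i $ j / (2 * \<i>)) * (coord x i / coord x j))"
    by (intro sum.cong refl) (auto simp: b)
  finally have "(\<Sum>(i, j)\<in>facet_edges F. bcoef M D K k (i, j) * (coord x i / coord x j))
      = (M *v flow (coupling (facet_edges F \<inter> E) K) x) $ k" for k
    unfolding sum_mcol_flow coupling_def[abs_def] by simp
  then show ?thesis
    by (simp add: facet_system_def vec_eq_iff ccoef_eq matrix_vector_mult_diff_distrib)
qed

lemma invertible_mult_eq_0_iff:
  fixes M :: "complex ^ 'n ^ 'n"
  assumes "invertible M"
  shows "M *v x = 0 \<longleftrightarrow> x = 0"
  using assms det_nonzero_iff_kernel[of M] invertible_det_nz[of M] by auto

section \<open>Solution sets\<close>

abbreviation linear_deform where "linear_deform C \<equiv> deform C (\<lambda>_ _. Suc 0)"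

lemma flow_linear_deform: "flow (linear_deform C t) u = t *\<^sub>R flow C u"
  by (simp add: flow_def deform_def vec_eq_iff scaleR_conv_of_real[where 'a = complex] sum_distrib_left algebra_simps)

lemma laplacian_linear_deform: "laplacian (linear_deform C t) u = t *\<^sub>R laplacian C u"
proof -
  have "weight (linear_deform C t) u i j = of_real t * weight C u i j" for i j
    by (simp add: weight_def deform_def algebra_simps)
  then show ?thesis
    by (simp add: laplacian_def vec_eq_iff scaleR_conv_of_real[where 'a = complex] right_diff_distrib flip: sum_distrib_left)
qed

lemma det_laplacian_linear_deform:
  assumes "t \<noteq> 0" "det (laplacian C u) \<noteq> 0"
  shows "det (laplacian (linear_deform C t) u) \<noteq> 0"
proof -
  have "(t *\<^sub>R laplacian C u) *v x = t *\<^sub>R (laplacian C u *v x)" for x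
    by (simp add: matrix_vector_mult_def vec_eq_iff scaleR_sum_right)
  then show ?thesis
    using assms unfolding det_nonzero_iff_kernel laplacian_linear_deform by simp
qed

lemma linear_deform_solution_iff:
  "t \<noteq> 0 \<Longrightarrow> flow (linear_deform C t) u = \<omega> \<longleftrightarrow> flow C u = (1 / t) *\<^sub>R \<omega>"
  by (auto simp: flow_linear_deform)

text \<open>Bounds on the coordinates and on their inverses confine the solutions to a compact box
  inside the torus, where the flow is continuous and its level set closed.\<close>

lemma compact_solutions:
  fixes \<omega> :: "complex ^ 'n::finite"
  assumes B: "\<And>u t i. t \<in> {a..b} \<Longrightarrow> u \<in> torus \<Longrightarrow> flow (deform C e t) u = \<omega> \<Longrightarrow>
      cmod (u $ i) \<le> B \<and> cmod (1 / u $ i) \<le> B"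
  shows "compact {(u, t). t \<in> {a..b} \<and> u \<in> torus \<and> flow (deform C e t) u = \<omega>}"
proof -
  \<comment> \<open>The maximum with 1 makes the bound positive, so that its inverse is a genuine
    lower bound.\<close>
  define B' where "B' = max B 1"
  define Q where "Q = {u :: complex ^ 'n. \<forall>i. cmod (u $ i) \<le> B' \<and> 1 / B' \<le> cmod (u $ i)}"
  have B': "B' > 0"
    by (simp add: B'_def)
  have Q_torus: "Q \<subseteq> torus"
  proof
    fix u assume "u \<in> Q"
    then have "1 / B' \<le> cmod (u $ i)" for i
      by (simp add: Q_def)
    moreover have "1 / B' > 0"
      using B' by simp
    ultimately have "cmod (u $ i) > 0" for i
      using less_le_trans by blast
    then show "u \<in> torus"
      by (simp add: torus_def)
  qed
  have "closed Q"
    unfolding Q_def by (intro closed_Collect_all closed_Collect_conj closed_Collect_le continuous_intros)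
  moreover have "bounded Q"
  proof (rule bounded_subset[OF bounded_cball[of 0 "\<Sum>i\<in>(UNIV :: 'n set). B'"]], rule subsetI)
    fix u assume "u \<in> Q"
    then have "norm u \<le> (\<Sum>i\<in>UNIV. cmod (u $ i))" "(\<Sum>i\<in>UNIV. cmod (u $ i)) \<le> (\<Sum>i\<in>(UNIV :: 'n set). B')"
      by (auto simp: Q_def norm_vec_def simp del: sum_constant intro!: sum_mono L2_set_le_sum)
    then show "u \<in> cball 0 (\<Sum>i\<in>(UNIV :: 'n set). B')"
      by (simp del: sum_constant)
  qed
  ultimately have comp: "compact (Q \<times> {a..b})"
    by (intro compact_Times compact_Icc) (simp add: compact_eq_bounded_closed)
  have "continuous_on (Q \<times> {a..b}) (\<lambda>p. flow (deform C e (snd p)) (fst p))"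
    using Q_torus by (intro continuous_on_flow continuous_on_deform continuous_intros) auto
  from continuous_closedin_preimage_constant[OF this, of \<omega>]
  have "compact {p \<in> Q \<times> {a..b}. flow (deform C e (snd p)) (fst p) = \<omega>}"
    by (rule closedin_compact[OF comp])
  also have "{p \<in> Q \<times> {a..b}. flow (deform C e (snd p)) (fst p) = \<omega>}
      = {(u, t). t \<in> {a..b} \<and> u \<in> torus \<and> flow (deform C e t) u = \<omega>}"
  proof -
    have "u \<in> Q" if u: "u \<in> torus" "t \<in> {a..b}" "flow (deform C e t) u = \<omega>" for u t
    proof -
      have "cmod (u $ i) \<le> B' \<and> 1 / B' \<le> cmod (u $ i)" for i
      proof -
        have nz: "cmod (u $ i) > 0"
          using u(1) by (simp add: torus_def)
        have "cmod (u $ i) \<le> B'" "1 / cmod (u $ i) \<le> B'"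
          using B[OF u(2,1,3), of i] by (auto simp: B'_def norm_divide)
        then show ?thesis
          using nz B' by (simp add: field_simps)
      qed
      then show ?thesis
        by (simp add: Q_def)
    qed
    then show ?thesis
      using Q_torus by auto
  qed
  finally show ?thesis .
qed

text \<open>The solution set is compact, and nondegenerate solutions are isolated, so it has no
  limit point.\<close>

lemma finite_solutions:
  fixes \<omega> :: "complex ^ 'n::finite"
  assumes B: "\<And>u i. u \<in> torus \<Longrightarrow> flow C u = \<omega> \<Longrightarrow> cmod (u $ i) \<le> B \<and> cmod (1 / u $ i) \<le> B"
    and det: "\<And>u. u \<in> torus \<Longrightarrow> flow C u = \<omega> \<Longrightarrow> det (laplacian C u) \<noteq> 0"
  shows "finite {u \<in> torus. flow C u = \<omega>}"
proof -
  \<comment> \<open>With all exponents 0 nothing depends on \<open>t\<close>, and local uniqueness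
    of branches becomes isolation of the solutions.\<close>
  have C: "deform C (\<lambda>_ _. 0) t = C" for t
    by (simp add: deform_def fun_eq_iff)
  let ?S = "{u \<in> torus. flow C u = \<omega>}"
  have "compact (fst ` {(u, t). t \<in> {0..0::real} \<and> u \<in> torus \<and> flow (deform C (\<lambda>_ _. 0) t) u = \<omega>})"
    by (intro compact_continuous_image compact_solutions[where B = B] continuous_intros) (use B in \<open>auto simp: C\<close>)
  also have "fst ` {(u, t). t \<in> {0..0::real} \<and> u \<in> torus \<and> flow (deform C (\<lambda>_ _. 0) t) u = \<omega>} = ?S"
    by (force simp: C)
  finally have "compact ?S" .
  show ?thesis
  proof (rule ccontr)
    assume "infinite ?S"
    then obtain u where u: "u \<in> ?S" "u islimpt ?S"
      using \<open>compact ?S\<close> unfolding compact_eq_Bolzano_Weierstrass by blast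
    have "u \<in> torus" "flow C u = \<omega>" "det (laplacian C u) \<noteq> 0"
      using u(1) det by auto
    from local_branch[where C = C and e = "\<lambda>_ _. 0" and ?t0.0 = 0, unfolded C, OF this]
    obtain \<epsilon> \<delta> W where "open W" "(u, 0 :: real) \<in> W"
      "\<forall>(v, t)\<in>W. v \<in> torus \<and> flow C v = \<omega> \<longrightarrow> \<bar>t - 0\<bar> < \<epsilon> \<and> v = \<delta> t"
      by blast
    then have W: "open W" "(u, 0 :: real) \<in> W" "\<forall>(v, t)\<in>W. v \<in> torus \<and> flow C v = \<omega> \<longrightarrow> v = \<delta> t"
      by auto
    have "open ((\<lambda>v. (v, 0 :: real)) -` W)"
      by (intro open_vimage W(1) continuous_intros)
    then obtain v where "v \<in> ?S" "(v, 0) \<in> W" "v \<noteq> u"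
      using u(2) W(2) unfolding islimpt_def by auto
    then have "v = \<delta> 0" "u = \<delta> 0"
      using W(2,3) u(1) by blast+
    then show False
      using \<open>v \<noteq> u\<close> by simp
  qed
qed

lemma continuous_on_if_differentiable:
  assumes "\<And>t. t \<in> J \<Longrightarrow> \<exists>v. (f has_vector_derivative v) (at t)"
  shows "continuous_on J f"
  using assms by (meson continuous_at_imp_continuous_on has_vector_derivative_continuous)

lemma branches_linear_deform:
  fixes \<omega> :: "complex ^ 'n::finite"
  assumes det: "\<And>t u. t > 0 \<Longrightarrow> u \<in> torus \<Longrightarrow> flow C u = (1 / t) *\<^sub>R \<omega> \<Longrightarrow> det (laplacian C u) \<noteq> 0"
  shows "branches {(u, t). t > 0 \<and> u \<in> torus \<and> flow (linear_deform C t) u = \<omega>}"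
proof
  fix u0 t0
  let ?S = "{(u, t). t > 0 \<and> u \<in> torus \<and> flow (linear_deform C t) u = \<omega>}"
  assume "(u0, t0) \<in> ?S"
  then have u0: "t0 > 0" "u0 \<in> torus" "flow (linear_deform C t0) u0 = \<omega>"
    by auto
  have "det (laplacian (linear_deform C t0) u0) \<noteq> 0"
    using u0 by (intro det_laplacian_linear_deform det[of t0]) (auto simp: linear_deform_solution_iff[symmetric])
  from local_branch[OF u0(2,3) this] obtain \<epsilon> \<delta> W where W: "\<epsilon> > 0" "open W" "(u0, t0) \<in> W"
    "\<forall>t. \<bar>t - t0\<bar> < \<epsilon> \<longrightarrow> \<delta> t \<in> torus \<and> flow (linear_deform C t) (\<delta> t) = \<omega> \<and> (\<exists>v. (\<delta> has_vector_derivative v) (at t))"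
    "\<forall>(u, t)\<in>W. u \<in> torus \<and> flow (linear_deform C t) u = \<omega> \<longrightarrow> \<bar>t - t0\<bar> < \<epsilon> \<and> u = \<delta> t"
    by blast
  \<comment> \<open>The minimum with \<open>t0\<close> keeps the interval in the positive
    half-line.\<close>
  define \<epsilon>' where "\<epsilon>' = min \<epsilon> t0"
  have \<epsilon>': "\<bar>s - t0\<bar> < \<epsilon> \<and> s > 0" if "s \<in> ball t0 \<epsilon>'" for s
    using that by (auto simp: \<epsilon>'_def dist_real_def abs_if split: if_splits)
  show "\<exists>\<epsilon>>0. \<exists>\<delta> W. open W \<and> (u0, t0) \<in> W \<and> continuous_on (ball t0 \<epsilon>) \<delta> \<and>
      (\<forall>s\<in>ball t0 \<epsilon>. (\<delta> s, s) \<in> ?S) \<and> (\<forall>(y, s)\<in>?S \<inter> W. s \<in> ball t0 \<epsilon> \<and> y = \<delta> s)"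
  proof (intro exI conjI ballI)
    show "\<epsilon>' > 0"
      using W u0 by (simp add: \<epsilon>'_def)
    show "open (W \<inter> UNIV \<times> ball t0 \<epsilon>')"
      using W by (intro open_Int open_Times) auto
    show "continuous_on (ball t0 \<epsilon>') \<delta>"
      using W(4) \<epsilon>' by (intro continuous_on_if_differentiable) blast
    show "(\<delta> s, s) \<in> ?S" if "s \<in> ball t0 \<epsilon>'" for s
      using W(4) \<epsilon>'[OF that] by auto
    show "case p of (y, s) \<Rightarrow> s \<in> ball t0 \<epsilon>' \<and> y = \<delta> s" if "p \<in> ?S \<inter> (W \<inter> UNIV \<times> ball t0 \<epsilon>')" for p
      using W(5) that by auto
  qed (use W u0 in \<open>auto simp: \<epsilon>'_def\<close>)
qed

lemma global_branch:
  fixes \<omega> :: "complex ^ 'n::finite"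
  assumes det: "\<And>t u. t > 0 \<Longrightarrow> u \<in> torus \<Longrightarrow> flow C u = (1 / t) *\<^sub>R \<omega> \<Longrightarrow> det (laplacian C u) \<noteq> 0"
    and bnd: "\<And>a b. a > 0 \<Longrightarrow> \<exists>B. \<forall>t\<in>{a..b}. \<forall>u\<in>torus. flow C u = (1 / t) *\<^sub>R \<omega> \<longrightarrow>
      (\<forall>i. cmod (u $ i) \<le> B \<and> cmod (1 / u $ i) \<le> B)"
    and u0: "t0 > 0" "u0 \<in> torus" "flow C u0 = (1 / t0) *\<^sub>R \<omega>"
  shows "\<exists>\<gamma>. continuous_on {0<..} \<gamma> \<and> \<gamma> t0 = u0 \<and> (\<forall>t>0. \<gamma> t \<in> torus \<and> flow C (\<gamma> t) = (1 / t) *\<^sub>R \<omega>)"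
proof -
  let ?S = "{(u, t). t > 0 \<and> u \<in> torus \<and> flow (linear_deform C t) u = \<omega>}"
  have "compact (?S \<inter> UNIV \<times> {a..b})" if a: "a > 0" for a b
  proof -
    obtain B where B: "\<forall>t\<in>{a..b}. \<forall>u\<in>torus. flow C u = (1 / t) *\<^sub>R \<omega> \<longrightarrow>
        (\<forall>i. cmod (u $ i) \<le> B \<and> cmod (1 / u $ i) \<le> B)"
      using bnd[OF a, of b] by blast
    have "compact {(u, t). t \<in> {a..b} \<and> u \<in> torus \<and> flow (linear_deform C t) u = \<omega>}"
      by (rule compact_solutions[where B = B]) (use B a in \<open>auto simp: linear_deform_solution_iff\<close>)
    also have "{(u, t). t \<in> {a..b} \<and> u \<in> torus \<and> flow (linear_deform C t) u = \<omega>} = ?S \<inter> UNIV \<times> {a..b}"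
      using that by auto
    finally show ?thesis .
  qed
  moreover have "branches ?S"
    by (rule branches_linear_deform) (rule det)
  moreover have "(u0, t0) \<in> ?S"
    using u0 by (simp add: linear_deform_solution_iff)
  ultimately obtain \<gamma> where "continuous_on {0<..} \<gamma>" "\<gamma> t0 = u0" "\<forall>t>0. (\<gamma> t, t) \<in> ?S"
    using branches.continuation[of ?S u0 t0] u0(1) by blast
  then show ?thesis
    by (intro exI[of _ \<gamma>]) (auto simp: linear_deform_solution_iff)
qed

section \<open>Facets of the adjacency polytope\<close>

lemma inner_axis_1: "a \<bullet> axis i (1::real) = a $ i"
  by (simp add: inner_axis)

fun functional :: "real ^ 'n \<Rightarrow> 'n::finite node \<Rightarrow> real" where
  "functional a None = 0"
| "functional a (Some i) = a $ i"

lemma inner_unit_vec: "a \<bullet> (unit_vec i - unit_vec j) = functional a i - functional a j"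
  by (cases i; cases j) (simp_all add: inner_diff_right inner_axis_1)

text \<open>The origin is the midpoint of an edge vector and its reverse. Edge vectors telescope
  along a path to the reference node, so they span all basis vectors.\<close>

lemma aff_dim_adjacency_polytope:
  fixes E :: "('n::finite node \<times> 'n node) set"
  assumes "simple_graph E" and "connected_graph E"
  shows "0 \<in> adjacency_polytope E" "aff_dim (adjacency_polytope E) = int CARD('n)"
proof -
  let ?V = "{unit_vec i - unit_vec j | i j. (i, j) \<in> E} :: (real ^ 'n) set"
  obtain i :: 'n where True by blast
  have "(Some i, None) \<in> E\<^sup>*"
    using assms(2) by (simp add: connected_graph_def)
  then obtain j where j: "(Some i, j) \<in> E"
    by (metis converse_rtranclE option.distinct(1))
  then have "(j, Some i) \<in> E"
    using assms(1) by (auto simp: simple_graph_def dest: symD)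
  then have "unit_vec (Some i) - unit_vec j \<in> convex hull ?V" "unit_vec j - unit_vec (Some i) \<in> convex hull ?V"
    using j by (auto intro!: hull_inc simp del: unit_vec.simps)
  from convexD[OF convex_convex_hull this, of "1 / 2" "1 / 2"]
  show 0: "0 \<in> adjacency_polytope E"
    by (simp add: adjacency_polytope_def algebra_simps)
  have "unit_vec i - unit_vec j \<in> span ?V" if "(i, j) \<in> E\<^sup>*" for i j
    using that
  proof (induction rule: rtrancl_induct)
    case (step k l)
    then have "unit_vec k - unit_vec l \<in> span ?V"
      by (intro span_base) blast
    from span_add[OF step.IH this] show ?case
      by simp
  qed (simp add: span_zero)
  then have "unit_vec (Some i) - unit_vec None \<in> span ?V" for i
    using assms(2) unfolding connected_graph_def by blast
  then have "Basis \<subseteq> span ?V"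
    by (auto simp: Basis_vec_def)
  then have "span Basis \<subseteq> span ?V"
    by (intro span_minimal subspace_span)
  then have "span ?V = UNIV"
    unfolding span_Basis by blast
  moreover have "span ?V \<subseteq> span (adjacency_polytope E)"
    unfolding adjacency_polytope_def by (intro span_mono hull_subset)
  ultimately have "span (adjacency_polytope E) = UNIV"
    by blast
  then have "dim (adjacency_polytope E) = CARD('n)"
    by (metis dim_UNIV dim_span DIM_cart DIM_real mult_1_right)
  then show "aff_dim (adjacency_polytope E) = int CARD('n)"
    using aff_dim_zero[OF hull_inc[OF 0]] by simp
qed

lemma polytope_adjacency_polytope: "polytope (adjacency_polytope E)"
proof -
  have "{unit_vec i - unit_vec j | i j. (i, j) \<in> E} = (\<lambda>(i, j). unit_vec i - unit_vec j) ` E"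
    by auto
  then show ?thesis
    unfolding adjacency_polytope_def by (auto intro: polytope_convex_hull)
qed

text \<open>The supporting hyperplane of the facet misses the origin, so its functional can be
  scaled to the value 1 on the facet.\<close>

lemma facet_functional:
  fixes E :: "('n::finite node \<times> 'n node) set"
  assumes E: "simple_graph E" "connected_graph E" and F: "F facet_of adjacency_polytope E"
  obtains a where "\<And>i j. (i, j) \<in> E \<Longrightarrow> functional a i - functional a j \<le> 1"
    "\<And>i j. (i, j) \<in> E \<Longrightarrow> (i, j) \<in> facet_edges F \<longleftrightarrow> functional a i - functional a j = 1"
    "F \<subseteq> {x. a \<bullet> x = 1}"
proof -
  let ?P = "adjacency_polytope E"
  have F': "F face_of ?P" "F \<noteq> {}" "aff_dim F = aff_dim ?P - 1"
    using F by (auto simp: facet_of_def)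
  have "F exposed_face_of ?P"
    using F'(1) polytope_adjacency_polytope[of E] exposed_face_of_polyhedron polytope_imp_polyhedron by blast
  then obtain a b where ab: "?P \<subseteq> {x. a \<bullet> x \<le> b}" "F = ?P \<inter> {x. a \<bullet> x = b}"
    unfolding exposed_face_of_def by blast
  have inP: "unit_vec i - unit_vec j \<in> ?P" if "(i, j) \<in> E" for i j
    using that unfolding adjacency_polytope_def by (intro hull_inc) blast
  \<comment> \<open>At level 0 the symmetry of the edge vectors would force the functional to vanish
    on the whole polytope, which would then be its own facet.\<close>
  have "b \<noteq> 0"
  proof
    assume "b = 0"
    have "a \<bullet> x = 0" if "x \<in> ?P" for x
    proof -
      have "?P \<subseteq> {x. a \<bullet> x = 0}"
        unfolding adjacency_polytope_def
      proof (rule hull_minimal)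
        show "{unit_vec i - unit_vec j | i j. (i, j) \<in> E} \<subseteq> {x. a \<bullet> x = 0}"
        proof clarify
          fix i j assume ij: "(i, j) \<in> E"
          then have "(j, i) \<in> E"
            using E(1) by (auto simp: simple_graph_def dest: symD)
          then have "a \<bullet> (unit_vec i - unit_vec j) \<le> 0" "a \<bullet> (unit_vec j - unit_vec i) \<le> 0"
            using ab(1) inP ij \<open>b = 0\<close> by blast+
          then show "a \<bullet> (unit_vec i - unit_vec j) = 0"
            by (simp add: inner_diff_right)
        qed
      qed (rule convex_hyperplane)
      then show ?thesis
        using that by blast
    qed
    then have "F = ?P"
      using ab(2) \<open>b = 0\<close> by blast
    then show False
      using F'(3) by simp
  qed
  moreover have "b \<ge> 0"
    using ab(1) aff_dim_adjacency_polytope(1)[OF E] by auto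
  ultimately have b: "b > 0"
    by simp
  let ?a = "(1 / b) *\<^sub>R a"
  show ?thesis
  proof (rule that[of ?a])
    fix i j assume ij: "(i, j) \<in> E"
    show "functional ?a i - functional ?a j \<le> 1"
      using ab(1) inP[OF ij] b unfolding inner_unit_vec[symmetric] by auto
    show "(i, j) \<in> facet_edges F \<longleftrightarrow> functional ?a i - functional ?a j = 1"
      using ab(2) inP[OF ij] b unfolding inner_unit_vec[symmetric] facet_edges_def by auto
  next
    show "F \<subseteq> {x. ?a \<bullet> x = 1}"
      using ab(2) b by auto
  qed
qed

text \<open>A face of the convex hull of a finite set is the convex hull of some of its points; here
  these points are edge vectors lying in \<open>F\<close>.\<close>

lemma facet_subset_hull:
  assumes "F face_of adjacency_polytope E"
  shows "F \<subseteq> convex hull {unit_vec i - unit_vec j | i j. (i, j) \<in> facet_edges F \<inter> E}"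
proof -
  let ?V = "{unit_vec i - unit_vec j | i j. (i, j) \<in> E}"
  have V: "?V = (\<lambda>(i, j). unit_vec i - unit_vec j) ` E"
    by auto
  have "compact ?V"
    unfolding V by (intro finite_imp_compact finite_imageI) simp
  then obtain S where S: "S \<subseteq> ?V" "F = convex hull S"
    using face_of_convex_hull_subset[OF _ assms[unfolded adjacency_polytope_def]] by blast
  then have "S \<subseteq> F"
    by (simp add: hull_subset)
  then have "S \<subseteq> {unit_vec i - unit_vec j | i j. (i, j) \<in> facet_edges F \<inter> E}"
    using S(1) unfolding facet_edges_def by blast
  then show ?thesis
    unfolding S(2) by (rule hull_mono)
qed

text \<open>If the edges of a facet did not connect all nodes, the indicator function of a set of nodes
  without the reference node would be a linear functional vanishing on the facet, which spans
  the whole space.\<close>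

lemma facet_connected:
  fixes E :: "('n::finite node \<times> 'n node) set"
  assumes E: "simple_graph E" "connected_graph E" and F: "F facet_of adjacency_polytope E"
  shows "connected_graph ((facet_edges F \<inter> E) \<union> (facet_edges F \<inter> E)\<inverse>)"
proof -
  let ?A = "facet_edges F \<inter> E"
  let ?R = "(?A \<union> ?A\<inverse>)\<^sup>*"
  have symR: "sym ?R"
    by (intro sym_rtrancl) (auto simp: sym_def)
  have "(None, k) \<in> ?R" for k
  proof (rule ccontr)
    assume k: "(None, k) \<notin> ?R"
    define h :: "real ^ 'n" where "h = (\<chi> i. of_bool ((None, Some i) \<notin> ?R))"
    have fh: "functional h i = of_bool ((None, i) \<notin> ?R)" for i
      by (cases i) (auto simp: h_def)
    have "h \<noteq> 0"
      using k fh[of k] by (cases k) auto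
    have "(None, i) \<in> ?R \<longleftrightarrow> (None, j) \<in> ?R" if "(i, j) \<in> ?A" for i j
      using that by (meson UnI1 UnI2 converse_iff rtrancl.rtrancl_into_rtrancl)
    then have "{unit_vec i - unit_vec j | i j. (i, j) \<in> ?A} \<subseteq> {x. h \<bullet> x = 0}"
      by (auto simp: inner_unit_vec fh)
    then have "convex hull {unit_vec i - unit_vec j | i j. (i, j) \<in> ?A} \<subseteq> {x. h \<bullet> x = 0}"
      by (rule hull_minimal) (rule convex_hyperplane)
    then have "F \<subseteq> {x. h \<bullet> x = 0}"
      using facet_subset_hull F unfolding facet_of_def by blast
    then have "insert 0 F \<subseteq> {x. h \<bullet> x = 0}"
      by simp
    from dim_subset[OF this] have "dim (insert 0 F) \<le> CARD('n) - 1"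
      using dim_hyperplane[OF \<open>h \<noteq> 0\<close>] by simp
    \<comment> \<open>\<open>F\<close> lies in a hyperplane that avoids the origin, so adjoining 0
      raises its affine dimension by one to the full dimension.\<close>
    moreover obtain a where "F \<subseteq> {x. a \<bullet> x = 1}"
      using facet_functional[OF E F] by metis
    then have "affine hull F \<subseteq> {x. a \<bullet> x = 1}"
      by (rule hull_minimal) (rule affine_hyperplane)
    then have "0 \<notin> affine hull F"
      by auto
    then have "aff_dim (insert 0 F) = aff_dim F + 1"
      by (simp add: aff_dim_insert)
    then have "int (dim (insert 0 F)) = int CARD('n)"
      using F aff_dim_adjacency_polytope(2)[OF E] aff_dim_zero[of "insert 0 F"]
      by (simp add: facet_of_def hull_inc)
    ultimately show False
      using zero_less_card_finite[where 'a = 'n] by linarith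
  qed
  then have "(i, j) \<in> ?R" for i j
    using symR by (meson rtrancl_trans symD)
  then show ?thesis
    unfolding connected_graph_def by blast
qed

text \<open>Since the potential changes by one along each facet edge and the facet edges connect all nodes,
  it is integral.\<close>

lemma facet_potential:
  fixes E :: "('n::finite node \<times> 'n node) set"
  assumes E: "simple_graph E" "connected_graph E" and F: "F facet_of adjacency_polytope E"
  obtains \<alpha> :: "'n node \<Rightarrow> int" where "\<alpha> None = 0" "\<And>i j. (i, j) \<in> E \<Longrightarrow> \<bar>\<alpha> i - \<alpha> j\<bar> \<le> 1"
    "\<And>i j. (i, j) \<in> E \<Longrightarrow> (i, j) \<in> facet_edges F \<longleftrightarrow> \<alpha> i - \<alpha> j = -1"
proof -
  obtain a where a: "\<And>i j. (i, j) \<in> E \<Longrightarrow> functional a i - functional a j \<le> 1"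
    "\<And>i j. (i, j) \<in> E \<Longrightarrow> (i, j) \<in> facet_edges F \<longleftrightarrow> functional a i - functional a j = 1"
    using facet_functional[OF E F] by metis
  let ?A = "facet_edges F \<inter> E"
  have "functional a k \<in> \<int>" if "(None, k) \<in> (?A \<union> ?A\<inverse>)\<^sup>*" for k
    using that
  proof (induction rule: rtrancl_induct)
    case (step j k)
    then have "functional a k = functional a j - 1 \<or> functional a k = functional a j + 1"
      using a(2)[of j k] a(2)[of k j] by auto
    then show ?case
      using step.IH by auto
  qed simp
  then have int: "functional a k \<in> \<int>" for k
    using facet_connected[OF E F] unfolding connected_graph_def by blast
  \<comment> \<open>The sign is reversed: the coordinates will grow like
    \<open>t powi \<alpha>\<close>, and a facet edge must have exponent -1 to cancel the factor
    \<open>t\<close> of the homotopy.\<close>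
  define \<alpha> where "\<alpha> i = - \<lfloor>functional a i\<rfloor>" for i
  have \<alpha>: "functional a i = - of_int (\<alpha> i)" for i
    using int[of i] by (simp add: \<alpha>_def)
  show ?thesis
  proof (rule that[of \<alpha>])
    show "\<alpha> None = 0"
      by (simp add: \<alpha>_def)
    fix i j assume ij: "(i, j) \<in> E"
    then have ji: "(j, i) \<in> E"
      using E(1) by (auto simp: simple_graph_def dest: symD)
    show "\<bar>\<alpha> i - \<alpha> j\<bar> \<le> 1"
      using a(1)[OF ij] a(1)[OF ji] unfolding \<alpha> by linarith
    show "(i, j) \<in> facet_edges F \<longleftrightarrow> \<alpha> i - \<alpha> j = -1"
      unfolding a(2)[OF ij] \<alpha> by linarith
  qed
qed

section \<open>Generic rays\<close>

definition scale :: "complex \<Rightarrow> 'n::finite params \<Rightarrow> 'n params" where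
  "scale s p = (fst p, (\<chi> i. s * snd p $ i))"

text \<open>The coefficients in \<open>s\<close> are again polynomials in the parameters, and the
  degree bound is independent of the parameters, so only finitely many exponents occur.\<close>

lemma complex_polynomial_scale:
  assumes "complex_polynomial P"
  shows "\<exists>R N. (\<forall>d. complex_polynomial (\<lambda>p. coeff (R p) d)) \<and> (\<forall>p. degree (R p) \<le> N) \<and>
    (\<forall>p s. P (scale s p) = poly (R p) s)"
  using assms
proof induction
  case (coupling i j)
  have "complex_polynomial (\<lambda>p. coeff [:fst p $ i $ j:] d)" for d
    by (cases d) (auto intro: complex_polynomial.coupling complex_polynomial.const)
  then show ?case
    by (intro exI[of _ "\<lambda>p. [:fst p $ i $ j:]"] exI[of _ 0]) (simp add: scale_def)
next
  case (frequency i)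
  have "complex_polynomial (\<lambda>p. coeff [:0, snd p $ i:] d)" for d
  proof -
    have "coeff [:0, a:] d = (if d = 1 then a else 0)" for a :: complex
      by (auto simp: coeff_pCons split: nat.split)
    then show ?thesis
      by (cases "d = 1") (auto intro: complex_polynomial.frequency complex_polynomial.const)
  qed
  then show ?case
    by (intro exI[of _ "\<lambda>p. [:0, snd p $ i:]"] exI[of _ 1]) (simp add: scale_def)
next
  case (const c)
  show ?case
    by (intro exI[of _ "\<lambda>p. [:c:]"] exI[of _ 0]) (simp add: complex_polynomial.const)
next
  case (add f g)
  then obtain R N R' N' where "(\<forall>d. complex_polynomial (\<lambda>p. coeff (R p) d)) \<and> (\<forall>p. degree (R p) \<le> N) \<and>
      (\<forall>p s. f (scale s p) = poly (R p) s)"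
    "(\<forall>d. complex_polynomial (\<lambda>p. coeff (R' p) d)) \<and> (\<forall>p. degree (R' p) \<le> N') \<and>
      (\<forall>p s. g (scale s p) = poly (R' p) s)"
    by (elim exE)
  then show ?case
    by (intro exI[of _ "\<lambda>p. R p + R' p"] exI[of _ "N + N'"])
      (auto intro!: complex_polynomial.add degree_add_le intro: trans_le_add1 trans_le_add2)
next
  case (mult f g)
  then obtain R N R' N' where "(\<forall>d. complex_polynomial (\<lambda>p. coeff (R p) d)) \<and> (\<forall>p. degree (R p) \<le> N) \<and>
      (\<forall>p s. f (scale s p) = poly (R p) s)"
    "(\<forall>d. complex_polynomial (\<lambda>p. coeff (R' p) d)) \<and> (\<forall>p. degree (R' p) \<le> N') \<and>
      (\<forall>p s. g (scale s p) = poly (R' p) s)"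
    by (elim exE)
  then show ?case
    by (intro exI[of _ "\<lambda>p. R p * R' p"] exI[of _ "N + N'"])
      (auto intro!: complex_polynomial.mult complex_polynomial_sum order_trans[OF degree_mult_le] add_mono simp: coeff_mult)
qed

definition real_imag_polynomial :: "('n::finite params \<Rightarrow> complex) \<Rightarrow> bool" where
  "real_imag_polynomial f \<longleftrightarrow> real_polynomial_function (\<lambda>p. Re (f p)) \<and> real_polynomial_function (\<lambda>p. Im (f p))"

lemma real_imag_polynomial_const: "real_imag_polynomial (\<lambda>p. c)"
  by (simp add: real_imag_polynomial_def real_polynomial_function.intros(2))

lemma real_imag_polynomial_add:
  "real_imag_polynomial f \<Longrightarrow> real_imag_polynomial g \<Longrightarrow> real_imag_polynomial (\<lambda>p. f p + g p)"
  by (auto simp: real_imag_polynomial_def intro: real_polynomial_function.intros(3))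

lemma real_imag_polynomial_mult:
  "real_imag_polynomial f \<Longrightarrow> real_imag_polynomial g \<Longrightarrow> real_imag_polynomial (\<lambda>p. f p * g p)"
  by (auto simp: real_imag_polynomial_def intro!: real_polynomial_function.intros(3) real_polynomial_function_diff
      real_polynomial_function.intros(4))

lemma real_imag_polynomial_cnj: "real_imag_polynomial f \<Longrightarrow> real_imag_polynomial (\<lambda>p. cnj (f p))"
  by (auto simp: real_imag_polynomial_def intro: real_polynomial_function_minus)

lemma real_imag_polynomial_if:
  "real_imag_polynomial f \<Longrightarrow> real_imag_polynomial g \<Longrightarrow> real_imag_polynomial (\<lambda>p. if b then f p else g p)"
  by (cases b) auto

lemma real_imag_polynomial_sum:
  "(\<And>i. i \<in> I \<Longrightarrow> real_imag_polynomial (f i)) \<Longrightarrow> real_imag_polynomial (\<lambda>p. \<Sum>i\<in>I. f i p)"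
  by (induction I rule: infinite_finite_induct) (auto intro: real_imag_polynomial_const real_imag_polynomial_add)

lemma real_imag_polynomial_prod:
  "(\<And>i. i \<in> I \<Longrightarrow> real_imag_polynomial (f i)) \<Longrightarrow> real_imag_polynomial (\<lambda>p. \<Prod>i\<in>I. f i p)"
  by (induction I rule: infinite_finite_induct) (auto intro: real_imag_polynomial_const real_imag_polynomial_mult)

lemma real_imag_polynomial_complex_polynomial:
  assumes "complex_polynomial f"
  shows "real_imag_polynomial f"
  using assms
proof induction
  case (coupling i j)
  have "bounded_linear (\<lambda>p :: 'a params. fst p $ i $ j)"
    by (intro bounded_linear_compose[OF bounded_linear_vec_nth] bounded_linear_fst
        bounded_linear_compose[OF bounded_linear_vec_nth bounded_linear_fst])
  then show ?case
    unfolding real_imag_polynomial_def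
    by (intro conjI real_polynomial_function.intros(1) bounded_linear_compose[OF bounded_linear_Re]
        bounded_linear_compose[OF bounded_linear_Im])
next
  case (frequency i)
  have "bounded_linear (\<lambda>p :: 'a params. snd p $ i)"
    by (intro bounded_linear_compose[OF bounded_linear_vec_nth bounded_linear_snd])
  then show ?case
    unfolding real_imag_polynomial_def
    by (intro conjI real_polynomial_function.intros(1) bounded_linear_compose[OF bounded_linear_Re]
        bounded_linear_compose[OF bounded_linear_Im])
qed (auto intro: real_imag_polynomial_const real_imag_polynomial_add real_imag_polynomial_mult)

lemma real_imag_polynomial_norm:
  assumes "real_imag_polynomial f"
  shows "real_polynomial_function (\<lambda>p. (cmod (f p))\<^sup>2)"
  using assms unfolding real_imag_polynomial_def cmod_power2
  by (intro real_polynomial_function.intros(3) real_polynomial_function_power) auto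

lemma infinite_unit_circle: "infinite (sphere (0::complex) 1)"
proof
  assume "finite (sphere (0::complex) 1)"
  moreover have "connected (sphere (0::complex) 1)"
    by (rule connected_sphere) simp
  ultimately obtain a where "sphere (0::complex) 1 = {a}"
    using connected_finite_iff_sing[of "sphere (0::complex) 1"] by auto
  moreover have "1 \<in> sphere (0::complex) 1" "-1 \<in> sphere (0::complex) 1"
    by auto
  ultimately have "(1::complex) = -1"
    by (metis singletonD)
  then show False
    by simp
qed

lemma resultant_zero_iff_common_root:
  fixes f g :: "complex poly"
  assumes "f \<noteq> 0"
  shows "resultant f g = 0 \<longleftrightarrow> (\<exists>s. poly f s = 0 \<and> poly g s = 0)"
proof
  assume "resultant f g = 0"
  then have "degree (gcd f g) \<noteq> 0"
    by (simp add: resultant_0_gcd)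
  then obtain s where "poly (gcd f g) s = 0"
    using alg_closed_imp_poly_has_root[of "gcd f g"] by auto
  then have "[:-s, 1:] dvd gcd f g"
    by (simp only: poly_eq_0_iff_dvd)
  then have "[:-s, 1:] dvd f \<and> [:-s, 1:] dvd g"
    by (simp only: gcd_greatest_iff)
  then show "\<exists>s. poly f s = 0 \<and> poly g s = 0"
    unfolding poly_eq_0_iff_dvd by blast
next
  assume "\<exists>s. poly f s = 0 \<and> poly g s = 0"
  then obtain s where "[:-s, 1:] dvd gcd f g"
    unfolding poly_eq_0_iff_dvd gcd_greatest_iff by blast
  moreover have "gcd f g \<noteq> 0"
    using assms by simp
  ultimately have "degree [:-s, 1:] \<le> degree (gcd f g)"
    by (intro dvd_imp_degree_le)
  then show "resultant f g = 0"
    by (simp add: resultant_0_gcd)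
qed

lemma poly_map_poly_cnj: "poly (map_poly cnj p) (cnj s) = cnj (poly p s)"
  by (induction p) (simp_all add: map_poly_pCons)

text \<open>A positive zero is real, hence a common zero with the conjugate polynomial, and makes
  the resultant of the two vanish. The resultant involves conjugates, so it is polynomial only in
  the real and imaginary parts of the parameters.\<close>

lemma generic_ray:
  fixes P :: "'n::finite params \<Rightarrow> complex"
  assumes P: "complex_polynomial P" and p0: "p0 \<in> param_space E" "P p0 \<noteq> 0"
  shows "\<exists>T. real_polynomial_function T \<and> (\<exists>p\<in>param_space E. T p \<noteq> 0) \<and>
    (\<forall>p\<in>param_space E. T p \<noteq> 0 \<longrightarrow> (\<forall>s>0. P (scale (of_real s) p) \<noteq> 0))"
proof -
  obtain R N where "(\<forall>d. complex_polynomial (\<lambda>p. coeff (R p) d)) \<and> (\<forall>p. degree (R p) \<le> N) \<and>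
      (\<forall>p s. P (scale s p) = poly (R p) s)"
    using complex_polynomial_scale[OF P] by (elim exE)
  then have R: "\<And>d. complex_polynomial (\<lambda>p. coeff (R p) d)" "\<And>p. degree (R p) \<le> N"
    "\<And>p s. P (scale s p) = poly (R p) s"
    by auto
  define S where "S = {d. \<exists>p\<in>param_space E. coeff (R p) d \<noteq> 0}"
  have "S \<subseteq> {..N}"
    using R(2) le_degree le_trans unfolding S_def by blast
  then have finS: "finite S"
    using finite_subset by blast
  have "S \<noteq> {}"
  proof
    assume "S = {}"
    then have "R p0 = 0"
      using p0 by (auto simp: S_def poly_eq_iff)
    then have "P (scale 1 p0) = 0"
      by (simp add: R)
    moreover have "scale 1 p0 = p0"
      by (simp add: scale_def vec_eq_iff prod_eq_iff)
    ultimately show False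
      using p0 by simp
  qed
  define k where "k = Min S"
  define m where "m = Max S"
  have km: "k \<in> S" "m \<in> S" "\<And>d. d \<in> S \<Longrightarrow> k \<le> d \<and> d \<le> m"
    using finS \<open>S \<noteq> {}\<close> by (auto simp: k_def m_def)
  then have "k \<le> m"
    by blast
  \<comment> \<open>Division by the largest power of \<open>s\<close> common to all parameters
    removes the real root 0, which would make the resultant vanish identically. The upper exponent
    \<open>m\<close> is the generic degree.\<close>
  define q where "q p = (\<Sum>d\<le>m - k. monom (coeff (R p) (d + k)) d)" for p
  have coeff_q: "coeff (q p) d = (if d \<le> m - k then coeff (R p) (d + k) else 0)" for p d
    by (simp add: q_def coeff_sum if_distrib cong: if_cong)
  have deg_q: "degree (q p) \<le> m - k" for p
    by (rule degree_le) (simp add: coeff_q)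
  have Rq: "R p = monom 1 k * q p" if "p \<in> param_space E" for p
  proof (rule poly_eqI)
    fix d
    have "coeff (R p) d = 0" if "\<not> (k \<le> d \<and> d \<le> m)"
      using km(3)[of d] that \<open>p \<in> param_space E\<close> by (auto simp: S_def)
    then show "coeff (R p) d = coeff (monom 1 k * q p) d"
      using \<open>k \<le> m\<close> by (auto simp: coeff_monom_mult coeff_q)
  qed
  let ?M = "m - k"
  define q' where "q' p = map_poly cnj (q p)" for p
  have coeff_q': "coeff (q' p) d = cnj (coeff (q p) d)" for p d
    by (simp add: q'_def coeff_map_poly)
  have ri_q: "real_imag_polynomial (\<lambda>p. coeff (q p) d)" for d
    using real_imag_polynomial_complex_polynomial[OF R(1)] real_imag_polynomial_const[of 0]
    by (cases "d \<le> m - k") (simp_all add: coeff_q)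
  have ri_q': "real_imag_polynomial (\<lambda>p. coeff (q' p) d)" for d
    unfolding coeff_q' by (rule real_imag_polynomial_cnj[OF ri_q])
  \<comment> \<open>The sizes of the Sylvester matrix are fixed, so that its determinant is one
    polynomial in the coefficients even where the degree of \<open>q p\<close> drops.\<close>
  define r where "r p = Determinant.det (sylvester_mat_sub ?M ?M (q p) (q' p))" for p
  have ri_r: "real_imag_polynomial r"
  proof -
    have entry: "real_imag_polynomial (\<lambda>p. sylvester_mat_sub ?M ?M (q p) (q' p) $$ (i, j))"
      if "i < ?M + ?M" "j < ?M + ?M" for i j
      unfolding sylvester_mat_sub_index[OF that]
      by (intro real_imag_polynomial_if ri_q ri_q' real_imag_polynomial_const)
    have "r = (\<lambda>p. \<Sum>\<pi>\<in>{\<pi>. \<pi> permutes {0..<?M + ?M}}. signof \<pi> *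
        (\<Prod>i = 0..<?M + ?M. sylvester_mat_sub ?M ?M (q p) (q' p) $$ (i, \<pi> i)))"
      unfolding r_def by (intro ext det_def' sylvester_mat_sub_carrier)
    moreover have "real_imag_polynomial \<dots>"
    proof (intro real_imag_polynomial_sum real_imag_polynomial_mult real_imag_polynomial_const real_imag_polynomial_prod entry)
      fix \<pi> i assume "\<pi> \<in> {\<pi>. \<pi> permutes {0..<?M + ?M}}" "i \<in> {0..<?M + ?M}"
      then show "i < ?M + ?M" "\<pi> i < ?M + ?M"
        using permutes_in_image[of \<pi> "{0..<?M + ?M}" i] by auto
    qed
    ultimately show ?thesis
      by simp
  qed
  have r_iff: "r p = 0 \<longleftrightarrow> (\<exists>s. poly (q p) s = 0 \<and> poly (q p) (cnj s) = 0)" if "coeff (R p) m \<noteq> 0" for p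
  proof -
    have "coeff (q p) ?M \<noteq> 0"
      using that \<open>k \<le> m\<close> by (simp add: coeff_q)
    then have "degree (q p) = ?M" "q p \<noteq> 0" "coeff (q' p) ?M \<noteq> 0"
      using deg_q[of p] le_degree[of "q p" ?M] by (auto simp: coeff_q')
    moreover have "degree (q' p) = ?M"
      using le_degree[OF \<open>coeff (q' p) ?M \<noteq> 0\<close>] deg_q[of p]
      by (intro antisym degree_le) (auto simp: coeff_q' coeff_q)
    ultimately have "r p = 0 \<longleftrightarrow> (\<exists>s. poly (q p) s = 0 \<and> poly (q' p) s = 0)"
      using resultant_zero_iff_common_root[of "q p" "q' p"] unfolding r_def resultant_def sylvester_mat_def by simp
    moreover have "poly (q' p) s = 0 \<longleftrightarrow> poly (q p) (cnj s) = 0" for s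
      using poly_map_poly_cnj[of "q p" "cnj s"] by (simp add: q'_def)
    ultimately show ?thesis
      by simp
  qed
  \<comment> \<open>Squared moduli turn complex conditions into real polynomials. The factor at
    exponent \<open>m\<close> fixes the degree of \<open>q p\<close>, so that \<open>r\<close> is
    the resultant.\<close>
  define T where "T p = (cmod (coeff (R p) k))\<^sup>2 * (cmod (coeff (R p) m))\<^sup>2 * (cmod (r p))\<^sup>2" for p
  have "real_polynomial_function T"
    unfolding T_def[abs_def]
    by (intro real_polynomial_function.intros(4) real_imag_polynomial_norm ri_r real_imag_polynomial_complex_polynomial R)
  moreover have "P (scale (of_real s) p) \<noteq> 0" if p: "p \<in> param_space E" "T p \<noteq> 0" and s: "s > 0" for p s
  proof
    assume "P (scale (of_real s) p) = 0"
    then have "poly (q p) (of_real s) = 0"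
      using s unfolding R(3) Rq[OF p(1)] by (simp add: poly_monom)
    then have "r p = 0"
      using r_iff[of p] p(2) unfolding T_def by (metis complex_cnj_complex_of_real mult_eq_0_iff norm_eq_zero power_eq_0_iff zero_less_numeral power_zero_numeral)
    then show False
      using p(2) by (simp add: T_def)
  qed
  moreover have "\<exists>p\<in>param_space E. T p \<noteq> 0"
  proof -
    obtain p1 p2 where "p1 \<in> param_space E" "coeff (R p1) k \<noteq> 0" "p2 \<in> param_space E" "coeff (R p2) m \<noteq> 0"
      using km(1,2) by (auto simp: S_def)
    then obtain p where p: "p \<in> param_space E" "coeff (R p) k \<noteq> 0" "coeff (R p) m \<noteq> 0"
      using complex_polynomial_mult_nonzero[OF R(1) R(1), of p1 E k p2 m] by auto
    define Z where "Z = {s. poly (q p) s = 0}"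
    have "q p \<noteq> 0"
      using p(2) coeff_q[of p 0] by auto
    then have "finite Z"
      by (simp add: Z_def poly_roots_finite)
    then have "finite ((\<lambda>(x, y). x / cnj y) ` (Z \<times> Z))"
      by simp
    \<comment> \<open>Multiplying \<omega> by a square root \<open>l\<close> of \<mu> divides the
      roots by \<open>l\<close>. A conjugate pair of new roots would exhibit \<mu> as a quotient
      \<open>x / cnj y\<close> of old roots, and only finitely many such quotients exist on the
      infinite unit circle.\<close>
    then obtain \<mu> where \<mu>: "cmod \<mu> = 1" "\<mu> \<notin> (\<lambda>(x, y). x / cnj y) ` (Z \<times> Z)"
      using infinite_unit_circle finite_subset[of "sphere 0 1"] by (metis dist_0_norm mem_sphere subsetI)
    define l where "l = csqrt \<mu>"
    have l2: "l\<^sup>2 = \<mu>"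
      by (simp add: l_def)
    then have "(cmod l)\<^sup>2 = 1"
      using \<mu>(1) by (simp flip: norm_power)
    then have l1: "cmod l = 1"
      by (simp add: power2_eq_1_iff) (use norm_ge_zero[of l] in linarith)
    then have l0: "l \<noteq> 0"
      by auto
    define p' where "p' = scale l p"
    have p': "p' \<in> param_space E"
      using p(1) by (auto simp: p'_def scale_def param_space_def case_prod_unfold)
    have "poly (R p') s = poly (pcompose (R p) [:0, l:]) s" for s
    proof -
      have "scale s p' = scale (s * l) p"
        by (simp add: p'_def scale_def vec_eq_iff mult.assoc)
      then show ?thesis
        by (simp add: poly_pcompose mult.commute flip: R(3))
    qed
    then have R': "R p' = pcompose (R p) [:0, l:]"
      by (simp add: fun_eq_iff flip: poly_eq_poly_eq_iff)
    have c': "coeff (R p') d = l ^ d * coeff (R p) d" for d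
      by (simp add: R' coeff_pcompose_linear)
    have root: "l * s \<in> Z" if "poly (q p') s = 0" for s
    proof -
      have "q p' = smult (l ^ k) (pcompose (q p) [:0, l:])"
        by (rule poly_eqI) (simp add: coeff_q c' coeff_pcompose_linear power_add mult_ac)
      then show ?thesis
        using that l0 by (simp add: Z_def poly_pcompose mult.commute)
    qed
    have "r p' \<noteq> 0"
    proof
      assume "r p' = 0"
      then obtain s where s: "poly (q p') s = 0" "poly (q p') (cnj s) = 0"
        using r_iff[of p'] c'[of m] p(3) l0 by auto
      \<comment> \<open>The constant coefficient of \<open>q p'\<close> is a nonzero multiple of the
        coefficient of \<open>R p\<close> at \<open>k\<close>, which is nonzero by the choice of
        \<open>p\<close>.\<close>
      have "s \<noteq> 0"
      proof
        assume "s = 0"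
        then have "coeff (q p') 0 = 0"
          using s(1) by (simp add: poly_0_coeff_0)
        then show False
          using p(2) l0 by (simp add: coeff_q c')
      qed
      moreover have "l * cnj l = 1"
        using l1 by (simp add: complex_norm_square[symmetric])
      then have "\<mu> * cnj l = l"
        unfolding l2[symmetric] power2_eq_square mult.assoc by simp
      ultimately have eq: "(l * s) / cnj (l * cnj s) = \<mu>"
        using l0 by (simp add: divide_eq_eq)
      have "(l * s, l * cnj s) \<in> Z \<times> Z"
        using root s by blast
      then have "\<mu> \<in> (\<lambda>(x, y). x / cnj y) ` (Z \<times> Z)"
        by (rule image_eqI[rotated]) (simp only: prod.case eq)
      then show False
        using \<mu>(2) by blast
    qed
    then have "T p' \<noteq> 0"
      using p l0 by (simp add: T_def c')
    then show ?thesis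
      using p' by blast
  qed
  ultimately show ?thesis
    by blast
qed

section \<open>Solution curves\<close>

text \<open>The determinant is continuous along the branch, so it stays nonzero after the interval
  is shrunk; smoothness needs this at every time.\<close>

lemma regular_local_branch:
  fixes u0 :: "complex ^ 'n::finite"
  assumes u0: "u0 \<in> torus" "flow (deform C e t0) u0 = \<omega>" "det (laplacian (deform C e t0) u0) \<noteq> 0"
  shows "\<exists>\<epsilon>>0. \<exists>\<delta>. \<delta> t0 = u0 \<and> continuous_on (ball t0 \<epsilon>) \<delta> \<and>
    (\<forall>t\<in>ball t0 \<epsilon>. \<delta> t \<in> torus \<and> flow (deform C e t) (\<delta> t) = \<omega> \<and>
      det (laplacian (deform C e t) (\<delta> t)) \<noteq> 0)"
proof -
  from local_branch[OF u0] obtain \<epsilon> \<delta> W where W: "\<epsilon> > 0" "(u0, t0) \<in> W"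
    "\<forall>t. \<bar>t - t0\<bar> < \<epsilon> \<longrightarrow> \<delta> t \<in> torus \<and> flow (deform C e t) (\<delta> t) = \<omega> \<and> (\<exists>v. (\<delta> has_vector_derivative v) (at t))"
    "\<forall>(u, t)\<in>W. u \<in> torus \<and> flow (deform C e t) u = \<omega> \<longrightarrow> \<bar>t - t0\<bar> < \<epsilon> \<and> u = \<delta> t"
    by blast
  have \<delta>: "\<delta> t0 = u0"
    using W(2,4) u0 by blast
  have ball: "\<bar>t - t0\<bar> < \<epsilon>" if "t \<in> ball t0 \<epsilon>" for t
    using that by (simp add: dist_real_def abs_minus_commute)
  have cont: "continuous_on (ball t0 \<epsilon>) \<delta>"
    using W(3) ball by (intro continuous_on_if_differentiable) blast
  have "continuous_on (ball t0 \<epsilon>) (\<lambda>t. det (laplacian (deform C e t) (\<delta> t)))"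
    using W(3) ball by (intro continuous_on_det_laplacian cont continuous_on_deform continuous_intros) blast
  then have "open (ball t0 \<epsilon> \<inter> (\<lambda>t. det (laplacian (deform C e t) (\<delta> t))) -` (- {0}))"
    by (intro continuous_open_preimage) auto
  moreover have "t0 \<in> ball t0 \<epsilon> \<inter> (\<lambda>t. det (laplacian (deform C e t) (\<delta> t))) -` (- {0})"
    using W(1) u0(3) by (simp add: \<delta>)
  ultimately obtain \<epsilon>' where "\<epsilon>' > 0"
    "ball t0 \<epsilon>' \<subseteq> ball t0 \<epsilon> \<inter> (\<lambda>t. det (laplacian (deform C e t) (\<delta> t))) -` (- {0})"
    using open_contains_ball by blast
  moreover from this(2) have "continuous_on (ball t0 \<epsilon>') \<delta>"
    by (intro continuous_on_subset[OF cont]) blast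
  ultimately show ?thesis
    using W(3) ball \<delta> by (intro exI[of _ \<epsilon>'] conjI exI[of _ \<delta>]) blast+
qed

definition flow_curve :: "('n node \<Rightarrow> 'n node \<Rightarrow> complex) \<Rightarrow> complex ^ 'n::finite \<Rightarrow> real \<Rightarrow> real
    \<Rightarrow> (real \<Rightarrow> complex ^ 'n) \<Rightarrow> bool" where
  "flow_curve C \<omega> a b \<gamma> \<longleftrightarrow> smooth_curve_on {a<..<b} \<gamma> \<and> continuous_on {a<..<b} \<gamma> \<and>
    (\<forall>t\<in>{a<..<b}. \<gamma> t \<in> torus \<and> flow C (\<gamma> t) = (1 / t) *\<^sub>R \<omega>)"

definition puiseux_start :: "(real \<Rightarrow> complex ^ 'n) \<Rightarrow> complex ^ 'n::finite \<Rightarrow> bool" where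
  "puiseux_start \<gamma> y \<longleftrightarrow> (\<exists>\<alpha> :: 'n \<Rightarrow> rat. \<forall>i.
    (\<lambda>t. \<gamma> t $ i - y $ i * of_real (t powr of_rat (\<alpha> i))) \<in> o[at_right 0](\<lambda>t. of_real (t powr of_rat (\<alpha> i))))"

lemma linear_flow_curve:
  fixes \<gamma> :: "real \<Rightarrow> complex ^ 'n::finite"
  assumes "0 \<le> a" and cont: "continuous_on {a<..<b} \<gamma>"
    and sol: "\<And>t. t \<in> {a<..<b} \<Longrightarrow> \<gamma> t \<in> torus \<and> flow C (\<gamma> t) = (1 / t) *\<^sub>R \<omega>"
    and det: "\<And>t. t \<in> {a<..<b} \<Longrightarrow> det (laplacian (linear_deform C t) (\<gamma> t)) \<noteq> 0"
  shows "flow_curve C \<omega> a b \<gamma>"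
proof -
  have "smooth_curve_on {a<..<b} \<gamma>"
  proof (rule branch_smooth[OF open_greaterThanLessThan cont _ det])
    show "\<gamma> t \<in> torus \<and> flow (linear_deform C t) (\<gamma> t) = \<omega>" if "t \<in> {a<..<b}" for t
      using sol[OF that] that assms(1) by (auto simp: linear_deform_solution_iff)
    show "(\<lambda>t. \<gamma> t $ i) \<in> rational_closure {a<..<b} (insert of_real (range (\<lambda>i t. \<gamma> t $ i)))" for i
      by (rule rational_closure.gen) blast
  qed
  then show ?thesis
    using cont sol by (simp add: flow_curve_def)
qed

lemma local_sync_curve:
  fixes z :: "complex ^ 'n::finite"
  assumes z: "z \<in> torus" "flow C z = \<omega>" and det: "det (laplacian C z) \<noteq> 0"
  shows "\<exists>a \<gamma>. 0 \<le> a \<and> a < 1 \<and> flow_curve C \<omega> a 1 \<gamma> \<and> (\<gamma> \<longlongrightarrow> z) (at_left 1)"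
proof -
  have "flow (linear_deform C 1) z = \<omega>"
    using z by (simp add: linear_deform_solution_iff)
  moreover have "det (laplacian (linear_deform C 1) z) \<noteq> 0"
    by (rule det_laplacian_linear_deform[OF one_neq_zero det])
  ultimately obtain \<epsilon> \<delta> where \<delta>: "\<epsilon> > 0" "\<delta> 1 = z" "continuous_on (ball 1 \<epsilon>) \<delta>"
    "\<forall>t\<in>ball 1 \<epsilon>. \<delta> t \<in> torus \<and> flow (linear_deform C t) (\<delta> t) = \<omega> \<and>
      det (laplacian (linear_deform C t) (\<delta> t)) \<noteq> 0"
    using regular_local_branch[OF z(1)] by blast
  define a where "a = max 0 (1 - \<epsilon>)"
  have a: "0 \<le> a" "a < 1"
    using \<delta>(1) by (auto simp: a_def)
  have sub: "{a<..<1} \<subseteq> ball 1 \<epsilon>"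
    by (auto simp: a_def dist_real_def)
  have "flow_curve C \<omega> a 1 \<delta>"
  proof (rule linear_flow_curve[OF a(1)])
    show "continuous_on {a<..<1} \<delta>"
      by (rule continuous_on_subset[OF \<delta>(3) sub])
    fix t assume t: "t \<in> {a<..<1}"
    then have "flow (linear_deform C t) (\<delta> t) = \<omega>" "t > 0"
      using \<delta>(4) sub a by auto
    then show "\<delta> t \<in> torus \<and> flow C (\<delta> t) = (1 / t) *\<^sub>R \<omega>"
      using \<delta>(4) sub t linear_deform_solution_iff[of t C "\<delta> t" \<omega>] by auto
    show "det (laplacian (linear_deform C t) (\<delta> t)) \<noteq> 0"
      using \<delta>(4) sub t by blast
  qed
  moreover have "isCont \<delta> 1"
    by (rule continuous_on_interior[OF \<delta>(3)]) (use \<delta>(1) in simp)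
  then have "(\<delta> \<longlongrightarrow> z) (at_left 1)"
    unfolding isCont_def \<delta>(2) by (rule filterlim_mono[OF _ order_refl at_le]) simp
  ultimately show ?thesis
    using a by blast
qed

text \<open>In the coordinates \<open>u\<^sub>i = x\<^sub>i / t powi \<alpha>\<^sub>i\<close> the equations extend to \<open>t = 0\<close>, where they become
  the facet system.\<close>

lemma local_facet_curve:
  fixes y :: "complex ^ 'n::finite" and \<alpha> :: "'n node \<Rightarrow> int"
  assumes \<alpha>: "\<alpha> None = 0" "\<And>i j. (i, j) \<in> E \<Longrightarrow> \<bar>\<alpha> i - \<alpha> j\<bar> \<le> 1"
    and A: "\<And>i j. (i, j) \<in> A \<longleftrightarrow> (i, j) \<in> E \<and> \<alpha> i - \<alpha> j = -1"
    and y: "y \<in> torus" "flow (coupling A K) y = \<omega>" "det (laplacian (coupling A K) y) \<noteq> 0"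
  shows "\<exists>b \<gamma>. 0 < b \<and> b \<le> 1 \<and> flow_curve (coupling E K) \<omega> 0 b \<gamma> \<and> puiseux_start \<gamma> y"
proof -
  let ?C = "coupling E K"
  \<comment> \<open>On edges the integer is 0, 1 or 2, so \<open>nat\<close> loses nothing; it is 0
    exactly on the facet edges. On other pairs the coupling vanishes.\<close>
  define e where "e i j = nat (1 + \<alpha> i - \<alpha> j)" for i j
  \<comment> \<open>At \<open>t = 0\<close> precisely the terms with exponent 0 survive, because
    \<open>0 ^ 0 = 1\<close>.\<close>
  have e0: "deform ?C e 0 = coupling A K"
  proof (intro ext)
    fix i j
    show "deform ?C e 0 i j = coupling A K i j"
      using \<alpha>(2)[of i j] A[of i j]
      by (cases "(i, j) \<in> E"; cases "\<alpha> i - \<alpha> j = -1") (auto simp: deform_def coupling_def e_def)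
  qed
  obtain \<epsilon> \<delta> where \<delta>: "\<epsilon> > 0" "\<delta> 0 = y" "continuous_on (ball 0 \<epsilon>) \<delta>"
    "\<forall>t\<in>ball 0 \<epsilon>. \<delta> t \<in> torus \<and> flow (deform ?C e t) (\<delta> t) = \<omega> \<and>
      det (laplacian (deform ?C e t) (\<delta> t)) \<noteq> 0"
    using regular_local_branch[of y ?C e 0 \<omega>] y unfolding e0 by blast
  define b where "b = min \<epsilon> 1"
  have b: "0 < b" "b \<le> 1"
    using \<delta>(1) by (auto simp: b_def)
  have sub: "{0<..<b} \<subseteq> ball 0 \<epsilon>"
    by (auto simp: b_def dist_real_def)
  define \<gamma> where "\<gamma> t = (\<chi> i. \<delta> t $ i * of_real (t powi \<alpha> (Some i)))" for t
  have coord: "coord (\<gamma> t) i = coord (\<delta> t) i * of_real (t powi \<alpha> i)" for t i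
    using \<alpha>(1) by (cases i) (auto simp: \<gamma>_def)
  let ?R = "rational_closure {0<..<b} (insert of_real (range (\<lambda>i t. \<delta> t $ i)))"
  have id: "of_real \<in> ?R" and \<delta>R: "(\<lambda>t. \<delta> t $ i) \<in> ?R" for i
    by (rule rational_closure.gen, simp)+
  have pow: "(\<lambda>t. of_real (t powi k)) \<in> ?R" for k
  proof -
    have "(\<lambda>t. inverse (complex_of_real t)) \<in> ?R"
      by (rule rational_closure.inverse[OF id]) simp
    from rational_closure_power[OF this] rational_closure_power[OF id]
    show ?thesis
      by (cases "k \<ge> 0") (simp_all add: power_int_def)
  qed
  have cont\<delta>: "continuous_on {0<..<b} \<delta>"
    by (rule continuous_on_subset[OF \<delta>(3) sub])
  have smooth: "smooth_curve_on {0<..<b} \<gamma>"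
  proof (rule branch_smooth[OF open_greaterThanLessThan cont\<delta>])
    show "\<delta> t \<in> torus \<and> flow (deform ?C e t) (\<delta> t) = \<omega>"
      "det (laplacian (deform ?C e t) (\<delta> t)) \<noteq> 0" if "t \<in> {0<..<b}" for t
      using \<delta>(4) sub that by blast+
    show "(\<lambda>t. \<gamma> t $ i) \<in> ?R" for i
      unfolding \<gamma>_def vec_lambda_beta by (intro rational_closure.mult \<delta>R pow)
  qed
  have cont: "continuous_on {0<..<b} \<gamma>"
    unfolding \<gamma>_def
    by (intro continuous_on_vec_lambda continuous_intros cont\<delta>) auto
  have sol: "\<gamma> t \<in> torus \<and> flow ?C (\<gamma> t) = (1 / t) *\<^sub>R \<omega>" if t: "t \<in> {0<..<b}" for t
  proof -
    have t0: "t > 0" and \<delta>t: "\<delta> t \<in> torus" "flow (deform ?C e t) (\<delta> t) = \<omega>"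
      using t \<delta>(4) sub by auto
    have *: "linear_deform ?C t i j * (coord (\<gamma> t) i / coord (\<gamma> t) j)
        = deform ?C e t i j * (coord (\<delta> t) i / coord (\<delta> t) j)" for i j
    proof (cases "(i, j) \<in> E")
      case True
      then have "t ^ e i j = t powi (1 + \<alpha> i - \<alpha> j)"
        using \<alpha>(2)[OF True] by (simp add: e_def power_int_def)
      also have "\<dots> = t * (t powi \<alpha> i / t powi \<alpha> j)"
        using t0 by (simp add: power_int_add power_int_diff)
      finally show ?thesis
        by (simp add: deform_def coord mult_ac)
    qed (simp add: deform_def coupling_def)
    have "flow (linear_deform ?C t) (\<gamma> t) = flow (deform ?C e t) (\<delta> t)"
      unfolding flow_def * ..
    then have "flow ?C (\<gamma> t) = (1 / t) *\<^sub>R \<omega>"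
      using t0 \<delta>t by (simp add: linear_deform_solution_iff)
    moreover have "\<gamma> t \<in> torus"
      using \<delta>t t0 by (simp add: torus_def \<gamma>_def)
    ultimately show ?thesis
      by blast
  qed
  have "flow_curve ?C \<omega> 0 b \<gamma>"
    using smooth cont sol by (simp add: flow_curve_def)
  moreover have "puiseux_start \<gamma> y"
    unfolding puiseux_start_def
  proof (intro exI allI)
    fix i
    let ?g = "\<lambda>t. complex_of_real (t powr of_rat (of_int (\<alpha> (Some i))))"
    have pos: "eventually (\<lambda>t :: real. t > 0) (at_right 0)"
      by (rule eventually_at_right_less)
    have "isCont \<delta> 0"
      by (rule continuous_on_interior[OF \<delta>(3)]) (use \<delta>(1) in simp)
    then have "(\<delta> \<longlongrightarrow> y) (at_right 0)"
      unfolding isCont_def \<delta>(2) by (rule filterlim_mono[OF _ order_refl at_le]) simp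
    then have "((\<lambda>t. \<delta> t $ i - y $ i) \<longlongrightarrow> 0) (at_right 0)"
      using LIM_zero tendsto_vec_nth by blast
    \<comment> \<open>Relative to the leading power of \<open>t\<close>, the error is the difference
      between the rescaled branch and its value at 0.\<close>
    moreover have "eventually (\<lambda>t. \<delta> t $ i - y $ i = (\<gamma> t $ i - y $ i * ?g t) / ?g t) (at_right 0)"
      using pos by eventually_elim (simp add: \<gamma>_def powr_real_of_int' diff_divide_distrib)
    ultimately have "((\<lambda>t. (\<gamma> t $ i - y $ i * ?g t) / ?g t) \<longlongrightarrow> 0) (at_right 0)"
      by (rule Lim_transform_eventually)
    moreover have "eventually (\<lambda>t. ?g t \<noteq> 0) (at_right 0)"
      using pos by eventually_elim simp
    ultimately show "(\<lambda>t. \<gamma> t $ i - y $ i * ?g t) \<in> o[at_right 0](?g)"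
      by (rule smalloI_tendsto)
  qed
  ultimately show ?thesis
    using b by blast
qed

lemma puiseux_start_cong:
  assumes "puiseux_start \<gamma> y" "b > 0" "\<And>t. t \<in> {0<..<b} \<Longrightarrow> \<gamma> t = \<eta> t"
  shows "puiseux_start \<eta> y"
proof -
  obtain \<alpha> :: "'a \<Rightarrow> rat" where \<alpha>: "\<forall>i. (\<lambda>t. \<gamma> t $ i - y $ i * of_real (t powr of_rat (\<alpha> i)))
      \<in> o[at_right 0](\<lambda>t. of_real (t powr of_rat (\<alpha> i)))"
    using assms(1) unfolding puiseux_start_def by blast
  have ev: "eventually (\<lambda>t. \<gamma> t = \<eta> t) (at_right 0)"
    using eventually_at_right_real[OF assms(2)] by eventually_elim (rule assms(3))
  show ?thesis
    unfolding puiseux_start_def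
  proof (intro exI[of _ \<alpha>] allI)
    fix i
    have "eventually (\<lambda>t. \<gamma> t $ i - y $ i * of_real (t powr of_rat (\<alpha> i))
        = \<eta> t $ i - y $ i * of_real (t powr of_rat (\<alpha> i))) (at_right 0)"
      using ev by eventually_elim simp
    from landau_o.small.in_cong[OF this] \<alpha>[rule_format, of i]
    show "(\<lambda>t. \<eta> t $ i - y $ i * of_real (t powr of_rat (\<alpha> i)))
        \<in> o[at_right 0](\<lambda>t. of_real (t powr of_rat (\<alpha> i)))"
      by (rule iffD1)
  qed
qed

text \<open>The bounds concern intervals away from 0 only: as \<open>t\<close> tends to 0, a
  coordinate of order \<open>t powi \<alpha>\<close> with nonzero exponent tends to 0 or
  infinity.\<close>

definition regular_ray :: "('n node \<Rightarrow> 'n node \<Rightarrow> complex) \<Rightarrow> complex ^ 'n::finite \<Rightarrow> bool" where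
  "regular_ray C \<omega> \<longleftrightarrow>
    (\<forall>t>0. \<forall>u\<in>torus. flow C u = (1 / t) *\<^sub>R \<omega> \<longrightarrow> det (laplacian C u) \<noteq> 0) \<and>
    (\<forall>a>0. \<forall>b. \<exists>B. \<forall>t\<in>{a..b}. \<forall>u\<in>torus. flow C u = (1 / t) *\<^sub>R \<omega> \<longrightarrow>
      (\<forall>i. cmod (u $ i) \<le> B \<and> cmod (1 / u $ i) \<le> B))"

lemma global_flow_curves:
  fixes \<omega> :: "complex ^ 'n::finite"
  assumes ray: "regular_ray C \<omega>" and u0: "t0 > 0" "u0 \<in> torus" "flow C u0 = (1 / t0) *\<^sub>R \<omega>"
  shows "\<exists>\<gamma>. continuous_on {0<..} \<gamma> \<and> \<gamma> t0 = u0 \<and> flow_curve C \<omega> 0 1 \<gamma> \<and>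
    (\<forall>t>0. \<gamma> t \<in> torus \<and> flow C (\<gamma> t) = (1 / t) *\<^sub>R \<omega>)"
proof -
  have "\<exists>\<gamma>. continuous_on {0<..} \<gamma> \<and> \<gamma> t0 = u0 \<and> (\<forall>t>0. \<gamma> t \<in> torus \<and> flow C (\<gamma> t) = (1 / t) *\<^sub>R \<omega>)"
    by (rule global_branch[OF _ _ u0]) (use ray in \<open>auto simp: regular_ray_def\<close>)
  then obtain \<gamma> where \<gamma>: "continuous_on {0<..} \<gamma>" "\<gamma> t0 = u0"
    "\<forall>t>0. \<gamma> t \<in> torus \<and> flow C (\<gamma> t) = (1 / t) *\<^sub>R \<omega>"
    by blast
  have "flow_curve C \<omega> 0 1 \<gamma>"
  proof (rule linear_flow_curve)
    show "continuous_on {0<..<1} \<gamma>"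
      by (rule continuous_on_subset[OF \<gamma>(1)]) auto
    fix t :: real assume t: "t \<in> {0<..<1}"
    then show "\<gamma> t \<in> torus \<and> flow C (\<gamma> t) = (1 / t) *\<^sub>R \<omega>"
      using \<gamma>(3) by simp
    then show "det (laplacian (linear_deform C t) (\<gamma> t)) \<noteq> 0"
      using t ray unfolding regular_ray_def by (intro det_laplacian_linear_deform) auto
  qed simp
  then show ?thesis
    using \<gamma> by blast
qed

text \<open>The continued branch is defined beyond \<open>t = 1\<close>, so its limit there is its
  value.\<close>

lemma global_sync_curve:
  fixes \<omega> :: "complex ^ 'n::finite"
  assumes ray: "regular_ray C \<omega>" and z: "z \<in> torus" "flow C z = \<omega>"
  shows "\<exists>\<gamma>. flow_curve C \<omega> 0 1 \<gamma> \<and> (\<gamma> \<longlongrightarrow> z) (at_left 1)"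
proof -
  have "\<exists>\<gamma>. continuous_on {0<..} \<gamma> \<and> \<gamma> 1 = z \<and> flow_curve C \<omega> 0 1 \<gamma> \<and>
      (\<forall>t>0. \<gamma> t \<in> torus \<and> flow C (\<gamma> t) = (1 / t) *\<^sub>R \<omega>)"
    by (rule global_flow_curves[OF ray _ z(1)]) (use z in auto)
  then obtain \<gamma> where \<gamma>: "continuous_on {0<..} \<gamma>" "\<gamma> 1 = z" "flow_curve C \<omega> 0 1 \<gamma>"
    by blast
  have "isCont \<gamma> 1"
    by (rule continuous_on_interior[OF \<gamma>(1)]) (simp add: interior_open)
  then have "(\<gamma> \<longlongrightarrow> z) (at_left 1)"
    unfolding isCont_def \<gamma>(2) by (rule filterlim_mono[OF _ order_refl at_le]) simp
  then show ?thesis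
    using \<gamma>(3) by blast
qed

text \<open>The branch continued from the point at time \<open>b / 2\<close> agrees with the local
  curve on \<open>{0<..<b}\<close> by uniqueness, and so inherits its asymptotics at 0.\<close>

lemma global_facet_curve:
  fixes \<omega> :: "complex ^ 'n::finite"
  assumes ray: "regular_ray C \<omega>" and b: "0 < b" and \<eta>: "flow_curve C \<omega> 0 b \<eta>" "puiseux_start \<eta> y"
  shows "\<exists>\<gamma>. flow_curve C \<omega> 0 1 \<gamma> \<and> puiseux_start \<gamma> y"
proof -
  let ?S = "{(u, t). t > 0 \<and> u \<in> torus \<and> flow (linear_deform C t) u = \<omega>}"
  have "b / 2 \<in> {0<..<b}"
    using b by simp
  then have "\<eta> (b / 2) \<in> torus" "flow C (\<eta> (b / 2)) = (1 / (b / 2)) *\<^sub>R \<omega>"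
    using \<eta>(1) unfolding flow_curve_def by blast+
  from global_flow_curves[OF ray half_gt_zero[OF b] this]
  obtain \<gamma> where \<gamma>: "continuous_on {0<..} \<gamma>" "\<gamma> (b / 2) = \<eta> (b / 2)" "flow_curve C \<omega> 0 1 \<gamma>"
    "\<forall>t>0. \<gamma> t \<in> torus \<and> flow C (\<gamma> t) = (1 / t) *\<^sub>R \<omega>"
    by blast
  have br: "branches ?S"
    using ray by (intro branches_linear_deform) (auto simp: regular_ray_def)
  have "\<eta> t = \<gamma> t" if "t \<in> {0<..<b}" for t
  proof (rule branches.branch_unique[OF br, of "{0<..<b}" \<eta> \<gamma> "b / 2"])
    show "continuous_on {0<..<b} \<eta>"
      using \<eta>(1) by (simp add: flow_curve_def)
    show "continuous_on {0<..<b} \<gamma>"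
      by (rule continuous_on_subset[OF \<gamma>(1)]) auto
    show "(\<eta> s, s) \<in> ?S" if "s \<in> {0<..<b}" for s
      using \<eta>(1) that unfolding flow_curve_def by (auto simp: linear_deform_solution_iff)
    show "(\<gamma> s, s) \<in> ?S" if "s \<in> {0<..<b}" for s
      using \<gamma>(4) that by (auto simp: linear_deform_solution_iff)
  qed (use that b \<gamma>(2) in auto)
  then show ?thesis
    using puiseux_start_cong[OF \<eta>(2) b] \<gamma>(3) by blast
qed

section \<open>Assembling the finite family of curves\<close>

text \<open>One curve is chosen for each solution at \<open>t = 1\<close> and one for each facet
  with a solution of its system. The intervals \<open>U\<close> are a parameter, so both versions of
  the conclusion share this step.\<close>

lemma has_solution_curvesI:
  fixes E :: "('n::finite node \<times> 'n node) set"
  assumes E: "simple_graph E" and p: "(K, \<omega>) \<in> param_space E" and D: "orientation E D" and M: "invertible M"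
    and fin: "finite {z \<in> torus. flow (coupling E K) z = \<omega>}"
      "\<And>F. F facet_of adjacency_polytope E \<Longrightarrow> finite {y \<in> torus. flow (coupling (facet_edges F \<inter> E) K) y = \<omega>}"
    and sync: "\<And>z. z \<in> torus \<Longrightarrow> flow (coupling E K) z = \<omega> \<Longrightarrow>
      \<exists>a \<gamma>. (a, 1) \<in> U \<and> flow_curve (coupling E K) \<omega> a 1 \<gamma> \<and> (\<gamma> \<longlongrightarrow> z) (at_left 1)"
    and facet: "\<And>F y. F facet_of adjacency_polytope E \<Longrightarrow> y \<in> torus \<Longrightarrow>
      flow (coupling (facet_edges F \<inter> E) K) y = \<omega> \<Longrightarrow>
      \<exists>b \<gamma>. (0, b) \<in> U \<and> flow_curve (coupling E K) \<omega> 0 b \<gamma> \<and> puiseux_start \<gamma> y"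
  shows "has_solution_curves U E K \<omega> M D"
proof -
  let ?C = "coupling E K"
  define Z where "Z = {z \<in> torus. flow ?C z = \<omega>}"
  define Y where "Y = (SIGMA F:{F. F facet_of adjacency_polytope E}.
    {y \<in> torus. flow (coupling (facet_edges F \<inter> E) K) y = \<omega>})"
  have "\<forall>z\<in>Z. \<exists>g. (fst g, fst (snd g)) \<in> U \<and> fst (snd g) = 1 \<and>
      flow_curve ?C \<omega> (fst g) (fst (snd g)) (snd (snd g)) \<and> (snd (snd g) \<longlongrightarrow> z) (at_left 1)"
    using sync unfolding Z_def by fastforce
  then obtain g where g: "\<forall>z\<in>Z. (fst (g z), fst (snd (g z))) \<in> U \<and> fst (snd (g z)) = 1 \<and>
      flow_curve ?C \<omega> (fst (g z)) (fst (snd (g z))) (snd (snd (g z))) \<and> (snd (snd (g z)) \<longlongrightarrow> z) (at_left 1)"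
    by (rule bchoice[THEN exE])
  have "\<forall>q\<in>Y. \<exists>h. (fst h, fst (snd h)) \<in> U \<and> fst h = 0 \<and>
      flow_curve ?C \<omega> (fst h) (fst (snd h)) (snd (snd h)) \<and> puiseux_start (snd (snd h)) (snd q)"
    using facet unfolding Y_def by fastforce
  then obtain h where h: "\<forall>q\<in>Y. (fst (h q), fst (snd (h q))) \<in> U \<and> fst (h q) = 0 \<and>
      flow_curve ?C \<omega> (fst (h q)) (fst (snd (h q))) (snd (snd (h q))) \<and> puiseux_start (snd (snd (h q))) (snd q)"
    by (rule bchoice[THEN exE])
  define \<Gamma> where "\<Gamma> = g ` Z \<union> h ` Y"
  have "finite Y"
    unfolding Y_def using fin(2) finite_polytope_facets[OF polytope_adjacency_polytope] by (intro finite_SigmaI) auto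
  then have "finite \<Gamma>"
    using fin(1) by (simp add: \<Gamma>_def Z_def)
  moreover have "(a, b) \<in> U \<and> solution_curve M D K \<omega> (a, b, \<gamma>)" if curve: "(a, b, \<gamma>) \<in> \<Gamma>" for a b \<gamma>
  proof -
    consider z where "z \<in> Z" "(a, b, \<gamma>) = g z" | q where "q \<in> Y" "(a, b, \<gamma>) = h q"
      using curve unfolding \<Gamma>_def by blast
    then have "(a, b) \<in> U \<and> flow_curve ?C \<omega> a b \<gamma>"
    proof cases
      case 1
      then show ?thesis
        using bspec[OF g 1(1)] unfolding 1(2)[symmetric] by auto
    next
      case 2
      then show ?thesis
        using bspec[OF h 2(1)] unfolding 2(2)[symmetric] by auto
    qed
    then show ?thesis
      by (auto simp: solution_curve_def flow_curve_def homotopy_eq[OF E D p] invertible_mult_eq_0_iff[OF M])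
  qed
  moreover have "reaches_sync_configs M E K \<omega> \<Gamma>"
    unfolding reaches_sync_configs_def
  proof (intro allI impI)
    fix z assume "z isolated_in {x \<in> torus. unmixed M E K \<omega> x = 0}"
    then have "z \<in> torus" "unmixed M E K \<omega> z = 0"
      by (auto simp: isolated_in_def)
    then have z: "z \<in> Z"
      by (simp add: Z_def unmixed_eq[OF E D p] homotopy_eq[OF E D p] invertible_mult_eq_0_iff[OF M])
    have "g z = (fst (g z), 1, snd (snd (g z)))"
      using g z by (metis prod.collapse)
    then show "\<exists>a \<gamma>. (a, 1, \<gamma>) \<in> \<Gamma> \<and> (\<gamma> \<longlongrightarrow> z) (at_left 1)"
      using g z unfolding \<Gamma>_def by (metis UnI1 imageI)
  qed
  moreover have "reaches_facet_solutions M E D K \<omega> \<Gamma>"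
    unfolding reaches_facet_solutions_def
  proof (intro allI impI)
    fix F y
    assume "F facet_of adjacency_polytope E \<and> y \<in> torus \<and> facet_system M D K \<omega> F y = 0"
    then have q: "(F, y) \<in> Y"
      by (simp add: Y_def facet_system_eq[OF D p] invertible_mult_eq_0_iff[OF M])
    have "h (F, y) = (0, fst (snd (h (F, y))), snd (snd (h (F, y))))"
      using h q by (metis prod.collapse)
    then have "(0, fst (snd (h (F, y))), snd (snd (h (F, y)))) \<in> \<Gamma>"
      using q unfolding \<Gamma>_def by (metis UnI2 imageI)
    moreover have "puiseux_start (snd (snd (h (F, y)))) y"
      using h q by fastforce
    ultimately show "\<exists>b \<gamma>. (0, b, \<gamma>) \<in> \<Gamma> \<and> (\<exists>\<alpha> :: 'n \<Rightarrow> rat. \<forall>i.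
        (\<lambda>t. \<gamma> t $ i - y $ i * of_real (t powr of_rat (\<alpha> i))) \<in> o[at_right 0](\<lambda>t. of_real (t powr of_rat (\<alpha> i))))"
      unfolding puiseux_start_def by blast
  qed
  ultimately show ?thesis
    unfolding has_solution_curves_def by blast
qed

lemma exists_orientation:
  fixes E :: "('n::finite node \<times> 'n node) set"
  assumes "simple_graph E"
  shows "\<exists>D. orientation E D"
proof -
  obtain f :: "'n node \<Rightarrow> nat" where f: "inj f"
    using finite_imp_inj_to_nat_seg[OF finite_class.finite_UNIV] by blast
  have "f i \<noteq> f j" if "(i, j) \<in> E" for i j
    using that assms injD[OF f] by (auto simp: simple_graph_def irrefl_def)
  moreover have "(j, i) \<in> E" if "(i, j) \<in> E" for i j
    using that assms by (auto simp: simple_graph_def dest: symD)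
  ultimately have "orientation E {(i, j) \<in> E. f i < f j}"
    unfolding orientation_def by (auto simp: linorder_neq_iff)
  then show ?thesis
    by blast
qed

text \<open>All connected subgraphs are treated alike; there are finitely many, and they include
  \<open>E\<close> itself and the edge set of every facet.\<close>

definition regular_subnetworks :: "('n node \<times> 'n node) set \<Rightarrow> 'n::finite params set \<Rightarrow> bool" where
  "regular_subnetworks E S \<longleftrightarrow> (\<forall>A\<in>{A. A \<subseteq> E \<and> connected_graph (A \<union> A\<inverse>)}.
    regular_flow_solutions A S \<and> bounded_flow_solutions A S)"

text \<open>The orientation chosen here only names the edge variables. The conclusion does not
  mention it, so a single excluded polynomial serves every \<open>M\<close> and
  \<open>D\<close>.\<close>

lemma generic_regular_subnetworks:
  assumes "simple_graph E"
  shows "generic_compact E (regular_subnetworks E)"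
proof -
  obtain D where "orientation E D"
    using exists_orientation[OF assms] by blast
  then interpret network E D
    using assms by unfold_locales
  show ?thesis
    unfolding regular_subnetworks_def
    by (intro generic_compact_ball generic_compact_conj generic_regular generic_bounded) auto
qed

lemma finite_subnetwork_solutions:
  assumes "regular_subnetworks E {(K, \<omega>)}" "A \<subseteq> E" "connected_graph (A \<union> A\<inverse>)"
  shows "finite {u \<in> torus. flow (coupling A K) u = \<omega>}"
proof -
  have "regular_flow_solutions A {(K, \<omega>)}" "bounded_flow_solutions A {(K, \<omega>)}"
    using assms unfolding regular_subnetworks_def by blast+
  then obtain B where "\<forall>u\<in>torus. flow (coupling A K) u = \<omega> \<longrightarrow> (\<forall>i. cmod (u $ i) \<le> B \<and> cmod (1 / u $ i) \<le> B)"
    and "\<forall>u\<in>torus. flow (coupling A K) u = \<omega> \<longrightarrow> det (laplacian (coupling A K) u) \<noteq> 0"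
    unfolding bounded_flow_solutions_def regular_flow_solutions_def by auto
  then show ?thesis
    by (intro finite_solutions[where B = B]) auto
qed

lemma subnetwork_facet_curve:
  fixes E :: "('n::finite node \<times> 'n node) set"
  assumes E: "simple_graph E" "connected_graph E" and reg: "regular_subnetworks E {(K, \<omega>)}"
    and F: "F facet_of adjacency_polytope E"
    and y: "y \<in> torus" "flow (coupling (facet_edges F \<inter> E) K) y = \<omega>"
  shows "\<exists>b \<gamma>. 0 < b \<and> b \<le> 1 \<and> flow_curve (coupling E K) \<omega> 0 b \<gamma> \<and> puiseux_start \<gamma> y"
proof -
  obtain \<alpha> :: "'n node \<Rightarrow> int" where \<alpha>: "\<alpha> None = 0" "\<And>i j. (i, j) \<in> E \<Longrightarrow> \<bar>\<alpha> i - \<alpha> j\<bar> \<le> 1"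
    "\<And>i j. (i, j) \<in> E \<Longrightarrow> (i, j) \<in> facet_edges F \<longleftrightarrow> \<alpha> i - \<alpha> j = -1"
    using facet_potential[OF E F] by metis
  have "regular_flow_solutions (facet_edges F \<inter> E) {(K, \<omega>)}"
    using reg facet_connected[OF E F] unfolding regular_subnetworks_def by blast
  then have "det (laplacian (coupling (facet_edges F \<inter> E) K) y) \<noteq> 0"
    using y unfolding regular_flow_solutions_def by blast
  then show ?thesis
    using \<alpha> y by (intro local_facet_curve[of \<alpha> E "facet_edges F \<inter> E"]) auto
qed

lemma connected_graph_self: "connected_graph E \<Longrightarrow> connected_graph (E \<union> E\<inverse>)"
  unfolding connected_graph_def using rtrancl_mono[of E "E \<union> E\<inverse>"] by blast

theorem theorem3:
  fixes E :: "('n::finite node \<times> 'n node) set"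
  assumes "simple_graph E" and "connected_graph E"
  shows "generic_complex_alg E (\<lambda>(K, \<omega>). \<forall>M D. invertible M \<and> orientation E D \<longrightarrow>
             has_solution_curves {(a, b). 0 \<le> a \<and> a < b \<and> b \<le> 1} E K \<omega> M D)
       \<and> generic_real_alg E (\<lambda>(K, \<omega>). \<forall>M D. invertible M \<and> orientation E D \<longrightarrow>
             has_solution_curves {(0, 1)} E K \<omega> M D)"
proof
  obtain P p0 where P: "complex_polynomial P" "p0 \<in> param_space E" "P p0 \<noteq> 0"
    "\<And>S. compact S \<Longrightarrow> S \<subseteq> param_space E \<Longrightarrow> \<forall>p\<in>S. P p \<noteq> 0 \<Longrightarrow> regular_subnetworks E S"
    using generic_regular_subnetworks[OF assms(1)] unfolding generic_compact_def by metis
  note conn = connected_graph_self[OF assms(2)]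
  have fin: "finite {z \<in> torus. flow (coupling E K) z = \<omega>}"
    "\<And>F. F facet_of adjacency_polytope E \<Longrightarrow> finite {y \<in> torus. flow (coupling (facet_edges F \<inter> E) K) y = \<omega>}"
    if reg: "regular_subnetworks E {(K, \<omega>)}" for K \<omega>
    using finite_subnetwork_solutions[OF reg] conn facet_connected[OF assms] by blast+
  show "generic_complex_alg E (\<lambda>(K, \<omega>). \<forall>M D. invertible M \<and> orientation E D \<longrightarrow>
      has_solution_curves {(a, b). 0 \<le> a \<and> a < b \<and> b \<le> 1} E K \<omega> M D)"
    unfolding generic_complex_alg_def
  proof (intro exI[of _ P] conjI ballI impI bexI[of _ p0] P(1-3), clarify)
    fix K \<omega> D and M :: "complex ^ 'n ^ 'n"
    assume p: "(K, \<omega>) \<in> param_space E" "P (K, \<omega>) \<noteq> 0" and MD: "invertible M" "orientation E D"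
    have reg: "regular_subnetworks E {(K, \<omega>)}"
      using p by (intro P(4)) auto
    show "has_solution_curves {(a, b). 0 \<le> a \<and> a < b \<and> b \<le> 1} E K \<omega> M D"
    proof (rule has_solution_curvesI[OF assms(1) p(1) MD(2,1) fin[OF reg]])
      fix z :: "complex ^ 'n" assume z: "z \<in> torus" "flow (coupling E K) z = \<omega>"
      moreover have "regular_flow_solutions E {(K, \<omega>)}"
        using reg conn unfolding regular_subnetworks_def by blast
      ultimately have "det (laplacian (coupling E K) z) \<noteq> 0"
        unfolding regular_flow_solutions_def by blast
      then show "\<exists>a \<gamma>. (a, 1) \<in> {(a, b). 0 \<le> a \<and> a < b \<and> b \<le> 1} \<and>
          flow_curve (coupling E K) \<omega> a 1 \<gamma> \<and> (\<gamma> \<longlongrightarrow> z) (at_left 1)"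
        using local_sync_curve[OF z] by auto
    next
      fix F and y :: "complex ^ 'n"
      assume "F facet_of adjacency_polytope E" "y \<in> torus" "flow (coupling (facet_edges F \<inter> E) K) y = \<omega>"
      then show "\<exists>b \<gamma>. (0, b) \<in> {(a, b). 0 \<le> a \<and> a < b \<and> b \<le> 1} \<and>
          flow_curve (coupling E K) \<omega> 0 b \<gamma> \<and> puiseux_start \<gamma> y"
        using subnetwork_facet_curve[OF assms reg] by fastforce
    qed
  qed
  obtain T where T: "real_polynomial_function T" "\<exists>p\<in>param_space E. T p \<noteq> 0"
    "\<And>p s. p \<in> param_space E \<Longrightarrow> T p \<noteq> 0 \<Longrightarrow> s > 0 \<Longrightarrow> P (scale (of_real s) p) \<noteq> 0"
    using generic_ray[OF P(1-3)] by metis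
  show "generic_real_alg E (\<lambda>(K, \<omega>). \<forall>M D. invertible M \<and> orientation E D \<longrightarrow>
      has_solution_curves {(0, 1)} E K \<omega> M D)"
    unfolding generic_real_alg_def
  proof (intro exI[of _ T] conjI ballI impI T(1,2), clarify)
    fix K \<omega> D and M :: "complex ^ 'n ^ 'n"
    assume p: "(K, \<omega>) \<in> param_space E" "T (K, \<omega>) \<noteq> 0" and MD: "invertible M" "orientation E D"
    have scale: "(K, s *\<^sub>R \<omega>) \<in> param_space E \<and> P (K, s *\<^sub>R \<omega>) \<noteq> 0" if "s > 0" for s
    proof -
      have "scale (of_real s) (K, \<omega>) = (K, s *\<^sub>R \<omega>)"
        by (simp add: scale_def vec_eq_iff scaleR_conv_of_real[where 'a = complex])
      then show ?thesis
        using T(3)[OF p that] p(1) by (simp add: param_space_def)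
    qed
    have "regular_subnetworks E {(K, 1 *\<^sub>R \<omega>)}"
      using scale[of 1] by (intro P(4)) auto
    then have reg: "regular_subnetworks E {(K, \<omega>)}"
      by simp
    \<comment> \<open>For \<open>t\<close> in \<open>{a..b}\<close> the parameters
      \<open>(K, (1 / t) *\<^sub>R \<omega>)\<close> form a compact segment of the ray on which
      \<open>P\<close> has no zero, so one bound holds for all these times.\<close>
    have interval: "regular_flow_solutions E ((\<lambda>t. (K, (1 / t) *\<^sub>R \<omega>)) ` {a..b}) \<and>
        bounded_flow_solutions E ((\<lambda>t. (K, (1 / t) *\<^sub>R \<omega>)) ` {a..b})" if a: "a > 0" for a b
    proof -
      have "compact ((\<lambda>t. (K, (1 / t) *\<^sub>R \<omega>)) ` {a..b})"
        using a by (intro compact_continuous_image continuous_intros compact_Icc) auto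
      moreover have "(K, (1 / t) *\<^sub>R \<omega>) \<in> param_space E \<and> P (K, (1 / t) *\<^sub>R \<omega>) \<noteq> 0" if "t \<in> {a..b}" for t
        using that a by (intro scale) auto
      ultimately have "regular_subnetworks E ((\<lambda>t. (K, (1 / t) *\<^sub>R \<omega>)) ` {a..b})"
        by (intro P(4)) auto
      then show ?thesis
        using conn unfolding regular_subnetworks_def by blast
    qed
    have det: "det (laplacian (coupling E K) u) \<noteq> 0"
      if "t > 0" "u \<in> torus" "flow (coupling E K) u = (1 / t) *\<^sub>R \<omega>" for t u
      using interval[OF that(1), of t] that unfolding regular_flow_solutions_def by auto
    have bnd: "\<exists>B. \<forall>t\<in>{a..b}. \<forall>u\<in>torus. flow (coupling E K) u = (1 / t) *\<^sub>R \<omega> \<longrightarrow>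
        (\<forall>i. cmod (u $ i) \<le> B \<and> cmod (1 / u $ i) \<le> B)" if "a > 0" for a b
      using interval[OF that, of b] unfolding bounded_flow_solutions_def by auto
    have ray: "regular_ray (coupling E K) \<omega>"
      using det bnd unfolding regular_ray_def by blast
    show "has_solution_curves {(0, 1)} E K \<omega> M D"
    proof (rule has_solution_curvesI[OF assms(1) p(1) MD(2,1) fin[OF reg]])
      fix z :: "complex ^ 'n" assume z: "z \<in> torus" "flow (coupling E K) z = \<omega>"
      show "\<exists>a \<gamma>. (a, 1) \<in> {(0, 1)} \<and> flow_curve (coupling E K) \<omega> a 1 \<gamma> \<and> (\<gamma> \<longlongrightarrow> z) (at_left 1)"
        using global_sync_curve[OF ray z] by auto
    next
      fix F and y :: "complex ^ 'n"
      assume "F facet_of adjacency_polytope E" "y \<in> torus" "flow (coupling (facet_edges F \<inter> E) K) y = \<omega>"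
      then obtain b \<eta> where "0 < b" "flow_curve (coupling E K) \<omega> 0 b \<eta>" "puiseux_start \<eta> y"
        using subnetwork_facet_curve[OF assms reg] by blast
      then show "\<exists>b \<gamma>. (0, b) \<in> {(0, 1)} \<and> flow_curve (coupling E K) \<omega> 0 b \<gamma> \<and> puiseux_start \<gamma> y"
        using global_facet_curve[OF ray] by auto
    qed
  qed
qed

end
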